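(* Let $d\ge2$ and let $W\in C^1(\mathbb{R}^{d\times d}_{\mathrm{sym},0};\mathbb{R})$ be convex with superlinear growth. Define $$f(\hat\epsilon,\hat\sigma)=W(\hat\epsilon)+W^\ast(\hat\sigma)-\hat\epsilon\cdot\hat\sigma,\qquad \hat\epsilon,\hat\sigma\in\mathbb{R}^{d\times d}_{\mathrm{sym},0}.$$ Then: (i) $f$ is continuous and non-negative; (ii) if, for some $1<p<\infty$ and positive constants $c_1,c_2,c_3$, $c_1(|\hat\epsilon|^p+1)\ge W(\hat\epsilon)\ge c_2|\hat\epsilon|^p-c_3$ for all $\hat\epsilon$, then, with $q=\tfrac{p}{p-1}$, there are positive constants $C_1,\dots,C_4$ such that for all $\hat\epsilon,\hat\sigma$ $$C_1(|\hat\epsilon|^p+|\hat\sigma|^q+1)\ge f(\hat\epsilon,\hat\sigma)\ge C_2(|\hat\epsilon|^p+|\hat\sigma|^q)-C_3-C_4\,\hat\epsilon\cdot\hat\sigma;$$ (iii) for $\hat\epsilon,\hat\sigma\in\mathbb{R}^{d\times d}_{\mathrm{sym},0}$ we have $\hat\sigma=DW(\hat\epsilon)$ if and only if $f(\hat\epsilon,\hat\sigma)=0$; (iv) $f$ is $\widetilde{\mathscr A}$-quasiconvex.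
   Context: $\mathbb{R}^{d\times d}_{\mathrm{sym},0}$ is the space of symmetric trace-free real $d\times d$ matrices with the Frobenius inner product $\hat\epsilon\cdot\hat\sigma$. Superlinear growth means $W(\hat\epsilon)/|\hat\epsilon|\to\infty$ as $|\hat\epsilon|\to\infty$. $W^\ast(\hat\sigma)=\sup_{\hat\epsilon'}\big(\hat\epsilon'\cdot\hat\sigma-W(\hat\epsilon')\big)$ is the convex conjugate. The operator $\widetilde{\mathscr A}$. For smooth $\epsilon,\sigma\colon\mathbb{T}_{d+1}=\mathbb{R}^{d+1}/\mathbb{Z}^{d+1}\to\mathbb{R}^{d\times d}_{\mathrm{sym},0}$ (variables $(t,x)$), $$\widetilde{\mathscr A}(\epsilon,\sigma)=\Big(\partial_t\epsilon-\tfrac12(\nabla+\nabla^T)\,\Pi\,\operatorname{div}\sigma,\ \ \Delta\epsilon-(\nabla+\nabla^T)\operatorname{div}\epsilon\Big),$$ where all spatial operators act in $x$, $(\nabla+\nabla^T)v=\nabla v+(\nabla v)^T$, and $\Pi=\mathrm{Id}-\Delta^{-1}\nabla\operatorname{div}$ is the Leray projector onto divergence-free fields on $\mathbb{T}_d$. A continuous $f\colon\mathbb{R}^{d\times d}_{\mathrm{sym},0}\times\mathbb{R}^{d\times d}_{\mathrm{sym},0}\to[0,\infty)$ is $\widetilde{\mathscr A}$-quasiconvex if for all constant $(\hat\epsilon,\hat\sigma)$ and all $(\epsilon,\sigma)\in C^\infty(\mathbb{T}_{d+1};\mathbb{R}^{d\times d}_{\mathrm{sym},0}\times\mathbb{R}^{d\times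 d}_{\mathrm{sym},0})$ with zero mean over $\mathbb{T}_{d+1}$ and $\widetilde{\mathscr A}(\epsilon,\sigma)=0$ one has $f(\hat\epsilon,\hat\sigma)\le\int_{\mathbb{T}_{d+1}}f(\hat\epsilon+\epsilon,\hat\sigma+\sigma)\,\mathrm d(t,x)$. *)

theory Defs
  imports "HOL-Analysis.Analysis"
begin

section \<open>Symmetric trace-free matrices\<close>

text \<open>On \<open>real ^ 'd ^ 'd\<close> the library's \<open>inner\<close> and \<open>norm\<close> are the Frobenius inner product and norm.\<close>

definition sym0 :: "(real ^ 'd ^ 'd) set" where
  "sym0 = {A. transpose A = A \<and> trace A = 0}"

text \<open>
  A function on \<open>sym0\<close> is represented by a function on all matrices of which only the values on
  \<open>sym0\<close> matter. The gradient is the representative in \<open>sym0\<close> of the derivative relative to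
  \<open>sym0\<close>; it is unique because \<open>sym0\<close> is a subspace.
\<close>

definition grad0 :: "(real ^ 'd ^ 'd \<Rightarrow> real) \<Rightarrow> real ^ 'd ^ 'd \<Rightarrow> real ^ 'd ^ 'd" where
  "grad0 W e = (THE G. G \<in> sym0 \<and> (W has_derivative (\<lambda>h. G \<bullet> h)) (at e within sym0))"

definition C1_sym0 :: "(real ^ 'd ^ 'd \<Rightarrow> real) \<Rightarrow> bool" where
  "C1_sym0 W \<longleftrightarrow> W differentiable_on sym0 \<and> continuous_on sym0 (grad0 W)"

definition superlinear_growth :: "(real ^ 'd ^ 'd \<Rightarrow> real) \<Rightarrow> bool" where
  "superlinear_growth W \<longleftrightarrow>
     filterlim (\<lambda>e. W e / norm e) at_top (inf at_infinity (principal sym0))"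

text \<open>
  The supremum is taken in the reals. For continuous \<open>W\<close> of superlinear growth the set is bounded
  above, so this agrees with the supremum in the extended reals.
\<close>

definition convex_conjugate :: "(real ^ 'd ^ 'd \<Rightarrow> real) \<Rightarrow> real ^ 'd ^ 'd \<Rightarrow> real" where
  "convex_conjugate W s = (SUP e\<in>sym0. e \<bullet> s - W e)"

definition fenchel_defect :: "(real ^ 'd ^ 'd \<Rightarrow> real) \<Rightarrow> real ^ 'd ^ 'd \<Rightarrow> real ^ 'd ^ 'd \<Rightarrow> real"
  where "fenchel_defect W e s = W e + convex_conjugate W s - e \<bullet> s"


section \<open>Functions on the torus\<close>

text \<open>
  Functions on the torus are functions on Euclidean space that are 1-periodic in each coordinate,
  and integrals over the torus are integrals over the unit cube \<open>cbox 0 One\<close>.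
\<close>

definition periodic :: "('a::euclidean_space \<Rightarrow> 'b) \<Rightarrow> bool" where
  "periodic u \<longleftrightarrow> (\<forall>x. \<forall>b\<in>Basis. u (x + b) = u x)"

primrec C_k :: "nat \<Rightarrow> ('a::euclidean_space \<Rightarrow> 'b::real_normed_vector) \<Rightarrow> bool" where
  "C_k 0 u \<longleftrightarrow> continuous_on UNIV u"
| "C_k (Suc n) u \<longleftrightarrow>
     (\<forall>x. u differentiable (at x)) \<and> (\<forall>v. C_k n (\<lambda>x. frechet_derivative u (at x) v))"

definition C_infinity :: "('a::euclidean_space \<Rightarrow> 'b::real_normed_vector) \<Rightarrow> bool" where
  "C_infinity u \<longleftrightarrow> (\<forall>n. C_k n u)"

definition zero_mean :: "('a::euclidean_space \<Rightarrow> 'b::real_normed_vector) \<Rightarrow> bool" where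
  "zero_mean u \<longleftrightarrow> integral (cbox 0 One) u = 0"


section \<open>Spatial differential operators\<close>

definition partial :: "'d \<Rightarrow> (real ^ 'd \<Rightarrow> 'b::real_normed_vector) \<Rightarrow> real ^ 'd \<Rightarrow> 'b" where
  "partial i u x = frechet_derivative u (at x) (axis i 1)"

definition grad :: "(real ^ 'd \<Rightarrow> real) \<Rightarrow> real ^ 'd \<Rightarrow> real ^ 'd" where
  "grad u x = (\<chi> i. partial i u x)"

definition grad_plus_transpose :: "(real ^ 'd \<Rightarrow> real ^ 'd) \<Rightarrow> real ^ 'd \<Rightarrow> real ^ 'd ^ 'd" where
  "grad_plus_transpose v x = jacobian v (at x) + transpose (jacobian v (at x))"

definition vdiv :: "(real ^ 'd \<Rightarrow> real ^ 'd) \<Rightarrow> real ^ 'd \<Rightarrow> real" where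
  "vdiv v x = (\<Sum>i\<in>UNIV. partial i (\<lambda>y. v y $ i) x)"

definition mdiv :: "(real ^ 'd \<Rightarrow> real ^ 'd ^ 'd) \<Rightarrow> real ^ 'd \<Rightarrow> real ^ 'd" where
  "mdiv A x = (\<chi> i. \<Sum>j\<in>UNIV. partial j (\<lambda>y. A y $ i $ j) x)"

definition laplacian :: "(real ^ 'd \<Rightarrow> 'b::real_normed_vector) \<Rightarrow> real ^ 'd \<Rightarrow> 'b" where
  "laplacian u x = (\<Sum>i\<in>UNIV. partial i (partial i u) x)"

text \<open>
  The inverse Laplacian on the torus: the unique periodic zero-mean solution \<open>u\<close> of
  \<open>laplacian u = g\<close>. Meaningful for smooth periodic \<open>g\<close> of zero mean; below it is only applied to
  \<open>g = grad (vdiv v)\<close>, which has zero mean.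
\<close>

definition inverse_laplacian ::
    "(real ^ 'd \<Rightarrow> 'b::real_normed_vector) \<Rightarrow> real ^ 'd \<Rightarrow> 'b" where
  "inverse_laplacian g = (THE u. periodic u \<and> C_k 2 u \<and> zero_mean u \<and> laplacian u = g)"

definition leray :: "(real ^ 'd \<Rightarrow> real ^ 'd) \<Rightarrow> real ^ 'd \<Rightarrow> real ^ 'd" where
  "leray v x = v x - inverse_laplacian (grad (vdiv v)) x"


section \<open>The operator and quasiconvexity\<close>

text \<open>Points of the space-time torus are pairs \<open>(t, x)\<close>.\<close>

definition A_tilde ::
    "(real \<times> (real ^ 'd) \<Rightarrow> real ^ 'd ^ 'd) \<Rightarrow> (real \<times> (real ^ 'd) \<Rightarrow> real ^ 'd ^ 'd) \<Rightarrow>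
     real \<times> (real ^ 'd) \<Rightarrow> (real ^ 'd ^ 'd) \<times> (real ^ 'd ^ 'd)" where
  "A_tilde \<epsilon> \<sigma> = (\<lambda>(t, x).
     (vector_derivative (\<lambda>s. \<epsilon> (s, x)) (at t)
        - (1 / 2) *\<^sub>R grad_plus_transpose (leray (mdiv (\<lambda>y. \<sigma> (t, y)))) x,
      laplacian (\<lambda>y. \<epsilon> (t, y)) x - grad_plus_transpose (mdiv (\<lambda>y. \<epsilon> (t, y))) x))"

definition A_tilde_quasiconvex :: "(real ^ 'd ^ 'd \<Rightarrow> real ^ 'd ^ 'd \<Rightarrow> real) \<Rightarrow> bool" where
  "A_tilde_quasiconvex f \<longleftrightarrow>
     continuous_on (sym0 \<times> sym0) (\<lambda>(e, s). f e s) \<and>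
     (\<forall>e\<in>sym0. \<forall>s\<in>sym0. 0 \<le> f e s) \<and>
     (\<forall>e\<in>sym0. \<forall>s\<in>sym0. \<forall>\<epsilon> \<sigma>.
        (\<forall>z. \<epsilon> z \<in> sym0) \<and> (\<forall>z. \<sigma> z \<in> sym0) \<and>
        periodic \<epsilon> \<and> periodic \<sigma> \<and> C_infinity \<epsilon> \<and> C_infinity \<sigma> \<and>
        zero_mean \<epsilon> \<and> zero_mean \<sigma> \<and> (\<forall>z. A_tilde \<epsilon> \<sigma> z = 0) \<longrightarrow>
        f e s \<le> integral (cbox 0 One) (\<lambda>z. f (e + \<epsilon> z) (s + \<sigma> z)))"

end

theory Submission
  imports Defs
begin

text \<open>
Write \<open>W\<^sup>*\<close> for the convex conjugate and \<open>f(e, s) = W e + W\<^sup>* s - e \<bullet> s\<close>. Superlinear growth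
makes \<open>W\<^sup>*\<close> finite on all matrices, so it is a finite convex function on a finite-dimensional space
and therefore continuous. Non-negativity of \<open>f\<close> is the Fenchel inequality, and equality holds
exactly when \<open>e\<close> minimises \<open>W e - e \<bullet> s\<close>, that is, when \<open>s\<close> is the gradient of \<open>W\<close> at \<open>e\<close>
(\<open>fenchel_defect_eq_0_iff\<close>). The growth bounds come from the Young inequality and from testing the
supremum in \<open>W\<^sup>*\<close> with a multiple of \<open>s\<close> (\<open>fenchel_defect_growth\<close>).

For quasiconvexity, \<open>W\<close> and \<open>W\<^sup>*\<close> are convex, so they are bounded below by affine functions and the
mean-zero perturbations \<open>\<epsilon>, \<sigma>\<close> cannot decrease their averages. What is left is the bilinear term:
the null Lagrangian property \<open>\<integral> \<epsilon> \<bullet> \<sigma> = 0\<close> for every field in the kernel of the operator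
(\<open>A_tilde_null_orthogonal\<close>). To see it, solve the spatial Poisson equation \<open>\<Delta>U = div \<epsilon>\<close> at each time.
The second equation and the vanishing trace give \<open>div U = 0\<close> and \<open>\<epsilon> = \<nabla>U + (\<nabla>U)\<^sup>T\<close>. The first
equation then reads \<open>2 \<partial>\<^sub>t U = \<Pi> div \<sigma>\<close>. As \<open>\<sigma>\<close> is symmetric and \<open>U\<close> is orthogonal to gradients,
integrating by parts gives
\<open>\<integral> \<epsilon> \<bullet> \<sigma> = - 2 \<integral> U \<bullet> div \<sigma> = - 2 \<integral> U \<bullet> \<Pi> div \<sigma> = - 2 \<integral> \<partial>\<^sub>t |U|\<^sup>2 = 0\<close>.

The argument needs smooth solutions of the Poisson equation on the torus that depend smoothly on time;
the Leray projector itself is only meaningful once such solutions exist. They are constructed without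
Fourier series. Let \<open>K\<close> average a function over a ball, with a weight, that contains a period cell. Two facts
are used. On functions of mean zero \<open>K\<close> is a contraction in the supremum norm: a constant part of the
weight on one cell can be dropped, as the function integrates to zero there (\<open>bump_mean_contraction\<close>).
And \<open>K u - u = S (\<Delta>u)\<close> for an explicit averaging operator \<open>S\<close>, by differentiating the averages in the radius of the ball
(\<open>bump_mean_value\<close>). Hence \<open>v = \<Sum>\<^sub>n K\<^sup>n F\<close> converges with all derivatives, since \<open>K\<close> commutes
with them, and \<open>u = - S v\<close> satisfies \<open>\<Delta>u = v - K v = F\<close> (\<open>poisson_exists\<close>). The same formula
shows that a harmonic \<open>u\<close> of mean zero satisfies \<open>u = K u\<close> and so vanishes, which is uniqueness
(\<open>harmonic_periodic_eq_0\<close>).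
\<close>

section \<open>Directional derivatives\<close>

text \<open>
The direction comes first, so that \<open>dderiv v\<close> is an operator on functions. The class \<open>C_k\<close> is defined
by iterating these operators.
\<close>

definition dderiv :: "'a::euclidean_space \<Rightarrow> ('a \<Rightarrow> 'b::real_normed_vector) \<Rightarrow> 'a \<Rightarrow> 'b" where
  "dderiv v u = (\<lambda>x. frechet_derivative u (at x) v)"

lemma dderiv_eq: "(u has_derivative u') (at x) \<Longrightarrow> dderiv v u x = u' v"
  unfolding dderiv_def using frechet_derivative_at by fastforce

lemma has_derivative_dderiv:
  "u differentiable (at x) \<Longrightarrow> (u has_derivative (\<lambda>v. dderiv v u x)) (at x)"
  unfolding dderiv_def using frechet_derivative_works by fastforce

lemma dderiv_scaleR:
  assumes "u differentiable (at x)"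
  shows "dderiv (c *\<^sub>R v) u x = c *\<^sub>R dderiv v u x"
  by (rule linear_cmul[OF has_derivative_linear[OF has_derivative_dderiv[OF assms]]])

lemma dderiv_Basis:
  fixes u :: "'a::euclidean_space \<Rightarrow> real"
  assumes "u differentiable (at x)"
  shows "dderiv v u x = (\<Sum>b\<in>Basis. (v \<bullet> b) * dderiv b u x)"
proof -
  have lin: "linear (\<lambda>v. dderiv v u x)"
    by (rule has_derivative_linear[OF has_derivative_dderiv[OF assms]])
  from linear_sum[OF lin, of "\<lambda>b. (v \<bullet> b) *\<^sub>R b" Basis] linear_cmul[OF lin]
  show ?thesis by (simp add: euclidean_representation)
qed

lemma C_k_Suc_iff:
  "C_k (Suc n) u \<longleftrightarrow> (\<forall>x. u differentiable (at x)) \<and> (\<forall>v. C_k n (dderiv v u))"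
  by (simp add: dderiv_def)

lemma C_k_SucI:
  assumes "\<And>x. (u has_derivative (\<lambda>v. u' v x)) (at x)" and "\<And>v. C_k n (u' v)"
  shows "C_k (Suc n) u"
proof -
  have "dderiv v u = u' v" for v
    using dderiv_eq[OF assms(1)] by auto
  then show ?thesis
    using assms unfolding C_k_Suc_iff differentiable_def by auto
qed

declare C_k.simps(2) [simp del]

lemma C_k_SucD:
  assumes "C_k (Suc n) u"
  shows "u differentiable (at x)" "C_k n (dderiv v u)" "(u has_derivative (\<lambda>v. dderiv v u x)) (at x)"
  using assms has_derivative_dderiv unfolding C_k_Suc_iff by auto

lemma C_k_continuous: "C_k n u \<Longrightarrow> continuous_on UNIV u"
  by (cases n) (auto intro!: continuous_at_imp_continuous_on differentiable_imp_continuous_within C_k_SucD)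

lemma C_k_lower: "C_k (Suc n) u \<Longrightarrow> C_k n u"
proof (induction n arbitrary: u)
  case 0
  then show ?case using C_k_continuous by auto
next
  case (Suc n)
  then show ?case by (metis C_k_Suc_iff)
qed

lemma C_infinity_C_k: "C_infinity u \<Longrightarrow> C_k n u"
  by (simp add: C_infinity_def)

lemma C_infinityD:
  assumes "C_infinity u"
  shows "u differentiable (at x)" "(u has_derivative (\<lambda>v. dderiv v u x)) (at x)"
    "C_infinity (dderiv v u)" "continuous_on A u"
  using assms C_k_SucD(1,3)[OF C_infinity_C_k[OF assms]] C_k_SucD(2)
    continuous_on_subset[OF C_k_continuous[OF C_infinity_C_k[OF assms]]]
  unfolding C_infinity_def by blast+

text \<open>
Smoothness for limits and integrals that can only be differentiated once at a time: if an operator \<open>T\<close>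
commutes with directional derivatives on a class \<open>P\<close> that is stable under them, then every derivative of
\<open>T F\<close> is again of the form \<open>T G\<close> with \<open>G\<close> in \<open>P\<close>, and can be differentiated in turn.
\<close>

lemma C_infinity_of_commuting_operator:
  assumes "P F"
    and "\<And>F x. P F \<Longrightarrow> (T F has_derivative (\<lambda>v. T (dderiv v F) x)) (at x)"
    and "\<And>F v. P F \<Longrightarrow> P (dderiv v F)"
  shows "C_infinity (T F)"
proof -
  have "P F \<Longrightarrow> C_k n (T F)" for n F
  proof (induction n arbitrary: F)
    case 0
    then show ?case
      using assms(2) by (auto intro!: continuous_at_imp_continuous_on has_derivative_continuous)
  next
    case (Suc n)
    then show ?case using assms by (intro C_k_SucI[where u' = "\<lambda>v. T (dderiv v F)"]) auto
  qed
  then show ?thesis using assms(1) by (simp add: C_infinity_def)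
qed

lemma dderiv_linear:
  assumes "bounded_linear L" "u differentiable (at x)"
  shows "dderiv v (\<lambda>x. L (u x)) x = L (dderiv v u x)"
  by (rule dderiv_eq) (rule bounded_linear.has_derivative[OF assms(1) has_derivative_dderiv[OF assms(2)]])

lemma C_k_linear:
  assumes "bounded_linear L" "C_k n u"
  shows "C_k n (\<lambda>x. L (u x))"
  using assms(2)
proof (induction n arbitrary: u)
  case 0
  then show ?case using assms(1) by (auto intro: bounded_linear.continuous_on)
next
  case (Suc n)
  show ?case
    by (rule C_k_SucI[where u' = "\<lambda>v x. L (dderiv v u x)"])
      (intro bounded_linear.has_derivative[OF assms(1)] Suc.IH C_k_SucD(2,3)[OF Suc.prems])+
qed

lemma dderiv_affine:
  assumes "bounded_linear L" "u differentiable (at (c + L x))"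
  shows "dderiv v (\<lambda>x. u (c + L x)) x = dderiv (L v) u (c + L x)"
proof (rule dderiv_eq)
  have "((\<lambda>x. c + L x) has_derivative L) (at x)"
    using assms(1) by (auto intro!: derivative_eq_intros bounded_linear_imp_has_derivative)
  from has_derivative_compose[OF this has_derivative_dderiv[OF assms(2)]]
  show "((\<lambda>x. u (c + L x)) has_derivative (\<lambda>v. dderiv (L v) u (c + L x))) (at x)" .
qed

lemma C_k_affine:
  assumes "bounded_linear L" "C_k n u"
  shows "C_k n (\<lambda>x. u (c + L x))"
  using assms(2)
proof (induction n arbitrary: u)
  case 0
  then have "continuous_on UNIV u" by simp
  moreover have "continuous_on UNIV (\<lambda>x. c + L x)"
    using assms(1) by (intro continuous_on_add continuous_on_const linear_continuous_on)
  ultimately show ?case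
    by (auto intro: continuous_on_compose2)
next
  case (Suc n)
  have *: "((\<lambda>x. c + L x) has_derivative L) (at x)" for x
    using assms(1) by (auto intro!: derivative_eq_intros bounded_linear_imp_has_derivative)
  show ?case
  proof (rule C_k_SucI[where u' = "\<lambda>v x. dderiv (L v) u (c + L x)"])
    show "((\<lambda>x. u (c + L x)) has_derivative (\<lambda>v. dderiv (L v) u (c + L x))) (at x)" for x
      by (rule has_derivative_compose[OF * C_k_SucD(3)[OF Suc.prems]])
    show "C_k n (\<lambda>x. dderiv (L v) u (c + L x))" for v
      by (rule Suc.IH[OF C_k_SucD(2)[OF Suc.prems]])
  qed
qed

lemma C_k_const: "C_k n (\<lambda>x. c)"
proof (induction n arbitrary: c)
  case (Suc n)
  show ?case by (rule C_k_SucI[where u' = "\<lambda>v x. 0"]) (auto intro: Suc)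
qed simp

lemma C_k_add:
  assumes "C_k n u" "C_k n v"
  shows "C_k n (\<lambda>x. u x + v x)"
  using assms
proof (induction n arbitrary: u v)
  case 0
  then show ?case by (simp add: continuous_on_add)
next
  case (Suc n)
  show ?case
  proof (rule C_k_SucI)
    show "((\<lambda>x. u x + v x) has_derivative (\<lambda>h. dderiv h u x + dderiv h v x)) (at x)" for x
      using Suc.prems by (intro has_derivative_add C_k_SucD(3))
    show "C_k n (\<lambda>x. dderiv h u x + dderiv h v x)" for h
      using Suc.prems by (intro Suc.IH C_k_SucD(2))
  qed
qed

lemma C_k_sum:
  assumes "\<And>i. i \<in> I \<Longrightarrow> C_k n (u i)"
  shows "C_k n (\<lambda>x. \<Sum>i\<in>I. u i x)"
  using assms
proof (induction I rule: infinite_finite_induct)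
  case (infinite I)
  show ?case unfolding sum.infinite[OF infinite(1)] by (rule C_k_const)
next
  case empty
  show ?case unfolding sum.empty by (rule C_k_const)
next
  case (insert i I)
  have "C_k n (\<lambda>x. u i x + (\<Sum>i\<in>I. u i x))"
    by (rule C_k_add[OF insert.prems[OF insertI1] insert.IH[OF insert.prems[OF insertI2]]])
  then show ?case unfolding sum.insert[OF insert(1,2)] .
qed

lemma C_k_scaleR: "C_k n u \<Longrightarrow> C_k n (\<lambda>x. c *\<^sub>R u x)"
  by (rule C_k_linear[OF bounded_linear_scaleR_right])

lemma C_k_mult:
  fixes u v :: "'a::euclidean_space \<Rightarrow> real"
  assumes "C_k n u" "C_k n v"
  shows "C_k n (\<lambda>x. u x * v x)"
  using assms
proof (induction n arbitrary: u v)
  case 0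
  then show ?case by (simp add: continuous_on_mult)
next
  case (Suc n)
  show ?case
  proof (rule C_k_SucI)
    show "((\<lambda>x. u x * v x) has_derivative (\<lambda>h. u x * dderiv h v x + dderiv h u x * v x)) (at x)" for x
      using Suc.prems by (intro has_derivative_mult C_k_SucD(3))
    show "C_k n (\<lambda>x. u x * dderiv h v x + dderiv h u x * v x)" for h
      by (intro C_k_add Suc.IH C_k_SucD(2) Suc.prems Suc.prems[THEN C_k_lower])
  qed
qed

lemma C_infinity_linear: "bounded_linear L \<Longrightarrow> C_infinity u \<Longrightarrow> C_infinity (\<lambda>x. L (u x))"
  unfolding C_infinity_def using C_k_linear[of L _ u] by blast

lemma C_infinity_add: "C_infinity u \<Longrightarrow> C_infinity v \<Longrightarrow> C_infinity (\<lambda>x. u x + v x)"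
  unfolding C_infinity_def using C_k_add[of _ u v] by blast

lemma C_infinity_sum: "(\<And>i. i \<in> I \<Longrightarrow> C_infinity (u i)) \<Longrightarrow> C_infinity (\<lambda>x. \<Sum>i\<in>I. u i x)"
  unfolding C_infinity_def using C_k_sum[of I _ u] by blast

lemma C_infinity_mult:
  fixes u v :: "'a::euclidean_space \<Rightarrow> real"
  shows "C_infinity u \<Longrightarrow> C_infinity v \<Longrightarrow> C_infinity (\<lambda>x. u x * v x)"
  unfolding C_infinity_def using C_k_mult[of _ u v] by blast

lemma C_infinity_cmult: "C_infinity u \<Longrightarrow> C_infinity (\<lambda>x. c * u x :: real)"
  by (rule C_infinity_linear[OF bounded_linear_mult_right])

lemma C_infinity_diff:
  assumes "C_infinity u" "C_infinity v"
  shows "C_infinity (\<lambda>x. u x - v x)"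
proof -
  have "C_infinity (\<lambda>x. u x + - v x)"
    using C_infinity_linear[OF bounded_linear_minus[OF bounded_linear_ident] assms(2)]
    by (rule C_infinity_add[OF assms(1)])
  then show ?thesis by simp
qed

lemma dderiv_add: "C_infinity u \<Longrightarrow> C_infinity v \<Longrightarrow> dderiv h (\<lambda>x. u x + v x) = (\<lambda>x. dderiv h u x + dderiv h v x)"
  by (rule ext, rule dderiv_eq) (intro has_derivative_add C_infinityD(2))

lemma dderiv_diff: "C_infinity u \<Longrightarrow> C_infinity v \<Longrightarrow> dderiv h (\<lambda>x. u x - v x) = (\<lambda>x. dderiv h u x - dderiv h v x)"
  by (rule ext, rule dderiv_eq) (intro has_derivative_diff C_infinityD(2))

lemma dderiv_sum: "(\<And>i. i \<in> I \<Longrightarrow> C_infinity (u i)) \<Longrightarrow> dderiv h (\<lambda>x. \<Sum>i\<in>I. u i x) = (\<lambda>x. \<Sum>i\<in>I. dderiv h (u i) x)"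
  by (rule ext, rule dderiv_eq) (intro has_derivative_sum C_infinityD(2))

lemma dderiv_cmult: "C_infinity u \<Longrightarrow> dderiv h (\<lambda>x. c * u x :: real) = (\<lambda>x. c * dderiv h u x)"
  by (rule ext, rule dderiv_linear[OF bounded_linear_mult_right]) (rule C_infinityD(1))

lemma dderiv_mult:
  fixes u v :: "'a::euclidean_space \<Rightarrow> real"
  shows "C_infinity u \<Longrightarrow> C_infinity v \<Longrightarrow> dderiv h (\<lambda>x. u x * v x) = (\<lambda>x. u x * dderiv h v x + dderiv h u x * v x)"
  by (rule ext, rule dderiv_eq) (intro has_derivative_mult C_infinityD(2))

section \<open>Symmetry of second derivatives\<close>

text \<open>
The mixed second difference over a small parallelogram is \<open>t\<^sup>2\<close> times one mixed derivative at some
point of the parallelogram, by applying the mean value theorem along each side. The left-hand side is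
symmetric in \<open>v\<close> and \<open>w\<close>, which is what forces the two mixed derivatives to agree in the limit.
\<close>

lemma second_difference:
  fixes u :: "'a::euclidean_space \<Rightarrow> real"
  assumes "C_k 2 u" "0 < t"
  obtains r s where "0 < r" "r < t" "0 < s" "s < t"
    "u (x + t *\<^sub>R v + t *\<^sub>R w) - u (x + t *\<^sub>R v) - u (x + t *\<^sub>R w) + u x
       = t * t * dderiv v (dderiv w u) (x + r *\<^sub>R v + s *\<^sub>R w)"
proof -
  have C: "C_k (Suc 1) u" and C': "C_k (Suc 0) (dderiv w u)"
    using assms(1) C_k_SucD(2)[of 1 u w] by (simp_all add: numeral_2_eq_2)
  have line: "((\<lambda>\<tau>. f (z + \<tau> *\<^sub>R h)) has_real_derivative dderiv h f (z + \<tau> *\<^sub>R h)) (at \<tau>)"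
    if "C_k (Suc n) f" for f :: "'a \<Rightarrow> real" and h z \<tau> n
  proof -
    have "((\<lambda>\<tau>. z + \<tau> *\<^sub>R h) has_derivative (\<lambda>\<tau>. \<tau> *\<^sub>R h)) (at \<tau>)"
      by (auto intro!: derivative_eq_intros)
    from has_derivative_compose[OF this C_k_SucD(3)[OF that]]
    have D: "((\<lambda>\<tau>. f (z + \<tau> *\<^sub>R h)) has_derivative (\<lambda>d. dderiv (d *\<^sub>R h) f (z + \<tau> *\<^sub>R h))) (at \<tau>)" .
    have "(\<lambda>d. dderiv (d *\<^sub>R h) f (z + \<tau> *\<^sub>R h)) = (\<lambda>d. d * dderiv h f (z + \<tau> *\<^sub>R h))"
      by (simp add: dderiv_scaleR C_k_SucD(1)[OF that])
    with D show ?thesis by (simp add: has_field_derivative_def mult_commute_abs)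
  qed
  have "((\<lambda>\<tau>. u (x + t *\<^sub>R v + \<tau> *\<^sub>R w) - u (x + \<tau> *\<^sub>R w)) has_real_derivative
         dderiv w u (x + t *\<^sub>R v + \<tau> *\<^sub>R w) - dderiv w u (x + \<tau> *\<^sub>R w)) (at \<tau>)" for \<tau>
    by (intro DERIV_diff line[OF C])
  from MVT2[OF assms(2) this]
  obtain s where s: "0 < s" "s < t"
    and eq1: "u (x + t *\<^sub>R v + t *\<^sub>R w) - u (x + t *\<^sub>R w) - (u (x + t *\<^sub>R v + 0 *\<^sub>R w) - u (x + 0 *\<^sub>R w))
      = (t - 0) * (dderiv w u (x + t *\<^sub>R v + s *\<^sub>R w) - dderiv w u (x + s *\<^sub>R w))"
    by blast
  have "((\<lambda>\<tau>. dderiv w u (x + s *\<^sub>R w + \<tau> *\<^sub>R v)) has_real_derivative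
         dderiv v (dderiv w u) (x + s *\<^sub>R w + \<tau> *\<^sub>R v)) (at \<tau>)" for \<tau>
    by (intro line[OF C'])
  from MVT2[OF assms(2) this]
  obtain r where r: "0 < r" "r < t"
    and eq2: "dderiv w u (x + s *\<^sub>R w + t *\<^sub>R v) - dderiv w u (x + s *\<^sub>R w + 0 *\<^sub>R v)
      = (t - 0) * dderiv v (dderiv w u) (x + s *\<^sub>R w + r *\<^sub>R v)"
    by blast
  show thesis
    by (rule that[OF r s]) (use eq1 eq2 in \<open>simp add: add_ac algebra_simps\<close>)
qed

lemma dderiv_commute_C2:
  fixes u :: "'a::euclidean_space \<Rightarrow> real"
  assumes "C_k 2 u"
  shows "dderiv v (dderiv w u) x = dderiv w (dderiv v u) x"
proof -
  have cont: "isCont (dderiv a (dderiv b u)) x" for a b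
  proof -
    have "C_k 0 (dderiv a (dderiv b u))"
      using assms C_k_SucD(2) by (metis numeral_2_eq_2)
    then show ?thesis by (simp add: continuous_on_eq_continuous_at)
  qed
  have "\<exists>\<xi> \<eta>. norm (\<xi> - x) \<le> t * (norm v + norm w) \<and> norm (\<eta> - x) \<le> t * (norm v + norm w)
          \<and> dderiv v (dderiv w u) \<xi> = dderiv w (dderiv v u) \<eta>" if t: "0 < t" for t :: real
  proof -
    obtain r s where rs: "0 < r" "r < t" "0 < s" "s < t"
      and 1: "u (x + t *\<^sub>R v + t *\<^sub>R w) - u (x + t *\<^sub>R v) - u (x + t *\<^sub>R w) + u x
       = t * t * dderiv v (dderiv w u) (x + r *\<^sub>R v + s *\<^sub>R w)"
      by (rule second_difference[OF assms t])
    obtain r' s' where rs': "0 < r'" "r' < t" "0 < s'" "s' < t"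
      and 2: "u (x + t *\<^sub>R w + t *\<^sub>R v) - u (x + t *\<^sub>R w) - u (x + t *\<^sub>R v) + u x
       = t * t * dderiv w (dderiv v u) (x + r' *\<^sub>R w + s' *\<^sub>R v)"
      by (rule second_difference[OF assms t])
    have "t * t * dderiv v (dderiv w u) (x + r *\<^sub>R v + s *\<^sub>R w) = t * t * dderiv w (dderiv v u) (x + r' *\<^sub>R w + s' *\<^sub>R v)"
      using 1 2 by (simp add: algebra_simps)
    then have eq: "dderiv v (dderiv w u) (x + r *\<^sub>R v + s *\<^sub>R w) = dderiv w (dderiv v u) (x + r' *\<^sub>R w + s' *\<^sub>R v)"
      using t by simp
    have nb: "norm (a *\<^sub>R v + b *\<^sub>R w) \<le> t * (norm v + norm w)" if "0 < a" "a < t" "0 < b" "b < t" for a b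
    proof -
      have "norm (a *\<^sub>R v + b *\<^sub>R w) \<le> a * norm v + b * norm w"
        using norm_triangle_ineq[of "a *\<^sub>R v" "b *\<^sub>R w"] that by simp
      also have "\<dots> \<le> t * norm v + t * norm w"
        using that by (intro add_mono mult_right_mono) auto
      finally show ?thesis by (simp add: algebra_simps)
    qed
    show ?thesis
      by (rule exI[of _ "x + r *\<^sub>R v + s *\<^sub>R w"], rule exI[of _ "x + r' *\<^sub>R w + s' *\<^sub>R v"])
        (use eq nb[OF rs] nb[OF rs'(3,4,1,2)] in \<open>simp add: add.assoc add.commute[of "r' *\<^sub>R w"]\<close>)
  qed
  then obtain \<xi> \<eta> where \<xi>: "\<And>t. 0 < t \<Longrightarrow> norm (\<xi> t - x) \<le> t * (norm v + norm w)"
    and \<eta>: "\<And>t. 0 < t \<Longrightarrow> norm (\<eta> t - x) \<le> t * (norm v + norm w)"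
    and eq: "\<And>t::real. 0 < t \<Longrightarrow> dderiv v (dderiv w u) (\<xi> t) = dderiv w (dderiv v u) (\<eta> t)"
    by metis
  have tt: "((\<lambda>t. t * (norm v + norm w)) \<longlongrightarrow> 0) (at_right (0::real))"
    by (auto intro!: tendsto_eq_intros)
  have lim: "(\<zeta> \<longlongrightarrow> x) (at_right 0)" if "\<And>t. 0 < t \<Longrightarrow> norm (\<zeta> t - x) \<le> t * (norm v + norm w)" for \<zeta> :: "real \<Rightarrow> 'a"
  proof (rule LIM_zero_cancel, rule Lim_null_comparison[OF _ tt])
    show "\<forall>\<^sub>F t in at_right 0. norm (\<zeta> t - x) \<le> t * (norm v + norm w)"
      using that by (auto simp: eventually_at_right_less eventually_at_filter)
  qed
  have "((\<lambda>t. dderiv v (dderiv w u) (\<xi> t)) \<longlongrightarrow> dderiv v (dderiv w u) x) (at_right 0)"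
    by (rule isCont_tendsto_compose[OF cont lim[OF \<xi>]])
  moreover have "((\<lambda>t. dderiv v (dderiv w u) (\<xi> t)) \<longlongrightarrow> dderiv w (dderiv v u) x) (at_right 0)"
  proof (rule Lim_transform_eventually[OF isCont_tendsto_compose[OF cont lim[OF \<eta>]]])
    show "\<forall>\<^sub>F t in at_right 0. dderiv w (dderiv v u) (\<eta> t) = dderiv v (dderiv w u) (\<xi> t)"
      using eq by (auto simp: eventually_at_filter)
  qed
  ultimately show ?thesis
    by (meson tendsto_unique trivial_limit_at_right_real)
qed

lemma dderiv_commute:
  fixes u :: "'a::euclidean_space \<Rightarrow> real"
  shows "C_infinity u \<Longrightarrow> dderiv v (dderiv w u) = dderiv w (dderiv v u)"
  using dderiv_commute_C2 C_infinity_C_k by blast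

section \<open>Integrals of periodic functions\<close>

lemma integral_cbox_translate:
  fixes f :: "'a::euclidean_space \<Rightarrow> 'b::banach"
  shows "integral (cbox a b) (\<lambda>x. f (x + c)) = integral (cbox (a + c) (b + c)) f"
  using integral_shift_cbox_plus[of a b f c] by (simp add: o_def add.commute)

lemma periodicD: "periodic f \<Longrightarrow> b \<in> Basis \<Longrightarrow> f (x + b) = f x"
  by (simp add: periodic_def)

text \<open>
Both boxes lie in the box that is longer by \<open>s\<close> in direction \<open>b\<close>. Cutting that box once at height 1 and
once at height \<open>s\<close> leaves over, besides these two boxes, two slabs that are translates of each other by
the period \<open>b\<close>.
\<close>

lemma integral_periodic_step:
  fixes f :: "'a::euclidean_space \<Rightarrow> 'b::banach"
  assumes "continuous_on UNIV f" "periodic f" "b \<in> Basis" "0 \<le> s" "s \<le> 1"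
  shows "integral (cbox (c + s *\<^sub>R b) (c + s *\<^sub>R b + One)) f = integral (cbox c (c + One)) f"
proof -
  define J where "J = cbox c (c + One + s *\<^sub>R b)"
  have int: "f integrable_on J"
    unfolding J_def using assms(1) by (intro integrable_continuous) (rule continuous_on_subset, auto)
  have sp: "(\<forall>i\<in>Basis. P i) \<longleftrightarrow> P b \<and> (\<forall>i\<in>Basis - {b}. P i)" for P
    using assms(3) by auto
  have bb: "b \<bullet> b = 1" "One \<bullet> b = 1" using assms(3) by simp_all
  have bo: "b \<bullet> i = 0" "One \<bullet> i = 1" if "i \<in> Basis - {b}" for i
    using assms(3) that by (auto simp: inner_Basis)
  \<comment> \<open>cuts at the far end of the original box and at the near end of the shifted one\<close>
  have J1: "J \<inter> {x. x \<bullet> b \<le> c \<bullet> b + 1} = cbox c (c + One)"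
    unfolding J_def set_eq_iff Int_iff mem_box mem_Collect_eq sp
    using assms(4,5) by (auto simp: inner_add_left bb bo)
  have J2: "J \<inter> {x. x \<bullet> b \<ge> c \<bullet> b + 1} = cbox (c + b) (c + One + s *\<^sub>R b)"
    unfolding J_def set_eq_iff Int_iff mem_box mem_Collect_eq sp
    using assms(4,5) by (auto simp: inner_add_left bb bo)
  have J3: "J \<inter> {x. x \<bullet> b \<le> c \<bullet> b + s} = cbox c (c + One + (s - 1) *\<^sub>R b)"
    unfolding J_def set_eq_iff Int_iff mem_box mem_Collect_eq sp
    using assms(4,5) by (auto simp: inner_add_left bb bo)
  have J4: "J \<inter> {x. x \<bullet> b \<ge> c \<bullet> b + s} = cbox (c + s *\<^sub>R b) (c + s *\<^sub>R b + One)"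
    unfolding J_def set_eq_iff Int_iff mem_box mem_Collect_eq sp
    using assms(4,5) by (auto simp: inner_add_left bb bo)
  have "integral (cbox c (c + One + (s - 1) *\<^sub>R b)) (\<lambda>x. f (x + b))
      = integral (cbox (c + b) (c + One + (s - 1) *\<^sub>R b + b)) f"
    by (rule integral_cbox_translate)
  then have tr: "integral (cbox c (c + One + (s - 1) *\<^sub>R b)) f = integral (cbox (c + b) (c + One + s *\<^sub>R b)) f"
    using assms(2,3) by (simp add: periodic_def algebra_simps)
  show ?thesis
    using integral_split[of f c "c + One + s *\<^sub>R b" b "c \<bullet> b + 1", folded J_def, OF int assms(3)]
      integral_split[of f c "c + One + s *\<^sub>R b" b "c \<bullet> b + s", folded J_def, OF int assms(3)]
    unfolding J1 J2 J3 J4 tr by simp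
qed

lemma integral_periodic_translate:
  fixes f :: "'a::euclidean_space \<Rightarrow> 'b::banach"
  assumes "continuous_on UNIV f" "periodic f"
  shows "integral (cbox 0 One) (\<lambda>x. f (x + c)) = integral (cbox 0 One) f"
proof -
  define I where "I = (\<lambda>c. integral (cbox c (c + One)) f)"
  have step: "I (c + s *\<^sub>R b) = I c" if "b \<in> Basis" "0 \<le> s" "s \<le> 1" for b s c
    unfolding I_def using integral_periodic_step[OF assms that] .
  have steps: "I (c + (real n * s) *\<^sub>R b) = I c" if "b \<in> Basis" "0 \<le> s" "s \<le> 1" for b s c n
  proof (induction n)
    case (Suc n)
    have "c + (real (Suc n) * s) *\<^sub>R b = (c + (real n * s) *\<^sub>R b) + s *\<^sub>R b"
      by (simp add: algebra_simps)
    then show ?case using Suc step[OF that, of "c + (real n * s) *\<^sub>R b"] by (simp only:)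
  qed simp
  have pos: "I (c + s *\<^sub>R b) = I c" if "b \<in> Basis" "0 \<le> s" for b s c
  proof -
    \<comment> \<open>a long translation is a sum of steps of length at most 1\<close>
    obtain n where "s < real n" using reals_Archimedean2 by blast
    then have "0 < real n" "s / real n \<le> 1" "0 \<le> s / real n" using that(2) by (auto simp: divide_simps)
    then show ?thesis using steps[OF that(1), of "s / real n" c n] by simp
  qed
  have all: "I (c + s *\<^sub>R b) = I c" if "b \<in> Basis" for b s c
    using pos[OF that, of s c] pos[OF that, of "- s" "c + s *\<^sub>R b"] by (cases "0 \<le> s") auto
  have sum: "I (\<Sum>b\<in>A. (c \<bullet> b) *\<^sub>R b) = I 0" if "A \<subseteq> Basis" for A
  proof -
    have "finite A" using that finite_subset[OF _ finite_Basis] by auto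
    then show ?thesis using that
    proof (induction A)
      case (insert b A)
      then show ?case using all[of b "\<Sum>b\<in>A. (c \<bullet> b) *\<^sub>R b" "c \<bullet> b"] by (simp add: add.commute)
    qed simp
  qed
  have "I c = I 0"
    using sum[of Basis] by (simp add: euclidean_representation)
  then show ?thesis
    using integral_cbox_translate[of 0 One f c] by (simp add: I_def add.commute)
qed

lemma dderiv_periodic:
  assumes "periodic u" "C_infinity u"
  shows "periodic (dderiv v u)"
  unfolding periodic_def
proof (intro allI ballI)
  fix x b :: 'a assume b: "b \<in> Basis"
  have "dderiv v u x = dderiv v (\<lambda>x. u (b + x)) x"
    using periodicD[OF assms(1) b] by (simp add: add.commute)
  also have "\<dots> = dderiv v u (b + x)"
    by (rule dderiv_affine[OF bounded_linear_ident C_infinityD(1)[OF assms(2)]])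
  finally show "dderiv v u (x + b) = dderiv v u x" by (simp add: add.commute)
qed

lemma periodic_bounded:
  fixes f :: "'a::euclidean_space \<Rightarrow> real"
  assumes "continuous_on UNIV f" "periodic f"
  obtains M where "\<And>x. \<bar>f x\<bar> \<le> M"
proof -
  have int: "f (x + of_int n *\<^sub>R b) = f x" if "b \<in> Basis" for x b and n :: int
  proof (induction n rule: int_induct[where k = 0])
    case (step1 i)
    then show ?case using periodicD[OF assms(2) that, of "x + of_int i *\<^sub>R b"] by (simp add: algebra_simps)
  next
    case (step2 i)
    then show ?case using periodicD[OF assms(2) that, of "x + of_int (i - 1) *\<^sub>R b"] by (simp add: algebra_simps)
  qed simp
  have red: "f (x + (\<Sum>b\<in>A. of_int (n b) *\<^sub>R b)) = f x" if "A \<subseteq> Basis" for A x and n :: "'a \<Rightarrow> int"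
  proof -
    have "finite A" using that finite_subset[OF _ finite_Basis] by auto
    then show ?thesis using that
    proof (induction A arbitrary: x)
      case (insert b A)
      have "f (x + (\<Sum>b\<in>insert b A. of_int (n b) *\<^sub>R b)) = f ((x + of_int (n b) *\<^sub>R b) + (\<Sum>b\<in>A. of_int (n b) *\<^sub>R b))"
        using insert(1,2) by (simp add: add.assoc)
      also have "\<dots> = f (x + of_int (n b) *\<^sub>R b)" using insert by blast
      also have "\<dots> = f x" using int insert.prems by auto
      finally show ?case .
    qed simp
  qed
  have "compact (f ` cbox 0 One)"
    by (rule compact_continuous_image) (use assms(1) continuous_on_subset in auto)
  then obtain M where M: "\<And>x. x \<in> cbox 0 One \<Longrightarrow> \<bar>f x\<bar> \<le> M"
    using compact_imp_bounded[of "f ` cbox 0 One"] by (auto simp: bounded_iff)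
  show thesis
  proof
    fix x :: 'a
    \<comment> \<open>the representative of \<open>x\<close> in the unit cell\<close>
    define y where "y = x + (\<Sum>b\<in>Basis. of_int (- \<lfloor>x \<bullet> b\<rfloor>) *\<^sub>R b)"
    have "y \<bullet> b = frac (x \<bullet> b)" if "b \<in> Basis" for b
    proof -
      have "(\<Sum>b\<in>Basis. of_int (- \<lfloor>x \<bullet> b\<rfloor>) *\<^sub>R b) \<bullet> b = of_int (- \<lfloor>x \<bullet> b\<rfloor>)"
        using that by (rule inner_sum_left_Basis)
      then show ?thesis by (simp add: y_def inner_add_left frac_def)
    qed
    then have "y \<in> cbox 0 One"
      by (simp add: mem_box frac_ge_0 frac_lt_1 less_imp_le)
    then show "\<bar>f x\<bar> \<le> M" using M[of y] red[of Basis x "\<lambda>b. - \<lfloor>x \<bullet> b\<rfloor>"] unfolding y_def by simp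
  qed
qed

section \<open>Weighted averages of translates\<close>

text \<open>
All averaging operators below have this form: ball averages, means over slices, and the operator that
recovers a function from its Laplacian up to a ball average. Such operators commute with derivatives, with each other, and
preserve periodicity, so these properties are proved once. The weights live on a box of a space of
parameters \<open>y\<close>, and \<open>l y\<close> is the translation belonging to \<open>y\<close>.
\<close>

definition smear :: "'c::euclidean_space set \<Rightarrow> ('c \<Rightarrow> real) \<Rightarrow> ('c \<Rightarrow> 'a::euclidean_space) \<Rightarrow> ('a \<Rightarrow> real) \<Rightarrow> 'a \<Rightarrow> real" where
  "smear B w l F z = integral B (\<lambda>y. w y * F (z + l y))"

lemma smear_integrable:
  fixes w :: "'c::euclidean_space \<Rightarrow> real" and l :: "'c \<Rightarrow> 'a::euclidean_space" and F :: "'a \<Rightarrow> real"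
  assumes "continuous_on (cbox p q) w" "continuous_on (cbox p q) l" "continuous_on UNIV F"
  shows "(\<lambda>y. w y * F (z + l y)) integrable_on cbox p q"
  by (intro integrable_continuous continuous_on_mult continuous_on_add continuous_on_const assms(1,2)
      continuous_on_compose2[OF assms(3)]) auto

lemma smear_diff:
  assumes "continuous_on (cbox p q) w" "continuous_on (cbox p q) l" "continuous_on UNIV F" "continuous_on UNIV G"
  shows "smear (cbox p q) w l (\<lambda>x. F x - G x) z = smear (cbox p q) w l F z - smear (cbox p q) w l G z"
  unfolding smear_def right_diff_distrib
  by (intro integral_diff smear_integrable assms)

lemma smear_sum:
  assumes "continuous_on (cbox p q) w" "continuous_on (cbox p q) l" "\<And>i. i \<in> I \<Longrightarrow> continuous_on UNIV (F i)" "finite I"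
  shows "smear (cbox p q) w l (\<lambda>x. \<Sum>i\<in>I. F i x) z = (\<Sum>i\<in>I. smear (cbox p q) w l (F i) z)"
  unfolding smear_def sum_distrib_left
  by (rule integral_sum) (use assms in \<open>auto intro: smear_integrable\<close>)

text \<open>
Differentiation under the integral sign. The classes \<open>C_k\<close> only provide continuity of each directional
derivative; since the space is finite-dimensional this is continuity of the derivative in operator norm.
\<close>

lemma smear_has_derivative:
  assumes w: "continuous_on (cbox p q) w" and l: "continuous_on (cbox p q) l" and F: "C_k (Suc 0) F"
  shows "(smear (cbox p q) w l F has_derivative (\<lambda>h. smear (cbox p q) w l (dderiv h F) z)) (at z)"
proof -
  define D where "D x = Blinfun (\<lambda>h. dderiv h F x)" for x
  have D: "blinfun_apply (D x) = (\<lambda>h. dderiv h F x)" for x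
    unfolding D_def
    by (rule bounded_linear_Blinfun_apply) (rule has_derivative_bounded_linear[OF C_k_SucD(3)[OF F]])
  have Fc: "continuous_on UNIV F" using F by (rule C_k_continuous)
  have Dc: "continuous_on UNIV D"
    by (rule continuous_on_blinfun_componentwise) (use C_k_SucD(2)[OF F] in \<open>simp add: D\<close>)
  have Dc2: "continuous_on (UNIV \<times> cbox p q) (\<lambda>(x, t). w t *\<^sub>R D (x + l t))"
    unfolding split_beta
    by (intro continuous_intros continuous_on_compose2[OF w] continuous_on_compose2[OF l]
        continuous_on_compose2[OF Dc]) auto
  have int: "(\<lambda>t. w t *\<^sub>R D (z + l t)) integrable_on cbox p q"
    by (intro integrable_continuous continuous_intros w l continuous_on_compose2[OF Dc]) auto
  have "((\<lambda>x. integral (cbox p q) (\<lambda>y. w y * F (x + l y))) has_derivative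
     blinfun_apply (integral (cbox p q) (\<lambda>t. w t *\<^sub>R D (z + l t)))) (at z within UNIV)"
  proof (rule leibniz_rule[OF _ _ Dc2])
    fix x t assume "t \<in> cbox p q"
    have "((\<lambda>x. x + l t) has_derivative (\<lambda>h. h)) (at x)" by (auto intro!: derivative_eq_intros)
    from has_derivative_compose[OF this C_k_SucD(3)[OF F]]
    have "((\<lambda>x. w t * F (x + l t)) has_derivative (\<lambda>h. w t * dderiv h F (x + l t))) (at x)"
      by (rule has_derivative_mult_right)
    then show "((\<lambda>x. w t * F (x + l t)) has_derivative blinfun_apply (w t *\<^sub>R D (x + l t))) (at x within UNIV)"
      by (simp add: D scaleR_blinfun.rep_eq)
  qed (auto intro: smear_integrable w l Fc)
  moreover have "blinfun_apply (integral (cbox p q) (\<lambda>t. w t *\<^sub>R D (z + l t)))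
      = (\<lambda>h. smear (cbox p q) w l (dderiv h F) z)"
  proof
    fix h
    show "blinfun_apply (integral (cbox p q) (\<lambda>t. w t *\<^sub>R D (z + l t))) h = smear (cbox p q) w l (dderiv h F) z"
    using integral_linear[OF int blinfun.bounded_linear_left[of h]]
    by (simp add: smear_def o_def D scaleR_blinfun.rep_eq)
  qed
  ultimately show ?thesis by (simp add: smear_def[abs_def])
qed

lemma smear_C_infinity:
  assumes "continuous_on (cbox p q) w" "continuous_on (cbox p q) l" "C_infinity F"
  shows "C_infinity (smear (cbox p q) w l F)"
  by (rule C_infinity_of_commuting_operator[where P = C_infinity, OF assms(3)])
    (auto intro!: smear_has_derivative assms(1,2) C_infinity_C_k C_infinityD(3))

lemma dderiv_smear:
  assumes "continuous_on (cbox p q) w" "continuous_on (cbox p q) l" "C_infinity F"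
  shows "dderiv h (smear (cbox p q) w l F) = smear (cbox p q) w l (dderiv h F)"
  by (rule ext, rule dderiv_eq[OF smear_has_derivative[OF assms(1,2) C_infinity_C_k[OF assms(3)]]])

lemma smear_commute:
  assumes "continuous_on (cbox p q) w" "continuous_on (cbox p q) l"
    and "continuous_on (cbox p' q') w'" "continuous_on (cbox p' q') l'" and "continuous_on UNIV F"
  shows "smear (cbox p q) w l (smear (cbox p' q') w' l' F) = smear (cbox p' q') w' l' (smear (cbox p q) w l F)"
proof
  fix z
  have "integral (cbox p q) (\<lambda>y. integral (cbox p' q') (\<lambda>y'. w y * (w' y' * F (z + l y + l' y'))))
      = integral (cbox p' q') (\<lambda>y'. integral (cbox p q) (\<lambda>y. w y * (w' y' * F (z + l y + l' y'))))"
  proof (rule integral_swap_continuous)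
    show "continuous_on (cbox (p, p') (q, q')) (\<lambda>(y, y'). w y * (w' y' * F (z + l y + l' y')))"
      unfolding split_beta
      by (intro continuous_intros continuous_on_compose2[OF assms(1)] continuous_on_compose2[OF assms(2)]
        continuous_on_compose2[OF assms(3)] continuous_on_compose2[OF assms(4)] continuous_on_compose2[OF assms(5)])
        (auto simp: cbox_Pair_eq)
  qed
  also have "\<dots> = integral (cbox p' q') (\<lambda>y'. integral (cbox p q) (\<lambda>y. w' y' * (w y * F (z + l' y' + l y))))"
    by (simp add: mult.left_commute add.commute add.left_commute)
  also have "\<dots> = integral (cbox p' q') (\<lambda>y'. w' y' * integral (cbox p q) (\<lambda>y. w y * F (z + l' y' + l y)))"
    by simp
  also have "integral (cbox p q) (\<lambda>y. integral (cbox p' q') (\<lambda>y'. w y * (w' y' * F (z + l y + l' y'))))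
    = integral (cbox p q) (\<lambda>y. w y * integral (cbox p' q') (\<lambda>y'. w' y' * F (z + l y + l' y')))"
    by simp
  finally show "smear (cbox p q) w l (smear (cbox p' q') w' l' F) z = smear (cbox p' q') w' l' (smear (cbox p q) w l F) z"
    unfolding smear_def .
qed

lemma smear_periodic:
  fixes F :: "'a::euclidean_space \<Rightarrow> real"
  shows "periodic F \<Longrightarrow> periodic (smear B w l F)"
  unfolding periodic_def smear_def
proof (intro allI ballI)
  fix x b :: 'a
  assume *: "\<forall>x. \<forall>b\<in>Basis. F (x + b) = F x" and b: "b \<in> Basis"
  have "F (x + b + l y) = F (x + l y)" for y
    using *[rule_format, OF b, of "x + l y"] by (simp add: algebra_simps)
  then show "integral B (\<lambda>y. w y * F (x + b + l y)) = integral B (\<lambda>y. w y * F (x + l y))" by simp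
qed

lemma smear_bound:
  assumes "continuous_on (cbox p q) w" "continuous_on (cbox p q) l" "continuous_on UNIV F"
    and "\<And>y. y \<in> cbox p q \<Longrightarrow> 0 \<le> w y" and "\<And>x. \<bar>F x\<bar> \<le> M"
  shows "\<bar>smear (cbox p q) w l F z\<bar> \<le> integral (cbox p q) w * M"
proof -
  have "norm (integral (cbox p q) (\<lambda>y. w y * F (z + l y))) \<le> integral (cbox p q) (\<lambda>y. w y * M)"
  proof (rule integral_norm_bound_integral)
    show "(\<lambda>y. w y * M) integrable_on cbox p q"
      by (intro integrable_continuous continuous_intros assms)
    show "norm (w x * F (z + l x)) \<le> w x * M" if "x \<in> cbox p q" for x
      using assms(4)[OF that] assms(5) by (simp add: abs_mult mult_left_mono)
  qed (rule smear_integrable[OF assms(1-3)])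
  then show ?thesis by (simp add: smear_def)
qed

lemma smear_tendsto:
  assumes w: "continuous_on (cbox p q) w" and l: "continuous_on (cbox p q) l"
    and nonneg: "\<And>y. y \<in> cbox p q \<Longrightarrow> 0 \<le> w y"
    and f: "\<And>n. continuous_on UNIV (f n)" and g: "continuous_on UNIV g"
    and e: "\<And>n x. \<bar>f n x - g x\<bar> \<le> e n" "e \<longlonglongrightarrow> 0"
  shows "(\<lambda>n. smear (cbox p q) w l (f n) z) \<longlonglongrightarrow> smear (cbox p q) w l g z"
proof (rule LIM_zero_cancel, rule Lim_null_comparison)
  have "\<bar>smear (cbox p q) w l (f n) z - smear (cbox p q) w l g z\<bar> \<le> integral (cbox p q) w * e n" for n
    unfolding smear_diff[OF w l f g, symmetric]
    by (rule smear_bound[OF w l _ nonneg e(1)]) (intro continuous_on_diff f g)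
  then show "\<forall>\<^sub>F n in sequentially. norm (smear (cbox p q) w l (f n) z - smear (cbox p q) w l g z)
      \<le> integral (cbox p q) w * e n" by simp
  show "(\<lambda>n. integral (cbox p q) w * e n) \<longlonglongrightarrow> 0"
    using tendsto_mult_left[OF e(2), of "integral (cbox p q) w"] by simp
qed

text \<open>
The integral of a translate of \<open>F\<close> over a period cell does not depend on the translation, so its
derivative in the translation vanishes.
\<close>

lemma integral_dderiv_periodic:
  fixes F :: "'a::euclidean_space \<Rightarrow> real"
  assumes "C_infinity F" "periodic F"
  shows "integral (cbox 0 One) (dderiv v F) = 0"
proof -
  have "smear (cbox 0 One) (\<lambda>_. 1) (\<lambda>y. y) F = (\<lambda>z. integral (cbox 0 One) F)"
    unfolding smear_def
    using integral_periodic_translate[OF C_infinityD(4)[OF assms(1)] assms(2)] by (simp add: add.commute)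
  then have "dderiv v (smear (cbox 0 One) (\<lambda>_. 1) (\<lambda>y. y) F) = (\<lambda>z. 0)"
    by (simp add: dderiv_def)
  then have "smear (cbox 0 One) (\<lambda>_. 1) (\<lambda>y. y) (dderiv v F) 0 = 0"
    using dderiv_smear[OF _ _ assms(1), of 0 One "\<lambda>_. 1" "\<lambda>y. y" v] by (simp add: continuous_on_id)
  then show ?thesis by (simp add: smear_def)
qed

section \<open>A mean value formula\<close>

definition laplace :: "('a::euclidean_space \<Rightarrow> real) \<Rightarrow> 'a \<Rightarrow> real" where
  "laplace f x = (\<Sum>b\<in>Basis. dderiv b (dderiv b f) x)"

text \<open>
The weight of the ball averages. It is chosen so that \<open>y * bump y\<close> is minus the gradient of
\<open>bump_potential\<close>, a function that is continuously differentiable and vanishes outside the unit ball.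
\<close>

definition bump :: "'a::euclidean_space \<Rightarrow> real" where
  "bump y = max 0 (1 - y \<bullet> y)"

definition bump_potential :: "'a::euclidean_space \<Rightarrow> real" where
  "bump_potential y = (bump y)\<^sup>2 / 4"

text \<open>
A box that contains the unit ball, with a margin so that it still does so after a small translation.
\<close>

definition bump_box :: "'a::euclidean_space set" where
  "bump_box = cbox (- (2 *\<^sub>R One)) (2 *\<^sub>R One)"

lemma continuous_on_bump [continuous_intros]:
  "continuous_on A f \<Longrightarrow> continuous_on A (\<lambda>x. bump (f x))"
  unfolding bump_def by (intro continuous_on_max continuous_intros)

lemma continuous_on_bump_potential [continuous_intros]:
  "continuous_on A f \<Longrightarrow> continuous_on A (\<lambda>x. bump_potential (f x))"
  unfolding bump_potential_def by (intro continuous_intros) auto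

lemma bump_nonneg: "0 \<le> bump y" by (simp add: bump_def)

lemma bump_potential_eq_0: "1 \<le> norm y \<Longrightarrow> bump_potential y = 0"
  by (simp add: bump_potential_def bump_def dot_square_norm max_def power2_eq_square) (smt (verit) mult_le_one one_le_power power2_eq_square)

lemma max_square_deriv: "((\<lambda>s::real. (max 0 s)\<^sup>2) has_real_derivative 2 * max 0 s) (at s)"
proof -
  consider "s < 0" | "s = 0" | "0 < s" by linarith
  then show ?thesis
  proof cases
    case 1
    have "((\<lambda>s::real. 0) has_real_derivative 2 * max 0 s) (at s)" using 1 by simp
    then show ?thesis
      by (rule has_field_derivative_transform_within_open[of _ _ _ "{..<0}"]) (use 1 in auto)
  next
    case 2
    have "isCont (\<lambda>z::real. max 0 z) 0" by (intro continuous_max continuous_const continuous_ident)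
    then show ?thesis unfolding CARAT_DERIV 2
      by (intro exI[of _ "\<lambda>z. max 0 z"]) (auto simp: power2_eq_square max_def)
  next
    case 3
    have "((\<lambda>s::real. s\<^sup>2) has_real_derivative 2 * max 0 s) (at s)"
      using 3 by (auto intro!: derivative_eq_intros)
    then show ?thesis
      by (rule has_field_derivative_transform_within_open[of _ _ _ "{0<..}"]) (use 3 in auto)
  qed
qed

lemma bump_potential_has_derivative:
  "(bump_potential has_derivative (\<lambda>h. - bump y * (y \<bullet> h))) (at y)"
proof -
  have "((\<lambda>y. 1 - y \<bullet> y) has_derivative (\<lambda>h. - (2 * (y \<bullet> h)))) (at y)"
    by (auto intro!: derivative_eq_intros simp: inner_commute)
  from has_derivative_compose[OF this has_field_derivative_imp_has_derivative[OF max_square_deriv]]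
  have "((\<lambda>y. (bump y)\<^sup>2) has_derivative (\<lambda>h. 2 * bump y * - (2 * (y \<bullet> h)))) (at y)"
    unfolding bump_def by simp
  from has_derivative_mult_right[OF this, of "1/4"]
  show ?thesis unfolding bump_potential_def[abs_def] by (simp add: mult.commute)
qed

text \<open>
Translating \<open>F\<close> by less than the margin of \<open>bump_box\<close> does not move its support out of the box. So the
integral does not depend on the translation and its derivative vanishes.
\<close>

lemma integral_dderiv_compact_support:
  fixes F :: "'a::euclidean_space \<Rightarrow> real"
  assumes F: "C_k (Suc 0) F" and supp: "\<And>y. 1 \<le> norm y \<Longrightarrow> F y = 0" and b: "b \<in> Basis"
  shows "integral bump_box (dderiv b F) = 0"
proof -
  define p q :: 'a where "p = - (2 *\<^sub>R One)" and "q = 2 *\<^sub>R One"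
  let ?G = "smear (cbox p q) (\<lambda>_. 1) (\<lambda>y. y) F"
  have cont: "continuous_on (cbox p q) (\<lambda>_. 1::real)" "continuous_on (cbox p q) (\<lambda>y. y)"
    by (intro continuous_intros)+
  have inner1: "One \<bullet> i = 1" if "i \<in> Basis" for i :: 'a using that by simp
  have const: "?G (s *\<^sub>R b) = integral (cbox (- One) One) F" if "\<bar>s\<bar> < 1" for s
  proof -
    have bi: "\<bar>s * (b \<bullet> i)\<bar> \<le> 1" if "i \<in> Basis" for i
      using b that \<open>\<bar>s\<bar> < 1\<close> by (simp add: inner_Basis)
    have sub: "cbox (- One) One \<subseteq> cbox (p + s *\<^sub>R b) (q + s *\<^sub>R b)"
      unfolding subset_box(1)
    proof (intro impI ballI)
      fix i :: 'a assume i: "i \<in> Basis"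
      show "(p + s *\<^sub>R b) \<bullet> i \<le> (- One) \<bullet> i \<and> One \<bullet> i \<le> (q + s *\<^sub>R b) \<bullet> i"
        using bi[OF i] inner1[OF i] unfolding p_def q_def inner_add_left inner_minus_left inner_scaleR_left by linarith
    qed
    have out: "F y = 0" if "y \<notin> cbox (- One) One" for y
    proof (rule supp)
      obtain i where i: "i \<in> Basis" "\<not> (- 1 \<le> y \<bullet> i \<and> y \<bullet> i \<le> 1)"
        using \<open>y \<notin> cbox (- One) One\<close> by (auto simp: mem_box)
      then have "1 \<le> \<bar>y \<bullet> i\<bar>" by linarith
      also have "\<dots> \<le> norm y" using i(1) by (rule Basis_le_norm)
      finally show "1 \<le> norm y" .
    qed
    have "(F has_integral integral (cbox (- One) One) F) (cbox (- One) One)"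
      using F by (intro integrable_integral integrable_continuous) (rule continuous_on_subset[OF C_k_continuous], auto)
    from has_integral_on_superset[OF this out sub]
    have "integral (cbox (p + s *\<^sub>R b) (q + s *\<^sub>R b)) F = integral (cbox (- One) One) F"
      by (rule integral_unique)
    then show ?thesis
      using integral_cbox_translate[of p q F "s *\<^sub>R b"] by (simp add: smear_def add.commute)
  qed
  have "((\<lambda>s. s *\<^sub>R b) has_derivative (\<lambda>d. d *\<^sub>R b)) (at 0)" by (auto intro!: derivative_eq_intros)
  from has_derivative_compose[OF this, of ?G, OF smear_has_derivative[OF cont F]]
  have D: "((\<lambda>s. ?G (s *\<^sub>R b)) has_derivative (\<lambda>d. smear (cbox p q) (\<lambda>_. 1) (\<lambda>y. y) (dderiv (d *\<^sub>R b) F) 0)) (at 0)"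
    by simp
  have "smear (cbox p q) (\<lambda>_. 1) (\<lambda>y. y) (dderiv (d *\<^sub>R b) F) 0 = d * integral (cbox p q) (dderiv b F)" for d
  proof -
    have "dderiv (d *\<^sub>R b) F y = d * dderiv b F y" for y
      by (simp add: dderiv_scaleR C_k_SucD(1)[OF F])
    then show ?thesis by (simp add: smear_def)
  qed
  with D have "((\<lambda>s. ?G (s *\<^sub>R b)) has_real_derivative integral (cbox p q) (dderiv b F)) (at 0)"
    by (simp add: has_field_derivative_def mult_commute_abs)
  from DERIV_local_const[OF this, of 1]
  have "integral (cbox p q) (dderiv b F) = 0" using const const[of 0] by simp
  then show ?thesis by (simp add: bump_box_def p_def q_def)
qed

lemma continuous_on_ray:
  fixes g :: "'a::euclidean_space \<Rightarrow> real"
  assumes "continuous_on UNIV g"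
  shows "continuous_on A (\<lambda>y. g (x + r *\<^sub>R y))"
  by (rule continuous_on_compose2[OF assms]) (auto intro!: continuous_intros)

text \<open>
Integration by parts in \<open>y\<close>, with \<open>- bump y * (y \<bullet> b)\<close> the derivative of \<open>bump_potential\<close>.
The boundary terms vanish because \<open>bump_potential\<close> is supported in the unit ball.
\<close>

lemma bump_parts:
  fixes g :: "'a::euclidean_space \<Rightarrow> real"
  assumes g: "C_k (Suc 0) g" and b: "b \<in> Basis"
  shows "integral bump_box (\<lambda>y. bump y * (y \<bullet> b) * g (x + r *\<^sub>R y))
    = r * integral bump_box (\<lambda>y. bump_potential y * dderiv b g (x + r *\<^sub>R y))"
proof -
  let ?F = "\<lambda>y. bump_potential y * g (x + r *\<^sub>R y)"
  let ?D = "\<lambda>v y. bump_potential y * (r * dderiv v g (x + r *\<^sub>R y)) + (- bump y * (y \<bullet> v)) * g (x + r *\<^sub>R y)"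
  have gc: "continuous_on UNIV g" "\<And>v. continuous_on UNIV (dderiv v g)"
    using g C_k_continuous C_k_SucD(2)[OF g] by auto
  have D: "(?F has_derivative (\<lambda>v. ?D v y)) (at y)" for y
  proof -
    have "((\<lambda>y. x + r *\<^sub>R y) has_derivative (\<lambda>h. r *\<^sub>R h)) (at y)" by (auto intro!: derivative_eq_intros)
    from has_derivative_compose[OF this C_k_SucD(3)[OF g]]
    have "((\<lambda>y. g (x + r *\<^sub>R y)) has_derivative (\<lambda>h. dderiv (r *\<^sub>R h) g (x + r *\<^sub>R y))) (at y)" .
    moreover have "dderiv (r *\<^sub>R h) g z = r * dderiv h g z" for h z
      by (simp add: dderiv_scaleR C_k_SucD(1)[OF g])
    ultimately have "((\<lambda>y. g (x + r *\<^sub>R y)) has_derivative (\<lambda>h. r * dderiv h g (x + r *\<^sub>R y))) (at y)"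
      by simp
    from has_derivative_mult[OF bump_potential_has_derivative this]
    show ?thesis .
  qed
  have F: "C_k (Suc 0) ?F"
  proof (rule C_k_SucI[where u' = ?D])
    show "C_k 0 (?D v)" for v
      by (simp, intro continuous_intros continuous_on_ray gc)
  qed (rule D)
  have "integral bump_box (dderiv b ?F) = 0"
    by (rule integral_dderiv_compact_support[OF F _ b]) (simp add: bump_potential_eq_0)
  moreover have "dderiv b ?F = ?D b"
    by (rule ext, rule dderiv_eq[OF D])
  moreover have "integral bump_box (?D b) = r * integral bump_box (\<lambda>y. bump_potential y * dderiv b g (x + r *\<^sub>R y))
     - integral bump_box (\<lambda>y. bump y * (y \<bullet> b) * g (x + r *\<^sub>R y))"
  proof -
    have 1: "(\<lambda>y. bump_potential y * dderiv b g (x + r *\<^sub>R y)) integrable_on bump_box"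
      unfolding bump_box_def by (intro integrable_continuous continuous_intros continuous_on_ray gc)
    have 2: "(\<lambda>y. bump y * (y \<bullet> b) * g (x + r *\<^sub>R y)) integrable_on bump_box"
      unfolding bump_box_def by (intro integrable_continuous continuous_intros continuous_on_ray gc)
    have "?D b = (\<lambda>y. r * (bump_potential y * dderiv b g (x + r *\<^sub>R y)) - bump y * (y \<bullet> b) * g (x + r *\<^sub>R y))"
      by (auto simp: algebra_simps)
    then show ?thesis
      using integral_diff[OF integrable_on_mult_right[OF 1, of r] 2] by simp
  qed
  ultimately show ?thesis by simp
qed

text \<open>
Differentiating in the radius produces the radial derivative \<open>y \<bullet> \<nabla>f\<close>. Since \<open>y * bump y\<close> is a gradient,
an integration by parts turns it into the Laplacian.
\<close>

lemma bump_mean_deriv: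
  fixes f :: "'a::euclidean_space \<Rightarrow> real"
  assumes f: "C_k 2 f"
  shows "((\<lambda>r. integral bump_box (\<lambda>y. bump y * f (x + r *\<^sub>R y))) has_real_derivative
      r * integral bump_box (\<lambda>y. bump_potential y * laplace f (x + r *\<^sub>R y))) (at r)"
proof -
  have f1: "C_k (Suc 0) f" "C_k (Suc 0) (dderiv b f)" "C_k 0 (dderiv b (dderiv b f))" for b
  proof -
    have f': "C_k (Suc (Suc 0)) f" using f by (simp add: numeral_2_eq_2)
    then show "C_k (Suc 0) f" by (rule C_k_lower)
    show "C_k (Suc 0) (dderiv b f)" by (rule C_k_SucD(2)[OF f'])
    then show "C_k 0 (dderiv b (dderiv b f))" by (rule C_k_SucD(2))
  qed
  note c = C_k_continuous[OF f1(1)] C_k_continuous[OF f1(2)] C_k_continuous[OF f1(3)]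
  have lin: "dderiv y f z = (\<Sum>b\<in>Basis. (y \<bullet> b) * dderiv b f z)" for y z
    by (rule dderiv_Basis[OF C_k_SucD(1)[OF f1(1)]])
  have ci: "continuous_on (UNIV \<times> A) (\<lambda>p. g (x + fst p *\<^sub>R snd p))" if "continuous_on UNIV g"
    for A and g :: "'a \<Rightarrow> real"
    by (rule continuous_on_compose2[OF that]) (auto intro!: continuous_intros)
  have "((\<lambda>r. integral bump_box (\<lambda>y. bump y * f (x + r *\<^sub>R y))) has_real_derivative
      integral bump_box (\<lambda>y. bump y * (\<Sum>b\<in>Basis. (y \<bullet> b) * dderiv b f (x + r *\<^sub>R y)))) (at r within UNIV)"
    unfolding bump_box_def
  proof (rule leibniz_rule_field_derivative)
    fix r :: real and y :: 'a
    have "((\<lambda>r. x + r *\<^sub>R y) has_derivative (\<lambda>d. d *\<^sub>R y)) (at r)" by (auto intro!: derivative_eq_intros)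
    from has_derivative_compose[OF this C_k_SucD(3)[OF f1(1)]]
    have "((\<lambda>r. f (x + r *\<^sub>R y)) has_derivative (\<lambda>d. dderiv (d *\<^sub>R y) f (x + r *\<^sub>R y))) (at r)" .
    moreover have "dderiv (d *\<^sub>R y) f z = dderiv y f z * d" for d z
      by (simp add: dderiv_scaleR C_k_SucD(1)[OF f1(1)])
    ultimately have "((\<lambda>r. f (x + r *\<^sub>R y)) has_real_derivative dderiv y f (x + r *\<^sub>R y)) (at r)"
      by (simp add: has_field_derivative_def)
    then show "((\<lambda>r. bump y * f (x + r *\<^sub>R y)) has_real_derivative
        bump y * (\<Sum>b\<in>Basis. (y \<bullet> b) * dderiv b f (x + r *\<^sub>R y))) (at r within UNIV)"
      unfolding lin[symmetric] by (rule DERIV_cmult)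
  next
    show "(\<lambda>y. bump y * f (x + r *\<^sub>R y)) integrable_on cbox (- (2 *\<^sub>R One)) (2 *\<^sub>R One)" for r
      by (intro integrable_continuous continuous_intros continuous_on_ray c)
    show "continuous_on (UNIV \<times> cbox (- (2 *\<^sub>R One)) (2 *\<^sub>R One))
      (\<lambda>(r, y). bump y * (\<Sum>b\<in>Basis. (y \<bullet> b) * dderiv b f (x + r *\<^sub>R y)))"
      unfolding split_beta by (intro continuous_intros ci c)
  qed auto
  also have "integral bump_box (\<lambda>y. bump y * (\<Sum>b\<in>Basis. (y \<bullet> b) * dderiv b f (x + r *\<^sub>R y)))
     = integral bump_box (\<lambda>y. \<Sum>b\<in>Basis. bump y * (y \<bullet> b) * dderiv b f (x + r *\<^sub>R y))"
    by (simp add: sum_distrib_left mult.assoc)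
  also have "\<dots> = (\<Sum>b\<in>Basis. integral bump_box (\<lambda>y. bump y * (y \<bullet> b) * dderiv b f (x + r *\<^sub>R y)))"
    unfolding bump_box_def
    by (intro integral_sum integrable_continuous continuous_intros continuous_on_ray c finite_Basis)
  also have "\<dots> = (\<Sum>b\<in>Basis. r * integral bump_box (\<lambda>y. bump_potential y * dderiv b (dderiv b f) (x + r *\<^sub>R y)))"
    by (rule sum.cong[OF refl bump_parts[OF f1(2)]])
  also have "\<dots> = r * (\<Sum>b\<in>Basis. integral bump_box (\<lambda>y. bump_potential y * dderiv b (dderiv b f) (x + r *\<^sub>R y)))"
    by (simp add: sum_distrib_left)
  also have "(\<Sum>b\<in>Basis. integral bump_box (\<lambda>y. bump_potential y * dderiv b (dderiv b f) (x + r *\<^sub>R y)))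
     = integral bump_box (\<lambda>y. \<Sum>b\<in>Basis. bump_potential y * dderiv b (dderiv b f) (x + r *\<^sub>R y))"
    unfolding bump_box_def
    by (intro integral_sum[symmetric] integrable_continuous continuous_intros continuous_on_ray c finite_Basis)
  finally show ?thesis
    by (simp add: laplace_def sum_distrib_left)
qed

text \<open>
Integrated form of the previous derivative between the radii 0 and \<open>R\<close>. It expresses a ball average minus
the value at the centre as an average of the Laplacian alone, which is what inverts the Laplacian below.
\<close>

lemma bump_mean_value:
  fixes f :: "'a::euclidean_space \<Rightarrow> real"
  assumes f: "C_k 2 f" and R: "0 \<le> R"
  shows "integral {0..R} (\<lambda>r. integral bump_box (\<lambda>y. r * bump_potential y * laplace f (x + r *\<^sub>R y)))
    = integral bump_box (\<lambda>y. bump y * f (x + R *\<^sub>R y)) - integral bump_box (bump :: 'a \<Rightarrow> real) * f x"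
proof -
  have "((\<lambda>r. r * integral bump_box (\<lambda>y. bump_potential y * laplace f (x + r *\<^sub>R y))) has_integral
     integral bump_box (\<lambda>y. bump y * f (x + R *\<^sub>R y)) - integral bump_box (\<lambda>y. bump y * f (x + 0 *\<^sub>R y))) {0..R}"
    by (rule fundamental_theorem_of_calculus[OF R])
      (use bump_mean_deriv[OF f] in \<open>auto simp: has_real_derivative_iff_has_vector_derivative[symmetric] intro: has_field_derivative_at_within\<close>)
  from integral_unique[OF this] show ?thesis by (simp add: mult.assoc)
qed

section \<open>Averaging contracts functions of mean zero\<close>

text \<open>
A radius \<open>R\<close> for which \<open>bump (y / R)\<close> is at least one half on the unit cell: there \<open>y \<bullet> y\<close> is at most
\<open>DIM('a)\<close>, and \<open>DIM('a) / R\<^sup>2\<close> is at most one half.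
\<close>

definition mean_radius :: "'a::euclidean_space itself \<Rightarrow> real" where
  "mean_radius _ = 2 * real DIM('a)"

definition contraction_factor :: "'a::euclidean_space itself \<Rightarrow> real" where
  "contraction_factor _ = 1 - measure lborel (cbox 0 (One /\<^sub>R mean_radius TYPE('a)) :: 'a set) / 2 / integral bump_box (bump :: 'a \<Rightarrow> real)"

text \<open>
Let \<open>C\<close> be the unit cell scaled down by the radius. The function has integral zero over every period cell,
so subtracting one half from the weight on \<open>C\<close> does not change the average. The remaining weight is still
non-negative, and its total mass is smaller by half the volume of \<open>C\<close>.
\<close>

lemma bump_mean_contraction:
  fixes f :: "'a::euclidean_space \<Rightarrow> real"
  assumes f: "continuous_on UNIV f" "periodic f" "zero_mean f" and M: "\<And>x. \<bar>f x\<bar> \<le> M"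
  shows "\<bar>integral bump_box (\<lambda>y. bump y * f (x + mean_radius TYPE('a) *\<^sub>R y))\<bar>
     \<le> (integral bump_box (bump :: 'a \<Rightarrow> real) - measure lborel (cbox 0 (One /\<^sub>R mean_radius TYPE('a)) :: 'a set) / 2) * M"
proof -
  define R where "R = mean_radius TYPE('a)"
  have R: "2 \<le> R" unfolding R_def mean_radius_def using DIM_positive[where 'a='a] by linarith
  define C :: "'a set" where "C = cbox 0 (One /\<^sub>R R)"
  have CB: "C \<subseteq> bump_box"
    unfolding C_def bump_box_def subset_box(1)
  proof (intro impI ballI)
    fix i :: 'a assume i: "i \<in> Basis"
    have "inverse R \<le> 2" using R by (simp add: field_simps)
    then show "(- (2 *\<^sub>R One)) \<bullet> i \<le> 0 \<bullet> i \<and> (One /\<^sub>R R) \<bullet> i \<le> (2 *\<^sub>R One) \<bullet> i"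
      using i by simp
  qed
  have half: "1/2 \<le> bump y" if "y \<in> C" for y
  proof -
    have "y \<bullet> y = (\<Sum>i\<in>Basis. (y \<bullet> i) * (y \<bullet> i))" by (rule euclidean_inner)
    also have "\<dots> \<le> (\<Sum>i\<in>(Basis::'a set). inverse R * inverse R)"
    proof (rule sum_mono)
      fix i :: 'a assume i: "i \<in> Basis"
      have "0 \<le> y \<bullet> i" "y \<bullet> i \<le> inverse R" using that i by (auto simp: C_def mem_box)
      then show "(y \<bullet> i) * (y \<bullet> i) \<le> inverse R * inverse R" using R by (intro mult_mono) auto
    qed
    also have "\<dots> = real DIM('a) / (R * R)" by (simp add: field_simps)
    also have "\<dots> = (1 / 2) / R" using R unfolding R_def mean_radius_def by (simp add: field_simps)
    also have "\<dots> \<le> 1/2" using R by (simp add: field_simps)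
    finally show ?thesis by (simp add: bump_def)
  qed
  let ?g = "\<lambda>y. f (x + R *\<^sub>R y)"
  have "((\<lambda>y. f (y + x)) has_integral 0) (cbox 0 One)"
  proof -
    have "(\<lambda>y. f (y + x)) integrable_on cbox 0 One"
      by (intro integrable_continuous continuous_on_compose2[OF f(1)]) (auto intro!: continuous_intros)
    moreover have "integral (cbox 0 One) (\<lambda>y. f (y + x)) = 0"
      using integral_periodic_translate[OF f(1,2)] f(3) by (simp add: zero_mean_def)
    ultimately show ?thesis by (metis integrable_integral)
  qed
  from has_integral_affinity'[OF this, of R 0] R
  have gC: "(?g has_integral 0) C" by (simp add: C_def add.commute)
  have gB: "((\<lambda>y. bump y * ?g y) has_integral integral bump_box (\<lambda>y. bump y * ?g y)) bump_box"
    unfolding bump_box_def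
    by (intro integrable_integral integrable_continuous continuous_intros continuous_on_ray f(1))
  have ind: "((\<lambda>y. (if y \<in> C then (1/2) * k y else 0)) has_integral (1/2) * I) bump_box"
    if "(k has_integral I) C" for k :: "'a \<Rightarrow> real" and I
    using has_integral_mult_right[OF that, of "1/2"] by (simp only: has_integral_restrict[OF CB])
  \<comment> \<open>subtracting half of the integral over \<open>C\<close>, which is zero\<close>
  have lhs: "((\<lambda>y. bump y * ?g y - (if y \<in> C then (1/2) * ?g y else 0)) has_integral
     integral bump_box (\<lambda>y. bump y * ?g y)) bump_box"
    using has_integral_diff[OF gB ind[OF gC]] by simp
  have "(bump :: 'a \<Rightarrow> real) integrable_on bump_box"
    using continuous_on_bump[OF continuous_on_id] unfolding bump_box_def by (rule integrable_continuous)
  from has_integral_mult_left[OF integrable_integral[OF this], of M]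
  have wB: "((\<lambda>y::'a. bump y * M) has_integral integral bump_box (bump :: 'a \<Rightarrow> real) * M) bump_box" .
  have wC: "((\<lambda>y. M) has_integral measure lborel C * M) C"
    using has_integral_const[of M 0 "One /\<^sub>R R"] unfolding C_def by simp
  have rhs: "((\<lambda>y. bump y * M - (if y \<in> C then (1/2) * M else 0)) has_integral
     integral bump_box (bump :: 'a \<Rightarrow> real) * M - (1/2) * (measure lborel C * M)) bump_box"
    using has_integral_diff[OF wB ind[OF wC]] .
  have "norm (integral bump_box (\<lambda>y. bump y * ?g y - (if y \<in> C then (1/2) * ?g y else 0)))
     \<le> integral bump_box (\<lambda>y. bump y * M - (if y \<in> C then (1/2) * M else 0))"
  proof (rule integral_norm_bound_integral)
    fix y :: 'a
    show "norm (bump y * ?g y - (if y \<in> C then (1/2) * ?g y else 0)) \<le> bump y * M - (if y \<in> C then (1/2) * M else 0)"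
    proof (cases "y \<in> C")
      case True
      have "\<bar>(bump y - 1/2) * ?g y\<bar> \<le> (bump y - 1/2) * M"
        using half[OF True] M by (simp add: abs_mult mult_left_mono)
      then show ?thesis using True by (simp add: left_diff_distrib)
    next
      case False
      then show ?thesis using bump_nonneg[of y] M by (simp add: abs_mult mult_left_mono)
    qed
  qed (use lhs rhs in \<open>auto simp: has_integral_integrable\<close>)
  then show ?thesis
    unfolding integral_unique[OF lhs] integral_unique[OF rhs] by (simp add: R_def C_def algebra_simps)
qed

text \<open>
The first inequality is the contraction estimate for the zero function with the bound 1.
\<close>

lemma bump_mass: "measure lborel (cbox 0 (One /\<^sub>R mean_radius TYPE('a)) :: 'a::euclidean_space set) / 2 \<le> integral bump_box (bump :: 'a \<Rightarrow> real)"
  "0 < measure lborel (cbox 0 (One /\<^sub>R mean_radius TYPE('a)) :: 'a::euclidean_space set)"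
proof -
  show "0 < measure lborel (cbox 0 (One /\<^sub>R mean_radius TYPE('a)) :: 'a::euclidean_space set)"
    unfolding content_pos_lt_eq by (auto simp: mean_radius_def)
  have "\<bar>integral bump_box (\<lambda>y. bump y * (\<lambda>_::'a. 0) (0 + mean_radius TYPE('a) *\<^sub>R y))\<bar>
     \<le> (integral bump_box (bump :: 'a \<Rightarrow> real) - measure lborel (cbox 0 (One /\<^sub>R mean_radius TYPE('a)) :: 'a set) / 2) * 1"
    by (rule bump_mean_contraction) (auto simp: periodic_def zero_mean_def)
  then show "measure lborel (cbox 0 (One /\<^sub>R mean_radius TYPE('a)) :: 'a::euclidean_space set) / 2 \<le> integral bump_box (bump :: 'a \<Rightarrow> real)"
    by simp
qed

lemma bump_mass_pos: "0 < integral bump_box (bump :: 'a::euclidean_space \<Rightarrow> real)"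
  using bump_mass[where 'a='a] by linarith

lemma contraction_factor: "0 \<le> contraction_factor TYPE('a::euclidean_space)" "contraction_factor TYPE('a) < 1"
  using bump_mass[where 'a='a] bump_mass_pos[where 'a='a] by (auto simp: contraction_factor_def field_simps)

lemma bump_mean_contraction_factor:
  fixes f :: "'a::euclidean_space \<Rightarrow> real"
  assumes f: "continuous_on UNIV f" "periodic f" "zero_mean f" and M: "\<And>x. \<bar>f x\<bar> \<le> M"
  shows "\<bar>integral bump_box (\<lambda>y. bump y * f (x + mean_radius TYPE('a) *\<^sub>R y))\<bar>
     \<le> integral bump_box (bump :: 'a \<Rightarrow> real) * (contraction_factor TYPE('a) * M)"
proof -
  have "integral bump_box (bump :: 'a \<Rightarrow> real) * (contraction_factor TYPE('a) * M)
    = (integral bump_box (bump :: 'a \<Rightarrow> real) - measure lborel (cbox 0 (One /\<^sub>R mean_radius TYPE('a)) :: 'a set) / 2) * M"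
    using bump_mass_pos[where 'a='a] by (simp add: contraction_factor_def field_simps)
  then show ?thesis using bump_mean_contraction[OF assms, of x] by (simp only:)
qed

text \<open>
By the mean value formula a harmonic function equals its ball averages, but averaging contracts the
supremum norm.
\<close>

lemma harmonic_periodic_eq_0:
  fixes u :: "'a::euclidean_space \<Rightarrow> real"
  assumes "C_k 2 u" "periodic u" "zero_mean u" and harm: "\<And>x. laplace u x = 0"
  shows "u x = 0"
proof -
  have cont: "continuous_on UNIV u" using assms(1) by (rule C_k_continuous)
  obtain M where M: "\<And>x. \<bar>u x\<bar> \<le> M" using periodic_bounded[OF cont assms(2)] by blast
  let ?m = "integral bump_box (bump :: 'a \<Rightarrow> real)" and ?\<theta> = "contraction_factor TYPE('a)"
  define S where "S = (SUP x. \<bar>u x\<bar>)"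
  have bdd: "bdd_above (range (\<lambda>x. \<bar>u x\<bar>))" using M by (intro bdd_aboveI[of _ M]) auto
  have S: "\<bar>u x\<bar> \<le> S" for x unfolding S_def using bdd by (rule cSUP_upper2) auto
  have "\<bar>u x\<bar> \<le> ?\<theta> * S" for x
  proof -
    have "0 \<le> mean_radius TYPE('a)" by (simp add: mean_radius_def)
    from bump_mean_value[OF assms(1) this, of x]
    have "?m * u x = integral bump_box (\<lambda>y. bump y * u (x + mean_radius TYPE('a) *\<^sub>R y))"
      by (simp add: harm)
    then have "?m * \<bar>u x\<bar> \<le> ?m * (?\<theta> * S)"
      using bump_mean_contraction_factor[OF cont assms(2,3) S, of x] bump_mass_pos[where 'a='a]
      by (metis abs_mult abs_of_pos)
    then show ?thesis using bump_mass_pos[where 'a='a] by simp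
  qed
  then have "S \<le> ?\<theta> * S" unfolding S_def by (intro cSUP_least) auto
  moreover have "0 \<le> S" using S[of x] by linarith
  ultimately have "S = 0"
    using contraction_factor[where 'a='a] by (smt (verit, best) mult_le_cancel_right1)
  then show ?thesis using S[of x] by simp
qed

section \<open>Averaging operators with a parameter\<close>

text \<open>
From here on functions depend on a parameter \<open>t\<close> and a space variable \<open>x\<close>. The operators act in \<open>x\<close>
only, but all functions are smooth in both variables, so that solutions can be differentiated in the
parameter.
\<close>

definition laplace_snd :: "('t::euclidean_space \<times> 'a::euclidean_space \<Rightarrow> real) \<Rightarrow> 't \<times> 'a \<Rightarrow> real" where
  "laplace_snd F z = (\<Sum>b\<in>Basis. dderiv (0, b) (dderiv (0, b) F) z)"

definition slice_mean :: "('t::euclidean_space \<times> 'a::euclidean_space \<Rightarrow> real) \<Rightarrow> 't \<times> 'a \<Rightarrow> real" where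
  "slice_mean = smear (cbox 0 One) (\<lambda>_. 1) (\<lambda>y. (0, y))"

text \<open>
The normalised ball average in \<open>x\<close>, the operator called \<open>K\<close> in the introduction.
\<close>

definition ball_mean :: "('t::euclidean_space \<times> 'a::euclidean_space \<Rightarrow> real) \<Rightarrow> 't \<times> 'a \<Rightarrow> real" where
  "ball_mean = smear bump_box (\<lambda>y. bump y / integral bump_box (bump :: 'a \<Rightarrow> real))
     (\<lambda>y. (0, mean_radius TYPE('a) *\<^sub>R y))"

text \<open>
The operator called \<open>S\<close> in the introduction: the left-hand side of \<open>bump_mean_value\<close> with \<open>F\<close> in
place of the Laplacian, normalised like \<open>ball_mean\<close>, as a single integral over radii \<open>r\<close> and points \<open>y\<close>.
\<close>

definition potential :: "('t::euclidean_space \<times> 'a::euclidean_space \<Rightarrow> real) \<Rightarrow> 't \<times> 'a \<Rightarrow> real" where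
  "potential = smear (cbox (0, - (2 *\<^sub>R One)) (mean_radius TYPE('a), 2 *\<^sub>R One))
     (\<lambda>(r, y). r * bump_potential y / integral bump_box (bump :: 'a \<Rightarrow> real)) (\<lambda>(r, y). (0, r *\<^sub>R y))"

text \<open>
The smooth periodic right-hand sides for which the Poisson equation in \<open>x\<close> has a periodic solution, and
the class in which the solution is unique. The mean over a slice is required to
vanish for all cells in it, which makes the condition visibly stable under derivatives in all directions
and under averaging; one cell per slice suffices (\<open>mean_freeI\<close>).
\<close>

definition mean_free :: "('t::euclidean_space \<times> 'a::euclidean_space \<Rightarrow> real) \<Rightarrow> bool" where
  "mean_free F \<longleftrightarrow> C_infinity F \<and> periodic F \<and> (\<forall>z. slice_mean F z = 0)"

lemma mean_freeD:
  "mean_free F \<Longrightarrow> C_infinity F" "mean_free F \<Longrightarrow> periodic F" "mean_free F \<Longrightarrow> slice_mean F z = 0"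
  unfolding mean_free_def by blast+

lemma slice_mean_weights:
  "continuous_on (cbox p q) (\<lambda>_::'a::euclidean_space. 1::real)" "continuous_on (cbox p q) (\<lambda>y::'a. (0::'t::euclidean_space, y))"
  by (intro continuous_intros)+

lemma ball_mean_weights:
  "continuous_on (cbox p q) (\<lambda>y::'a::euclidean_space. bump y / integral bump_box (bump :: 'a \<Rightarrow> real))"
  "continuous_on (cbox p q) (\<lambda>y::'a. (0::'t::euclidean_space, c *\<^sub>R y))"
  using bump_mass_pos[where 'a='a] by (auto intro!: continuous_intros)

lemma potential_weights:
  "continuous_on (cbox p q) (\<lambda>(r, y::'a::euclidean_space). r * bump_potential y / integral bump_box (bump :: 'a \<Rightarrow> real))"
  "continuous_on (cbox p q) (\<lambda>(r, y::'a). (0::'t::euclidean_space, r *\<^sub>R y))"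
  using bump_mass_pos[where 'a='a] unfolding split_beta by (auto intro!: continuous_intros)

lemma dderiv_slice:
  assumes "C_infinity F"
  shows "dderiv v (\<lambda>y. F (t, y)) = (\<lambda>y. dderiv (0, v) F (t, y))"
proof
  fix x
  have L: "bounded_linear (\<lambda>y. (0, y))"
    by (intro bounded_linear_Pair bounded_linear_zero bounded_linear_ident)
  have "F differentiable at ((t, 0) + (0, x))" by (rule C_infinityD(1)[OF assms])
  from dderiv_affine[OF L this, of v]
  show "dderiv v (\<lambda>y. F (t, y)) x = dderiv (0, v) F (t, x)" by simp
qed

lemma C_k_slice:
  assumes "C_k n F"
  shows "C_k n (\<lambda>y. F (t, y))"
proof -
  have L: "bounded_linear (\<lambda>y. (0, y))"
    by (intro bounded_linear_Pair bounded_linear_zero bounded_linear_ident)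
  from C_k_affine[OF L assms, of "(t, 0)"] show ?thesis by simp
qed

lemma C_infinity_slice: "C_infinity F \<Longrightarrow> C_infinity (\<lambda>y. F (t, y))"
  unfolding C_infinity_def using C_k_slice by blast

lemma laplace_slice:
  "C_infinity F \<Longrightarrow> laplace (\<lambda>y. F (t, y)) x = laplace_snd F (t, x)"
  by (simp add: laplace_def laplace_snd_def dderiv_slice C_infinityD(3))

lemma periodic_slice: "periodic F \<Longrightarrow> periodic (\<lambda>y. F (t, y))"
  unfolding periodic_def
proof (intro allI ballI)
  fix x b :: 'b assume *: "\<forall>x. \<forall>b\<in>Basis. F (x + b) = F x" and b: "b \<in> Basis"
  then have "(0, b) \<in> Basis" by (simp add: Basis_prod_def)
  from *[rule_format, OF this, of "(t, x)"] show "F (t, x + b) = F (t, x)" by simp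
qed

lemma slice_mean_eq: "slice_mean F (t, x) = integral (cbox 0 One) (\<lambda>y. F (t, y + x))"
  by (simp add: slice_mean_def smear_def add.commute)

lemma zero_mean_slice: "mean_free F \<Longrightarrow> zero_mean (\<lambda>y. F (t, y))"
  using mean_freeD(3)[of F "(t, 0)"] by (simp add: slice_mean_eq zero_mean_def)

lemma mean_freeI:
  assumes "C_infinity F" "periodic F" "\<And>t. zero_mean (\<lambda>y. F (t, y))"
  shows "mean_free F"
proof -
  have "slice_mean F (t, x) = 0" for t x
    using integral_periodic_translate[OF C_k_continuous[OF C_k_slice[OF C_infinity_C_k[OF assms(1)]]] periodic_slice[OF assms(2)], of t x]
      assms(3)[of t] unfolding slice_mean_eq zero_mean_def by simp
  then show ?thesis using assms(1,2) by (auto simp: mean_free_def)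
qed

text \<open>
Taking slice means commutes with derivatives in every direction, also with respect to the parameter.
\<close>

lemma mean_free_dderiv:
  assumes "mean_free F"
  shows "mean_free (dderiv v F)"
proof -
  note F = mean_freeD[OF assms]
  have "slice_mean F = (\<lambda>z. 0)" using F(3) by auto
  then have "dderiv v (slice_mean F) z = 0" for z by (simp add: dderiv_def)
  then have "slice_mean (dderiv v F) z = 0" for z
    unfolding slice_mean_def dderiv_smear[OF slice_mean_weights F(1)] by simp
  then show ?thesis using F by (simp add: mean_free_def C_infinityD(3) dderiv_periodic)
qed

lemma mean_free_smear:
  assumes "continuous_on (cbox p q) w" "continuous_on (cbox p q) l" "mean_free F"
  shows "mean_free (smear (cbox p q) w l F)"
proof -
  note F = mean_freeD[OF assms(3)]
  have "slice_mean F = (\<lambda>z. 0)" using F(3) by auto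
  then have "slice_mean (smear (cbox p q) w l F) z = 0" for z
    unfolding slice_mean_def smear_commute[OF slice_mean_weights assms(1,2) C_infinityD(4)[OF F(1)]]
    by (simp add: smear_def)
  then show ?thesis using F assms by (simp add: mean_free_def smear_C_infinity smear_periodic)
qed

lemma slice_mean_diff:
  "continuous_on UNIV F \<Longrightarrow> continuous_on UNIV G \<Longrightarrow> slice_mean (\<lambda>z. F z - G z) z = slice_mean F z - slice_mean G z"
  unfolding slice_mean_def by (rule smear_diff[OF slice_mean_weights])

lemma slice_mean_sum:
  "(\<And>i. i \<in> I \<Longrightarrow> continuous_on UNIV (F i)) \<Longrightarrow> finite I \<Longrightarrow> slice_mean (\<lambda>z. \<Sum>i\<in>I. F i z) z = (\<Sum>i\<in>I. slice_mean (F i) z)"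
  unfolding slice_mean_def by (rule smear_sum[OF slice_mean_weights])

lemma slice_mean_cmult: "slice_mean (\<lambda>z. c * F z) z = c * slice_mean F z"
  by (simp add: slice_mean_def smear_def mult.left_commute)

lemma mean_free_diff:
  assumes "mean_free F" "mean_free G"
  shows "mean_free (\<lambda>z. F z - G z)"
  using mean_freeD[OF assms(1)] mean_freeD[OF assms(2)]
  by (auto simp: mean_free_def slice_mean_diff C_infinityD(4) C_infinity_diff periodic_def)

lemma mean_free_sum:
  assumes "\<And>i. i \<in> I \<Longrightarrow> mean_free (F i)" "finite I"
  shows "mean_free (\<lambda>z. \<Sum>i\<in>I. F i z)"
  using assms mean_freeD(2)[OF assms(1)]
  by (auto simp: mean_free_def slice_mean_sum C_infinityD(4) C_infinity_sum periodic_def)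

lemma mean_free_cmult:
  assumes "mean_free F"
  shows "mean_free (\<lambda>z. c * F z)"
  using mean_freeD[OF assms]
  by (auto simp: mean_free_def slice_mean_cmult C_infinity_cmult periodic_def)

lemma mean_free_ball_mean: "mean_free F \<Longrightarrow> mean_free (ball_mean F)"
  unfolding ball_mean_def bump_box_def by (rule mean_free_smear[OF ball_mean_weights[unfolded bump_box_def]])

lemma mean_free_potential: "mean_free F \<Longrightarrow> mean_free (potential F)"
  unfolding potential_def by (rule mean_free_smear[OF potential_weights])

lemma ball_mean_slice:
  fixes F :: "'t::euclidean_space \<times> 'a::euclidean_space \<Rightarrow> real"
  shows "integral bump_box (bump :: 'a \<Rightarrow> real) * ball_mean F (t, x)
    = integral bump_box (\<lambda>y. bump y * F (t, x + mean_radius TYPE('a) *\<^sub>R y))"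
proof -
  have "ball_mean F (t, x) = integral bump_box (\<lambda>y. (bump y * F (t, x + mean_radius TYPE('a) *\<^sub>R y)) / integral bump_box (bump :: 'a \<Rightarrow> real))"
    by (simp add: ball_mean_def smear_def)
  then show ?thesis using bump_mass_pos[where 'a='a] by simp
qed

lemma potential_slice:
  fixes F :: "'t::euclidean_space \<times> 'a::euclidean_space \<Rightarrow> real"
  assumes "continuous_on UNIV F"
  shows "integral bump_box (bump :: 'a \<Rightarrow> real) * potential F (t, x)
    = integral {0..mean_radius TYPE('a)} (\<lambda>r. integral bump_box (\<lambda>y. r * bump_potential y * F (t, x + r *\<^sub>R y)))"
proof -
  let ?m = "integral bump_box (bump :: 'a \<Rightarrow> real)" and ?B = "cbox (0, - (2 *\<^sub>R One)) (mean_radius TYPE('a), 2 *\<^sub>R One) :: (real \<times> 'a) set"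
  have "potential F (t, x) = integral ?B (\<lambda>p. (fst p * bump_potential (snd p) * F (t, x + fst p *\<^sub>R snd p)) / ?m)"
    by (simp add: potential_def smear_def split_beta)
  then have "?m * potential F (t, x) = integral ?B (\<lambda>p. fst p * bump_potential (snd p) * F (t, x + fst p *\<^sub>R snd p))"
    using bump_mass_pos[where 'a='a] by simp
  also have "\<dots> = integral (cbox 0 (mean_radius TYPE('a))) (\<lambda>r. integral (cbox (- (2 *\<^sub>R One)) (2 *\<^sub>R One)) (\<lambda>y. r * bump_potential y * F (t, x + r *\<^sub>R y)))"
    by (subst integral_prod_continuous) (auto intro!: continuous_intros continuous_on_compose2[OF assms])
  finally show ?thesis by (simp add: bump_box_def)
qed

lemma potential_laplace:
  fixes F :: "'t::euclidean_space \<times> 'a::euclidean_space \<Rightarrow> real"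
  assumes "C_infinity F"
  shows "potential (laplace_snd F) z = ball_mean F z - F z"
proof -
  obtain t x where z: "z = (t, x)" by force
  let ?m = "integral bump_box (bump :: 'a \<Rightarrow> real)"
  have cont: "continuous_on UNIV (laplace_snd F)"
    unfolding laplace_snd_def[abs_def] by (intro continuous_on_sum C_infinityD assms)
  have R: "0 \<le> mean_radius TYPE('a)" by (simp add: mean_radius_def)
  have "?m * potential (laplace_snd F) (t, x) = ?m * ball_mean F (t, x) - ?m * F (t, x)"
    unfolding potential_slice[OF cont] ball_mean_slice
    using bump_mean_value[OF C_k_slice[OF C_infinity_C_k[OF assms]] R, of t x]
    by (simp add: laplace_slice[OF assms])
  then have "?m * potential (laplace_snd F) (t, x) = ?m * (ball_mean F (t, x) - F (t, x))"
    by (simp only: right_diff_distrib)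
  then show ?thesis using bump_mass_pos[where 'a='a] z by simp
qed

lemma ball_mean_contraction:
  fixes F :: "'t::euclidean_space \<times> 'a::euclidean_space \<Rightarrow> real"
  assumes "mean_free F" "\<And>z. \<bar>F z\<bar> \<le> M"
  shows "\<bar>ball_mean F z\<bar> \<le> contraction_factor TYPE('a) * M"
proof -
  obtain t x where z: "z = (t, x)" by force
  let ?m = "integral bump_box (bump :: 'a \<Rightarrow> real)"
  note F = mean_freeD[OF assms(1)]
  have "\<bar>?m * ball_mean F (t, x)\<bar> \<le> ?m * (contraction_factor TYPE('a) * M)"
    unfolding ball_mean_slice
    by (rule bump_mean_contraction_factor[OF C_k_continuous[OF C_k_slice[OF C_infinity_C_k[OF F(1)]]]
          periodic_slice[OF F(2)] zero_mean_slice[OF assms(1)] assms(2)])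
  then show ?thesis using bump_mass_pos[where 'a='a] z by (simp add: abs_mult)
qed

lemma dderiv_ball_mean: "C_infinity F \<Longrightarrow> dderiv v (ball_mean F) = ball_mean (dderiv v F)"
  unfolding ball_mean_def bump_box_def by (rule dderiv_smear[OF ball_mean_weights[unfolded bump_box_def]])

lemma ball_mean_sum:
  "(\<And>i. i \<in> I \<Longrightarrow> continuous_on UNIV (F i)) \<Longrightarrow> finite I \<Longrightarrow> ball_mean (\<lambda>z. \<Sum>i\<in>I. F i z) z = (\<Sum>i\<in>I. ball_mean (F i) z)"
  unfolding ball_mean_def bump_box_def by (rule smear_sum[OF ball_mean_weights[unfolded bump_box_def]])

section \<open>The Poisson equation with a parameter\<close>

text \<open>
The inverse of \<open>1 - K\<close> on mean-free functions, where \<open>K\<close> is \<open>ball_mean\<close>.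
\<close>

definition neumann :: "('t::euclidean_space \<times> 'a::euclidean_space \<Rightarrow> real) \<Rightarrow> 't \<times> 'a \<Rightarrow> real" where
  "neumann F z = (\<Sum>n. (ball_mean ^^ n) F z)"

lemma mean_free_iterate: "mean_free F \<Longrightarrow> mean_free ((ball_mean ^^ n) F)"
  by (induction n) (auto intro: mean_free_ball_mean)

lemma iterate_bound:
  fixes F :: "'t::euclidean_space \<times> 'a::euclidean_space \<Rightarrow> real"
  assumes "mean_free F" "\<And>z. \<bar>F z\<bar> \<le> M"
  shows "\<bar>(ball_mean ^^ n) F z\<bar> \<le> contraction_factor TYPE('a) ^ n * M"
proof (induction n arbitrary: z)
  case 0
  then show ?case using assms(2) by simp
next
  case (Suc n)
  from ball_mean_contraction[OF mean_free_iterate[OF assms(1)] Suc]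
  show ?case by (simp add: mult.assoc)
qed

lemma dderiv_iterate: "mean_free F \<Longrightarrow> dderiv v ((ball_mean ^^ n) F) = (ball_mean ^^ n) (dderiv v F)"
  by (induction n) (simp_all add: dderiv_ball_mean mean_freeD(1)[OF mean_free_iterate])

lemma neumann_partial_sums:
  fixes F :: "'t::euclidean_space \<times> 'a::euclidean_space \<Rightarrow> real"
  assumes "mean_free F" "\<And>z. \<bar>F z\<bar> \<le> M"
  shows "(\<lambda>n. (ball_mean ^^ n) F z) sums neumann F z"
    and "\<bar>(\<Sum>i<n. (ball_mean ^^ i) F z) - neumann F z\<bar>
      \<le> contraction_factor TYPE('a) ^ n * (M / (1 - contraction_factor TYPE('a)))"
proof -
  let ?\<theta> = "contraction_factor TYPE('a)"
  have \<theta>: "norm ?\<theta> < 1" using contraction_factor[where 'a='a] by simp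
  have gs: "(\<lambda>n. ?\<theta> ^ n * M) sums (1 / (1 - ?\<theta>) * M)"
    by (intro sums_mult2 geometric_sums \<theta>)
  have summable: "summable (\<lambda>n. (ball_mean ^^ n) F z)"
    by (rule summable_comparison_test[OF _ sums_summable[OF gs]]) (use iterate_bound[OF assms] in auto)
  then show "(\<lambda>n. (ball_mean ^^ n) F z) sums neumann F z"
    unfolding neumann_def by (rule summable_sums)
  have s2: "summable (\<lambda>i. \<bar>(ball_mean ^^ (i + n)) F z\<bar>)"
  proof (rule summable_comparison_test)
    show "\<exists>N. \<forall>i\<ge>N. norm \<bar>(ball_mean ^^ (i + n)) F z\<bar> \<le> ?\<theta> ^ (i + n) * M"
      using iterate_bound[OF assms] by auto
    show "summable (\<lambda>i. ?\<theta> ^ (i + n) * M)"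
      using sums_summable[OF gs] by (subst summable_iff_shift)
  qed
  have "(\<Sum>i<n. (ball_mean ^^ i) F z) - neumann F z = - (\<Sum>i. (ball_mean ^^ (i + n)) F z)"
    unfolding neumann_def suminf_minus_initial_segment[OF summable, of n] by simp
  then have "\<bar>(\<Sum>i<n. (ball_mean ^^ i) F z) - neumann F z\<bar> \<le> (\<Sum>i. \<bar>(ball_mean ^^ (i + n)) F z\<bar>)"
    using summable_rabs[OF s2] by simp
  also have "\<dots> \<le> (\<Sum>i. ?\<theta> ^ n * (?\<theta> ^ i * M))"
  proof (rule suminf_le[OF _ s2])
    show "\<bar>(ball_mean ^^ (i + n)) F z\<bar> \<le> ?\<theta> ^ n * (?\<theta> ^ i * M)" for i
      using iterate_bound[OF assms, of "i + n" z] by (simp add: power_add mult_ac)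
    show "summable (\<lambda>i. ?\<theta> ^ n * (?\<theta> ^ i * M))"
      by (intro summable_mult sums_summable[OF gs])
  qed
  also have "\<dots> = ?\<theta> ^ n * (\<Sum>i. ?\<theta> ^ i * M)" by (rule suminf_mult[OF sums_summable[OF gs]])
  also have "\<dots> = ?\<theta> ^ n * (M / (1 - ?\<theta>))" using sums_unique[OF gs] by simp
  finally show "\<bar>(\<Sum>i<n. (ball_mean ^^ i) F z) - neumann F z\<bar> \<le> ?\<theta> ^ n * (M / (1 - ?\<theta>))" .
qed

lemma mean_free_bounded:
  assumes "mean_free F"
  obtains M where "0 \<le> M" "\<And>z. \<bar>F z\<bar> \<le> M"
proof -
  obtain M where M: "\<And>z. \<bar>F z\<bar> \<le> M"
    using periodic_bounded[OF C_infinityD(4)[OF mean_freeD(1)[OF assms]] mean_freeD(2)[OF assms]] by blast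
  then have "0 \<le> M" by (meson abs_ge_zero order_trans)
  with M show thesis using that by blast
qed

lemma contraction_powers_tendsto:
  "(\<lambda>n. contraction_factor TYPE('a::euclidean_space) ^ n * c) \<longlonglongrightarrow> 0"
  using contraction_factor[where 'a='a] tendsto_mult_left_zero[OF LIMSEQ_realpow_zero] by blast

text \<open>
Every directional derivative of a mean-free function is mean-free, hence bounded, and \<open>ball_mean\<close>
commutes with derivatives. So the differentiated series is the Neumann series of the derivative, and it
converges geometrically and uniformly.
\<close>

lemma neumann_has_derivative:
  fixes F :: "'t::euclidean_space \<times> 'a::euclidean_space \<Rightarrow> real"
  assumes "mean_free F"
  shows "(neumann F has_derivative (\<lambda>v. neumann (dderiv v F) z)) (at z)"
proof -
  let ?\<theta> = "contraction_factor TYPE('a)"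
  have "\<exists>M. 0 \<le> M \<and> (\<forall>z. \<bar>dderiv b F z\<bar> \<le> M)" for b
    using mean_free_bounded[OF mean_free_dderiv[OF assms]] by metis
  then obtain Mb where Mb: "\<And>b. 0 \<le> Mb b" "\<And>b z. \<bar>dderiv b F z\<bar> \<le> Mb b" by metis
  define M where "M = (\<Sum>b\<in>Basis. Mb b)"
  have bound: "\<bar>dderiv h F z\<bar> \<le> M * norm h" for h z
  proof -
    have "dderiv h F z = (\<Sum>b\<in>Basis. (h \<bullet> b) * dderiv b F z)"
      by (rule dderiv_Basis[OF C_infinityD(1)[OF mean_freeD(1)[OF assms]]])
    also have "\<bar>\<dots>\<bar> \<le> (\<Sum>b\<in>Basis. \<bar>(h \<bullet> b) * dderiv b F z\<bar>)" by (rule sum_abs)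
    also have "\<dots> \<le> (\<Sum>b\<in>Basis. norm h * Mb b)"
      unfolding abs_mult by (intro sum_mono mult_mono Basis_le_norm Mb) auto
    finally show ?thesis by (simp add: M_def sum_distrib_left mult.commute)
  qed
  obtain M0 where M0: "\<And>z. \<bar>F z\<bar> \<le> M0" using mean_free_bounded[OF assms] by metis
  have "\<exists>g. \<forall>x\<in>UNIV. (\<lambda>n. (ball_mean ^^ n) F x) sums g x \<and>
      (g has_derivative (\<lambda>h. neumann (dderiv h F) x)) (at x within UNIV)"
  proof (rule has_derivative_series)
    show "((ball_mean ^^ n) F has_derivative (\<lambda>v. (ball_mean ^^ n) (dderiv v F) x)) (at x within UNIV)" for n x
      using C_infinityD(2)[OF mean_freeD(1)[OF mean_free_iterate[OF assms]], of n x]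
      by (simp add: dderiv_iterate[OF assms])
    show "(\<lambda>n. (ball_mean ^^ n) F 0) sums neumann F 0"
      by (rule neumann_partial_sums[OF assms M0])
    fix e :: real assume e: "e > 0"
    have "\<forall>\<^sub>F n in sequentially. ?\<theta> ^ n * (M / (1 - ?\<theta>)) < e"
      using order_tendstoD(2)[OF contraction_powers_tendsto e] .
    then show "\<forall>\<^sub>F n in sequentially. \<forall>x\<in>UNIV. \<forall>h.
        norm ((\<Sum>i<n. (ball_mean ^^ i) (dderiv h F) x) - neumann (dderiv h F) x) \<le> e * norm h"
    proof eventually_elim
      case (elim n)
      show ?case
      proof (intro ballI allI)
        fix x h
        have "\<bar>(\<Sum>i<n. (ball_mean ^^ i) (dderiv h F) x) - neumann (dderiv h F) x\<bar>
          \<le> ?\<theta> ^ n * (M * norm h / (1 - ?\<theta>))"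
          by (rule neumann_partial_sums(2)[OF mean_free_dderiv[OF assms] bound])
        also have "\<dots> = ?\<theta> ^ n * (M / (1 - ?\<theta>)) * norm h" by simp
        also have "\<dots> \<le> e * norm h" using elim by (intro mult_right_mono) auto
        finally show "norm ((\<Sum>i<n. (ball_mean ^^ i) (dderiv h F) x) - neumann (dderiv h F) x) \<le> e * norm h"
          by simp
      qed
    qed
  qed auto
  then obtain g where g: "\<And>x. (\<lambda>n. (ball_mean ^^ n) F x) sums g x"
    "\<And>x. (g has_derivative (\<lambda>h. neumann (dderiv h F) x)) (at x)" by auto
  have "g = neumann F"
    using sums_unique2[OF g(1) neumann_partial_sums(1)[OF assms M0]] by auto
  then show ?thesis using g(2) by simp
qed

lemma mean_free_neumann:
  fixes F :: "'t::euclidean_space \<times> 'a::euclidean_space \<Rightarrow> real"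
  assumes "mean_free F"
  shows "mean_free (neumann F)" and "neumann F z = F z + ball_mean (neumann F) z"
proof -
  let ?\<theta> = "contraction_factor TYPE('a)"
  let ?s = "\<lambda>n z. \<Sum>i<n. (ball_mean ^^ i) F z"
  obtain M where M: "\<And>z. \<bar>F z\<bar> \<le> M" using mean_free_bounded[OF assms] by metis
  have smooth: "C_infinity (neumann F)"
    by (rule C_infinity_of_commuting_operator[where P = mean_free, OF assms])
      (rule neumann_has_derivative, assumption, rule mean_free_dderiv)
  note cont = C_infinityD(4)[OF smooth]
  have per: "periodic (neumann F)"
    using mean_freeD(2)[OF mean_free_iterate[OF assms]] by (simp add: periodic_def neumann_def)
  have s_adm: "mean_free (?s n)" for n
    by (intro mean_free_sum mean_free_iterate[OF assms]) auto
  note s_cont = C_infinityD(4)[OF mean_freeD(1)[OF s_adm]]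
  have close: "\<bar>?s n z - neumann F z\<bar> \<le> ?\<theta> ^ n * (M / (1 - ?\<theta>))" for n z
    by (rule neumann_partial_sums(2)[OF assms M])
  have "(\<lambda>n. slice_mean (?s n) z) \<longlonglongrightarrow> slice_mean (neumann F) z" for z
    unfolding slice_mean_def
    by (rule smear_tendsto[OF slice_mean_weights _ s_cont cont close contraction_powers_tendsto]) simp
  then have "slice_mean (neumann F) z = 0" for z
    using mean_freeD(3)[OF s_adm] by (simp add: LIMSEQ_const_iff)
  then show "mean_free (neumann F)" using smooth per by (simp add: mean_free_def)
  have "(\<lambda>n. ball_mean (?s n) z) \<longlonglongrightarrow> ball_mean (neumann F) z"
    unfolding ball_mean_def bump_box_def
    by (rule smear_tendsto[OF ball_mean_weights[unfolded bump_box_def] _ s_cont[unfolded ball_mean_def bump_box_def] 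
          cont[unfolded ball_mean_def bump_box_def] close[unfolded ball_mean_def bump_box_def] contraction_powers_tendsto])
      (use bump_mass_pos[where 'a='a] in \<open>auto simp: bump_box_def bump_nonneg\<close>)
  moreover have "ball_mean (?s n) z = ?s (Suc n) z - F z" for n
  proof -
    have "ball_mean (?s n) z = (\<Sum>i<n. (ball_mean ^^ Suc i) F z)"
      by (subst ball_mean_sum) (auto intro: C_infinityD(4) mean_freeD(1) mean_free_iterate[OF assms])
    also have "\<dots> = ?s (Suc n) z - F z" unfolding sum.lessThan_Suc_shift by simp
    finally show ?thesis .
  qed
  moreover have "(\<lambda>n. ?s (Suc n) z - F z) \<longlonglongrightarrow> neumann F z - F z"
    by (intro tendsto_diff tendsto_const LIMSEQ_Suc)
      (use neumann_partial_sums(1)[OF assms M] in \<open>simp add: sums_def\<close>)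
  ultimately have "ball_mean (neumann F) z = neumann F z - F z"
    using LIMSEQ_unique by simp
  then show "neumann F z = F z + ball_mean (neumann F) z" by simp
qed

text \<open>
The solution is \<open>- potential (neumann F)\<close>. The Laplacian passes through \<open>potential\<close>, and
\<open>potential_laplace\<close> leaves \<open>v - ball_mean v\<close> with \<open>v = neumann F\<close>, which is \<open>F\<close>.
\<close>

theorem poisson_exists:
  fixes F :: "'t::euclidean_space \<times> 'a::euclidean_space \<Rightarrow> real"
  assumes "mean_free F"
  obtains u where "mean_free u" "\<And>z. laplace_snd u z = F z"
proof
  let ?v = "neumann F"
  note v = mean_free_neumann[OF assms]
  note v' = mean_freeD(1)[OF v(1)]
  have P: "mean_free (potential ?v)" by (rule mean_free_potential[OF v(1)])
  then show "mean_free (\<lambda>z. - 1 * potential ?v z)" by (rule mean_free_cmult)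
  fix z
  have dd: "dderiv a (dderiv b (potential ?v)) = potential (dderiv a (dderiv b ?v))" for a b
    unfolding potential_def
    by (simp only: dderiv_smear[OF potential_weights] v' C_infinityD(3)[OF v'])
  have "laplace_snd (potential ?v) z = potential (laplace_snd ?v) z"
    unfolding laplace_snd_def[abs_def] dd unfolding potential_def
    by (rule smear_sum[OF potential_weights, symmetric]) (auto intro: C_infinityD v')
  also have "\<dots> = - F z" using potential_laplace[OF v', of z] v(2)[of z] by simp
  finally have "laplace_snd (potential ?v) z = - F z" .
  moreover have "laplace_snd (\<lambda>z. - 1 * potential ?v z) z = - laplace_snd (potential ?v) z"
    unfolding laplace_snd_def dderiv_cmult[OF mean_freeD(1)[OF P]]
      dderiv_cmult[OF C_infinityD(3)[OF mean_freeD(1)[OF P]]] by (simp add: sum_negf)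
  ultimately show "laplace_snd (\<lambda>z. - 1 * potential ?v z) z = F z" by simp
qed

lemma poisson_unique:
  fixes F :: "'t::euclidean_space \<times> 'a::euclidean_space \<Rightarrow> real"
  assumes "mean_free F" "\<And>z. laplace_snd F z = 0"
  shows "F z = 0"
proof -
  obtain t x where z: "z = (t, x)" by force
  note F = mean_freeD[OF assms(1)]
  have "(\<lambda>y. F (t, y)) x = 0"
    by (rule harmonic_periodic_eq_0[OF C_k_slice[OF C_infinity_C_k[OF F(1)]] periodic_slice[OF F(2)] zero_mean_slice[OF assms(1)]])
      (simp add: laplace_slice[OF F(1)] assms(2))
  then show ?thesis using z by simp
qed

section \<open>Orthogonality of strain and stress\<close>

definition smooth_periodic :: "('a::euclidean_space \<Rightarrow> real) \<Rightarrow> bool" where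
  "smooth_periodic F \<longleftrightarrow> C_infinity F \<and> periodic F"

lemma smooth_periodicD: "smooth_periodic F \<Longrightarrow> C_infinity F" "smooth_periodic F \<Longrightarrow> periodic F"
  by (simp_all add: smooth_periodic_def)

lemma smooth_periodic_add: "smooth_periodic F \<Longrightarrow> smooth_periodic G \<Longrightarrow> smooth_periodic (\<lambda>z. F z + G z)"
  by (simp add: smooth_periodic_def periodic_def C_infinity_add)

lemma smooth_periodic_diff: "smooth_periodic F \<Longrightarrow> smooth_periodic G \<Longrightarrow> smooth_periodic (\<lambda>z. F z - G z)"
  by (simp add: smooth_periodic_def periodic_def C_infinity_diff)

lemma smooth_periodic_mult: "smooth_periodic F \<Longrightarrow> smooth_periodic G \<Longrightarrow> smooth_periodic (\<lambda>z. F z * G z)"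
  by (simp add: smooth_periodic_def periodic_def C_infinity_mult)

lemma smooth_periodic_const: "smooth_periodic (\<lambda>z. c)"
  by (simp add: smooth_periodic_def periodic_def C_infinity_def C_k_const)

lemma smooth_periodic_sum:
  "(\<And>i. i \<in> I \<Longrightarrow> smooth_periodic (F i)) \<Longrightarrow> smooth_periodic (\<lambda>z. \<Sum>i\<in>I. F i z)"
  by (simp add: smooth_periodic_def periodic_def C_infinity_sum)

lemma smooth_periodic_dderiv: "smooth_periodic F \<Longrightarrow> smooth_periodic (dderiv v F)"
  by (simp add: smooth_periodic_def dderiv_periodic C_infinityD(3))

lemmas smooth_periodic_intros = smooth_periodic_add smooth_periodic_diff smooth_periodic_mult
  smooth_periodic_const smooth_periodic_sum smooth_periodic_dderiv

lemma mean_free_smooth_periodic: "mean_free F \<Longrightarrow> smooth_periodic F"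
  by (simp add: mean_free_def smooth_periodic_def)

abbreviation torus_integral :: "('a::euclidean_space \<Rightarrow> real) \<Rightarrow> real" where
  "torus_integral F \<equiv> integral (cbox 0 One) F"

lemma smooth_periodic_integrable: "smooth_periodic F \<Longrightarrow> F integrable_on cbox 0 One"
  by (intro integrable_continuous C_infinityD(4) smooth_periodicD(1))

lemma torus_integral_by_parts:
  assumes "smooth_periodic F" "smooth_periodic G"
  shows "torus_integral (\<lambda>z. dderiv v F z * G z) = - torus_integral (\<lambda>z. F z * dderiv v G z)"
proof -
  have "torus_integral (dderiv v (\<lambda>z. F z * G z)) = 0"
    using smooth_periodicD[OF smooth_periodic_mult[OF assms]] by (rule integral_dderiv_periodic)
  then have "torus_integral (\<lambda>z. F z * dderiv v G z + dderiv v F z * G z) = 0"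
    by (simp add: dderiv_mult smooth_periodicD(1) assms)
  then show ?thesis
    by (subst (asm) integral_add) (auto intro!: smooth_periodic_integrable smooth_periodic_intros assms)
qed

lemma laplace_snd_diff:
  "C_infinity F \<Longrightarrow> C_infinity G \<Longrightarrow> laplace_snd (\<lambda>z. F z - G z) z = laplace_snd F z - laplace_snd G z"
  by (simp add: laplace_snd_def dderiv_diff C_infinityD(3) sum_subtractf)

lemma laplace_snd_sum:
  "(\<And>i. i \<in> I \<Longrightarrow> C_infinity (F i)) \<Longrightarrow> laplace_snd (\<lambda>z. \<Sum>i\<in>I. F i z) z = (\<Sum>i\<in>I. laplace_snd (F i) z)"
  by (simp add: laplace_snd_def dderiv_sum C_infinityD(3) sum.swap[of _ I])

lemma laplace_snd_cmult:
  "C_infinity F \<Longrightarrow> laplace_snd (\<lambda>z. c * F z) z = c * laplace_snd F z"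
  by (simp add: laplace_snd_def dderiv_cmult C_infinityD(3) sum_distrib_left)

lemma laplace_snd_dderiv:
  assumes "C_infinity F"
  shows "laplace_snd (dderiv v F) = dderiv v (laplace_snd F)"
proof -
  have "dderiv b (dderiv b (dderiv v F)) = dderiv v (dderiv b (dderiv b F))" for b
    using dderiv_commute[OF assms, of b v] dderiv_commute[OF C_infinityD(3)[OF assms], of b v b] by simp
  then show ?thesis
    unfolding laplace_snd_def[abs_def]
    by (simp add: dderiv_sum C_infinityD(3) assms)
qed

lemma sum_Basis_axis: "(\<Sum>b\<in>(Basis :: (real ^ 'd) set). f b) = (\<Sum>i\<in>UNIV. f (axis i 1))"
proof -
  have "(Basis :: (real ^ 'd) set) = range (\<lambda>i. axis i 1)"
    by (auto simp: Basis_vec_def)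
  moreover have "inj (\<lambda>i. axis i 1 :: real ^ 'd)"
    by (auto simp: inj_def axis_eq_axis)
  ultimately show ?thesis using sum.reindex[of "\<lambda>i. axis i 1 :: real ^ 'd" UNIV f] by (simp add: o_def)
qed

lemma laplace_snd_axis:
  "laplace_snd F z = (\<Sum>i\<in>UNIV. dderiv (0, axis i 1) (dderiv (0, axis i 1) F) z)"
  for F :: "'t::euclidean_space \<times> (real ^ 'd) \<Rightarrow> real"
  unfolding laplace_snd_def by (rule sum_Basis_axis)

text \<open>
A spatial derivative of a periodic function has mean zero over every slice. This makes divergences
possible right-hand sides of the Poisson equation.
\<close>

lemma mean_free_dderiv_snd:
  assumes "smooth_periodic F"
  shows "mean_free (dderiv (0, v) F)"
proof (rule mean_freeI)
  note F = smooth_periodicD[OF assms]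
  show "C_infinity (dderiv (0, v) F)" "periodic (dderiv (0, v) F)"
    using F by (auto intro: C_infinityD(3) dderiv_periodic)
  fix t
  from integral_dderiv_periodic[OF C_infinity_slice[OF F(1)] periodic_slice[OF F(2)], of v]
  show "zero_mean (\<lambda>y. dderiv (0, v) F (t, y))"
    by (simp add: zero_mean_def dderiv_slice[OF F(1)])
qed

lemma dderiv_time_space:
  fixes F :: "real \<times> 'a::euclidean_space \<Rightarrow> real"
  assumes "C_infinity F"
  shows "dderiv (\<tau>, v) F z = \<tau> * dderiv (1, 0) F z + dderiv (0, v) F z"
proof -
  have lin: "linear (\<lambda>v. dderiv v F z)"
    using has_derivative_linear[OF C_infinityD(2)[OF assms]] .
  have "(\<tau>, v) = \<tau> *\<^sub>R (1, 0) + (0, v)" by simp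
  then show ?thesis
    using linear_add[OF lin, of "\<tau> *\<^sub>R (1, 0)" "(0, v)"] linear_cmul[OF lin, of \<tau> "(1, 0)"] by simp
qed

text \<open>
The slice mean of \<open>F\<close> depends neither on time, by assumption, nor on the position of the cell. It is
therefore a constant, namely the mean of \<open>F\<close> over the whole torus.
\<close>

lemma mean_free_if_time_derivative_mean_free:
  fixes F :: "real \<times> 'a::euclidean_space \<Rightarrow> real"
  assumes F: "smooth_periodic F" and Ft: "mean_free (dderiv (1, 0) F)" and mean: "torus_integral F = 0"
  shows "mean_free F"
proof -
  note F' = smooth_periodicD[OF F]
  have "slice_mean (dderiv h F) z = 0" for h z
  proof -
    obtain \<tau> v where h: "h = (\<tau>, v)" by force
    have "dderiv h F = (\<lambda>z. \<tau> * dderiv (1, 0) F z - (- 1) * dderiv (0, v) F z)"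
      unfolding h by (rule ext) (simp add: dderiv_time_space[OF F'(1), of \<tau> v])
    moreover have "mean_free (\<lambda>z. \<tau> * dderiv (1, 0) F z - (- 1) * dderiv (0, v) F z)"
      by (intro mean_free_diff mean_free_cmult Ft mean_free_dderiv_snd[OF F])
    ultimately show ?thesis using mean_freeD(3)[of "dderiv h F" z] by simp
  qed
  moreover have "(slice_mean F has_derivative (\<lambda>h. slice_mean (dderiv h F) z)) (at z)" for z
    unfolding slice_mean_def by (rule smear_has_derivative[OF slice_mean_weights C_infinity_C_k[OF F'(1)]])
  ultimately have "\<exists>c. \<forall>z\<in>UNIV. slice_mean F z = c"
    by (intro has_derivative_zero_constant) auto
  then obtain c where c: "\<And>z. slice_mean F z = c" by auto
  have One: "(One :: real \<times> 'a) = (1, One)"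
    by (simp add: sum_Basis_prod_eq prod_eq_iff fst_sum snd_sum)
  have "torus_integral F = integral (cbox (0, 0) (1, One)) F"
    unfolding One by (simp add: zero_prod_def)
  also have "\<dots> = integral (cbox 0 1) (\<lambda>t. integral (cbox 0 One) (\<lambda>y. F (t, y)))"
    by (rule integral_prod_continuous) (rule C_infinityD(4)[OF F'(1)])
  also have "(\<lambda>t. integral (cbox 0 One) (\<lambda>y. F (t, y))) = (\<lambda>t. c)"
    using c slice_mean_eq[of F _ 0] by auto
  finally have "c = 0" using mean by simp
  then show ?thesis using F' c by (simp add: mean_free_def)
qed

text \<open>
The identity \<open>\<integral> \<epsilon> \<bullet> \<sigma> = 0\<close> in components. Here \<open>a\<close> and \<open>v\<close> are the divergences of \<open>e\<close> and \<open>s\<close>, and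
\<open>p\<close> is the Leray projection of \<open>v\<close>, with the gradient part written as the gradient of a solution \<open>\<phi>\<close>
of \<open>\<Delta>\<phi> = div v\<close>. Each identity between fields in the proof holds because the difference of the two
sides is harmonic and mean-free.
\<close>

lemma strain_stress_orthogonality:
  fixes e s :: "'d::finite \<Rightarrow> 'd \<Rightarrow> real \<times> (real ^ 'd) \<Rightarrow> real" and \<phi> :: "real \<times> (real ^ 'd) \<Rightarrow> real"
  defines "D \<equiv> (\<lambda>i F. dderiv (0 :: real, axis i 1 :: real ^ 'd) F)"
    and "Dt \<equiv> (\<lambda>F. dderiv (1 :: real, 0 :: real ^ 'd) F)"
  defines "a \<equiv> (\<lambda>i z. \<Sum>j\<in>UNIV. D j (e i j) z)" and "v \<equiv> (\<lambda>i z. \<Sum>j\<in>UNIV. D j (s i j) z)"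
  defines "p \<equiv> (\<lambda>i z. v i z - D i \<phi> z)"
  assumes e: "\<And>i j. smooth_periodic (e i j)" and s: "\<And>i j. smooth_periodic (s i j)"
    and s_sym: "\<And>i j. s i j = s j i" and e_trace: "\<And>z. (\<Sum>i\<in>UNIV. e i i z) = 0"
    and e_mean: "\<And>i j. torus_integral (e i j) = 0"
    and \<phi>: "smooth_periodic \<phi>" and \<phi>_eq: "\<And>z. laplace_snd \<phi> z = (\<Sum>i\<in>UNIV. D i (v i) z)"
    and evol: "\<And>i j z. Dt (e i j) z = 1/2 * (D j (p i) z + D i (p j) z)"
    and compat: "\<And>i j z. laplace_snd (e i j) z = D j (a i) z + D i (a j) z"
  shows "torus_integral (\<lambda>z. \<Sum>i\<in>UNIV. \<Sum>j\<in>UNIV. e i j z * s i j z) = 0"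
proof -
  note sp = smooth_periodic_intros
  have D_sp: "smooth_periodic (D i F)" if "smooth_periodic F" for i F
    unfolding D_def using that by (rule smooth_periodic_dderiv)
  have Dt_sp: "smooth_periodic (Dt F)" if "smooth_periodic F" for F
    unfolding Dt_def using that by (rule smooth_periodic_dderiv)
  have D_adm: "mean_free (D i F)" if "smooth_periodic F" for i F
    unfolding D_def using that by (rule mean_free_dderiv_snd)
  have D_sum: "D i (\<lambda>z. \<Sum>j\<in>UNIV. F j z) z = (\<Sum>j\<in>UNIV. D i (F j) z)"
    if "\<And>j. smooth_periodic (F j)" for i z and F :: "'d \<Rightarrow> real \<times> (real ^ 'd) \<Rightarrow> real"
    unfolding D_def by (simp add: dderiv_sum smooth_periodicD(1) that)
  have D_comm: "D i (D j F) = D j (D i F)" if "smooth_periodic F" for i j F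
    unfolding D_def by (rule dderiv_commute[OF smooth_periodicD(1)[OF that]])
  have a_adm: "mean_free (a i)" for i
    unfolding a_def by (intro mean_free_sum D_adm e finite)
  have v_adm: "mean_free (v i)" for i
    unfolding v_def by (intro mean_free_sum D_adm s finite)
  have p_adm: "mean_free (p i)" for i
    unfolding p_def by (intro mean_free_diff v_adm D_adm \<phi>)
  note a_sp = mean_free_smooth_periodic[OF a_adm] and v_sp = mean_free_smooth_periodic[OF v_adm]
    and p_sp = mean_free_smooth_periodic[OF p_adm]
  have lap: "laplace_snd F z = (\<Sum>i\<in>UNIV. D i (D i F) z)" for F z
    unfolding D_def by (rule laplace_snd_axis)
  have lap_D: "laplace_snd (D i F) = D i (laplace_snd F)" if "smooth_periodic F" for i F
    unfolding D_def by (rule laplace_snd_dderiv[OF smooth_periodicD(1)[OF that]])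

  \<comment> \<open>\<open>\<partial>\<^sub>t e\<close> is a symmetric gradient and so has mean zero over each slice\<close>
  have e_adm: "mean_free (e i j)" for i j
  proof (rule mean_free_if_time_derivative_mean_free[OF e _ e_mean])
    have "Dt (e i j) = (\<lambda>z. 1/2 * D j (p i) z - (- 1/2) * D i (p j) z)"
      using evol[of i j] by (auto simp: algebra_simps)
    moreover have "mean_free (\<lambda>z. 1/2 * D j (p i) z - (- 1/2) * D i (p j) z)"
      by (intro mean_free_diff mean_free_cmult D_adm p_sp)
    ultimately show "mean_free (dderiv (1, 0) (e i j))" by (simp add: Dt_def)
  qed

  \<comment> \<open>the trace of the compatibility equation is \<open>2 div a = \<Delta> (tr e) = 0\<close>\<close>
  have div_a: "(\<Sum>i\<in>UNIV. D i (a i) z) = 0" for z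
  proof -
    have "2 * (\<Sum>i\<in>UNIV. D i (a i) z) = (\<Sum>i\<in>UNIV. laplace_snd (e i i) z)"
      unfolding compat sum_distrib_left by (intro sum.cong) auto
    also have "\<dots> = laplace_snd (\<lambda>z. \<Sum>i\<in>UNIV. e i i z) z"
      by (rule laplace_snd_sum[symmetric]) (intro smooth_periodicD(1) e)
    also have "\<dots> = 0" by (simp add: e_trace laplace_snd_def dderiv_def)
    finally show ?thesis by simp
  qed

  have "\<exists>U. mean_free U \<and> (\<forall>z. laplace_snd U z = a i z)" for i
    using poisson_exists[OF a_adm[of i]] by metis
  then obtain U where U_adm: "\<And>i. mean_free (U i)" and U_lap: "\<And>i z. laplace_snd (U i) z = a i z"
    by metis
  note U = mean_free_smooth_periodic[OF U_adm]
  have U_lap': "laplace_snd (U i) = a i" for i using U_lap by auto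

  have div_U: "(\<Sum>i\<in>UNIV. D i (U i) z) = 0" for z
  proof (rule poisson_unique[where F = "\<lambda>z. \<Sum>i\<in>UNIV. D i (U i) z"])
    show "mean_free (\<lambda>z. \<Sum>i\<in>UNIV. D i (U i) z)" by (intro mean_free_sum D_adm U finite)
    fix z
    have "laplace_snd (\<lambda>z. \<Sum>i\<in>UNIV. D i (U i) z) z = (\<Sum>i\<in>UNIV. laplace_snd (D i (U i)) z)"
      by (rule laplace_snd_sum) (intro smooth_periodicD(1) D_sp U)
    also have "\<dots> = 0" by (simp add: lap_D[OF U] U_lap' div_a)
    finally show "laplace_snd (\<lambda>z. \<Sum>i\<in>UNIV. D i (U i) z) z = 0" .
  qed

  have e_U: "e i j z = D j (U i) z + D i (U j) z" for i j z
  proof -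
    let ?F = "\<lambda>z. (e i j z - D j (U i) z) - D i (U j) z"
    have "?F z = 0"
    proof (rule poisson_unique)
      show "mean_free ?F" by (intro mean_free_diff e_adm D_adm U)
      fix z
      have "laplace_snd ?F z = laplace_snd (e i j) z - laplace_snd (D j (U i)) z - laplace_snd (D i (U j)) z"
        by (simp add: laplace_snd_diff C_infinity_diff smooth_periodicD(1) D_sp U e)
      then show "laplace_snd ?F z = 0" by (simp add: lap_D[OF U] U_lap' compat)
    qed
    then show ?thesis by simp
  qed

  have div_p: "(\<Sum>i\<in>UNIV. D i (p i) z) = 0" for z
  proof -
    have "D i (p i) z = D i (v i) z - D i (D i \<phi>) z" for i
      unfolding p_def D_def by (simp add: dderiv_diff C_infinityD(3) smooth_periodicD(1) v_sp \<phi>)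
    then show ?thesis using \<phi>_eq[of z] lap[of \<phi> z] by (simp add: sum_subtractf)
  qed

  \<comment> \<open>both sides have the Laplacian \<open>\<Delta>p\<close>, by the divergence of the evolution equation and \<open>div p = 0\<close>\<close>
  have U_t: "2 * Dt (U i) z = p i z" for i z
  proof -
    let ?F = "\<lambda>z. 2 * Dt (U i) z - p i z"
    have "?F z = 0"
    proof (rule poisson_unique)
      show "mean_free ?F"
        unfolding Dt_def by (intro mean_free_diff mean_free_cmult mean_free_dderiv U_adm p_adm)
      fix z
      have "laplace_snd ?F z = 2 * laplace_snd (Dt (U i)) z - laplace_snd (p i) z"
        by (simp add: laplace_snd_diff laplace_snd_cmult C_infinity_cmult smooth_periodicD(1) Dt_sp U p_sp)
      also have "laplace_snd (Dt (U i)) z = Dt (a i) z"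
        unfolding Dt_def laplace_snd_dderiv[OF smooth_periodicD(1)[OF U]] U_lap' ..
      also have "Dt (a i) z = (\<Sum>j\<in>UNIV. D j (Dt (e i j)) z)"
        unfolding a_def Dt_def D_def
        by (simp add: dderiv_sum C_infinityD(3) smooth_periodicD(1)[OF e]
            dderiv_commute[OF smooth_periodicD(1)[OF e], of "(1, 0)"])
      also have "2 * \<dots> = (\<Sum>j\<in>UNIV. D j (D j (p i)) z + D j (D i (p j)) z)"
      proof -
        have "2 * D j (Dt (e i j)) z = D j (D j (p i)) z + D j (D i (p j)) z" for j
        proof -
          have "Dt (e i j) = (\<lambda>z. 1/2 * (D j (p i) z + D i (p j) z))" using evol by auto
          then show ?thesis
            unfolding D_def
            by (simp only: dderiv_cmult dderiv_add C_infinity_add C_infinityD(3) smooth_periodicD(1)[OF p_sp]) simp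
        qed
        then show ?thesis by (simp add: sum_distrib_left)
      qed
      also have "\<dots> = laplace_snd (p i) z + D i (\<lambda>z. \<Sum>j\<in>UNIV. D j (p j) z) z"
        by (simp only: sum.distrib lap D_sum[OF D_sp[OF p_sp]] D_comm[OF p_sp, of i])
      also have "D i (\<lambda>z. \<Sum>j\<in>UNIV. D j (p j) z) z = 0"
        unfolding div_p by (simp add: D_def dderiv_def)
      finally show "laplace_snd ?F z = 0" by simp
    qed
    then show ?thesis by simp
  qed

  have int_sum: "torus_integral (\<lambda>z. \<Sum>i\<in>UNIV. F i z) = (\<Sum>i\<in>UNIV. torus_integral (F i))"
    if "\<And>i. smooth_periodic (F i)" for F :: "'d \<Rightarrow> real \<times> (real ^ 'd) \<Rightarrow> real"
    by (rule integral_sum[OF finite]) (intro smooth_periodic_integrable that)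
  have parts: "torus_integral (\<lambda>z. D j F z * G z) = - torus_integral (\<lambda>z. F z * D j G z)"
    if "smooth_periodic F" "smooth_periodic G" for j F G
    unfolding D_def using that by (rule torus_integral_by_parts)
  \<comment> \<open>\<open>v = 2 \<partial>\<^sub>t U + \<nabla>\<phi>\<close>; the first part gives a time derivative of \<open>|U|\<^sup>2\<close>, the second is orthogonal to \<open>U\<close>\<close>
  have U_v: "(\<Sum>i\<in>UNIV. torus_integral (\<lambda>z. U i z * v i z)) = 0"
  proof -
    have "torus_integral (\<lambda>z. U i z * v i z) = - torus_integral (\<lambda>z. D i (U i) z * \<phi> z)" for i
    proof -
      have "torus_integral (\<lambda>z. U i z * Dt (U i) z) = 0"
        using torus_integral_by_parts[OF U U, of "(1, 0)" i i] unfolding Dt_def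
        by (simp add: mult.commute[of "dderiv _ _ _"])
      moreover have "v i z = 2 * Dt (U i) z + D i \<phi> z" for z using U_t[of i z] by (simp add: p_def)
      then have "(\<lambda>z. U i z * v i z) = (\<lambda>z. 2 * (U i z * Dt (U i) z) + U i z * D i \<phi> z)"
        by (auto simp: algebra_simps)
      then have "torus_integral (\<lambda>z. U i z * v i z)
          = torus_integral (\<lambda>z. 2 * (U i z * Dt (U i) z)) + torus_integral (\<lambda>z. U i z * D i \<phi> z)"
        by (simp only:) (intro integral_add smooth_periodic_integrable sp U D_sp Dt_sp \<phi>)
      ultimately show ?thesis using parts[OF U \<phi>, of i i] by simp
    qed
    then have "(\<Sum>i\<in>UNIV. torus_integral (\<lambda>z. U i z * v i z)) = - (\<Sum>i\<in>UNIV. torus_integral (\<lambda>z. D i (U i) z * \<phi> z))"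
      by (simp add: sum_negf)
    also have "(\<Sum>i\<in>UNIV. torus_integral (\<lambda>z. D i (U i) z * \<phi> z)) = torus_integral (\<lambda>z. \<Sum>i\<in>UNIV. D i (U i) z * \<phi> z)"
      by (rule int_sum[symmetric]) (intro sp D_sp U \<phi>)
    also have "\<dots> = torus_integral (\<lambda>z. 0)"
      using div_U by (simp flip: sum_distrib_right)
    finally show ?thesis by simp
  qed
  have half: "(\<Sum>i\<in>UNIV. \<Sum>j\<in>UNIV. torus_integral (\<lambda>z. D j (U i) z * s i j z)) = 0"
  proof -
    have "(\<Sum>j\<in>UNIV. torus_integral (\<lambda>z. D j (U i) z * s i j z)) = - torus_integral (\<lambda>z. U i z * v i z)" for i
    proof -
      have "torus_integral (\<lambda>z. U i z * v i z) = (\<Sum>j\<in>UNIV. torus_integral (\<lambda>z. U i z * D j (s i j) z))"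
        unfolding v_def sum_distrib_left by (rule int_sum) (intro sp U D_sp s)
      then show ?thesis by (simp add: parts[OF U s] sum_negf)
    qed
    then show ?thesis using U_v by (simp add: sum_negf)
  qed
  have flip: "(\<lambda>z. D i (U j) z * s i j z) = (\<lambda>z. D i (U j) z * s j i z)" for i j
    using s_sym[of i j] by simp
  have "torus_integral (\<lambda>z. \<Sum>i\<in>UNIV. \<Sum>j\<in>UNIV. e i j z * s i j z)
      = (\<Sum>i\<in>UNIV. torus_integral (\<lambda>z. \<Sum>j\<in>UNIV. e i j z * s i j z))"
    by (rule int_sum) (intro sp e s)
  also have "\<dots> = (\<Sum>i\<in>UNIV. \<Sum>j\<in>UNIV. torus_integral (\<lambda>z. e i j z * s i j z))"
    by (intro sum.cong refl int_sum sp e s)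
  also have "\<dots> = (\<Sum>i\<in>UNIV. \<Sum>j\<in>UNIV. torus_integral (\<lambda>z. D j (U i) z * s i j z) + torus_integral (\<lambda>z. D i (U j) z * s i j z))"
  proof (intro sum.cong refl)
    fix i j
    have "(\<lambda>z. e i j z * s i j z) = (\<lambda>z. D j (U i) z * s i j z + D i (U j) z * s i j z)"
      by (simp add: e_U algebra_simps)
    then show "torus_integral (\<lambda>z. e i j z * s i j z)
        = torus_integral (\<lambda>z. D j (U i) z * s i j z) + torus_integral (\<lambda>z. D i (U j) z * s i j z)"
      by (simp only:) (intro integral_add smooth_periodic_integrable sp U D_sp s)
  qed
  also have "\<dots> = (\<Sum>i\<in>UNIV. \<Sum>j\<in>UNIV. torus_integral (\<lambda>z. D j (U i) z * s i j z))
      + (\<Sum>i\<in>UNIV. \<Sum>j\<in>UNIV. torus_integral (\<lambda>z. D i (U j) z * s i j z))"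
    by (simp add: sum.distrib)
  also have "(\<Sum>i\<in>UNIV. \<Sum>j\<in>UNIV. torus_integral (\<lambda>z. D i (U j) z * s i j z))
      = (\<Sum>i\<in>UNIV. \<Sum>j\<in>UNIV. torus_integral (\<lambda>z. D i (U j) z * s j i z))"
    by (intro sum.cong refl arg_cong[OF flip])
  also have "\<dots> = (\<Sum>j\<in>UNIV. \<Sum>i\<in>UNIV. torus_integral (\<lambda>z. D i (U j) z * s j i z))"
    by (rule sum.swap)
  finally show ?thesis using half by simp
qed

section \<open>The differential operator in coordinates\<close>

lemma partial_eq_dderiv: "partial i u = dderiv (axis i 1) u"
  by (simp add: partial_def[abs_def] dderiv_def)

lemma C_k_vec:
  fixes f :: "'d::finite \<Rightarrow> 'a::euclidean_space \<Rightarrow> real"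
  assumes "\<And>i. C_k n (f i)"
  shows "C_k n (\<lambda>x. \<chi> i. f i x)"
proof -
  have "C_k n (\<lambda>x. \<Sum>i\<in>UNIV. f i x *\<^sub>R axis i (1::real))"
    by (intro C_k_sum C_k_linear[OF bounded_linear_scaleR_left assms])
  moreover have "(\<lambda>x. \<Sum>i\<in>UNIV. f i x *\<^sub>R axis i (1::real)) = (\<lambda>x. \<chi> i. f i x)"
    by (auto simp: vec_eq_iff axis_def if_distrib cong: if_cong)
  ultimately show ?thesis by simp
qed

lemma dderiv_nth: "u differentiable (at x) \<Longrightarrow> dderiv v (\<lambda>x. u x $ i) x = dderiv v u x $ i"
  by (rule dderiv_linear[OF bounded_linear_vec_nth])

lemma laplacian_nth:
  fixes u :: "real ^ 'd \<Rightarrow> real ^ 'n"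
  assumes "C_k 2 u"
  shows "laplacian u x $ i = laplace (\<lambda>y. u y $ i) x"
proof -
  have u: "C_k (Suc (Suc 0)) u" using assms by (simp add: numeral_2_eq_2)
  have 1: "dderiv v (\<lambda>y. u y $ i) = (\<lambda>y. dderiv v u y $ i)" for v
    by (rule ext, rule dderiv_nth, rule C_k_SucD(1)[OF u])
  have "dderiv v (dderiv v (\<lambda>y. u y $ i)) x = dderiv v (dderiv v u) x $ i" for v
    unfolding 1 by (rule dderiv_nth, rule C_k_SucD(1)[OF C_k_SucD(2)[OF u]])
  then show ?thesis
    by (simp add: laplacian_def laplace_def partial_eq_dderiv sum_Basis_axis)
qed

lemma zero_mean_nth:
  fixes u :: "'a::euclidean_space \<Rightarrow> real ^ 'n"
  assumes "continuous_on UNIV u"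
  shows "zero_mean u \<longleftrightarrow> (\<forall>i. zero_mean (\<lambda>x. u x $ i))"
proof -
  have "u integrable_on cbox 0 One"
    by (intro integrable_continuous continuous_on_subset[OF assms]) auto
  from integral_linear[OF this bounded_linear_vec_nth]
  have "integral (cbox 0 One) (\<lambda>x. u x $ i) = integral (cbox 0 One) u $ i" for i by (simp add: o_def)
  then show ?thesis by (auto simp: zero_mean_def vec_eq_iff)
qed

text \<open>
Uniqueness of periodic mean-zero solutions makes any solution the one picked by the definite description.
\<close>

lemma inverse_laplacian_eq:
  fixes u :: "real ^ 'd \<Rightarrow> real ^ 'n"
  assumes "periodic u" "C_k 2 u" "zero_mean u" "laplacian u = g"
  shows "inverse_laplacian g = u"
  unfolding inverse_laplacian_def
proof (rule the_equality)
  show "periodic u \<and> C_k 2 u \<and> zero_mean u \<and> laplacian u = g" using assms by simp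
  fix w assume w: "periodic w \<and> C_k 2 w \<and> zero_mean w \<and> laplacian w = g"
  have d: "C_k 2 (\<lambda>x. w x + (-1) *\<^sub>R u x)"
    using w assms(2) by (intro C_k_add C_k_scaleR) auto
  let ?d = "\<lambda>x. w x - u x"
  have d: "C_k 2 ?d" using d by simp
  have lin: "laplacian ?d x = laplacian w x - laplacian u x" for x
  proof -
    have W: "C_k (Suc (Suc 0)) w" and U: "C_k (Suc (Suc 0)) u" using w assms(2) by (auto simp: numeral_2_eq_2)
    have 1: "dderiv v ?d = (\<lambda>x. dderiv v w x - dderiv v u x)" for v
      by (rule ext, rule dderiv_eq) (intro has_derivative_diff C_k_SucD(3)[OF W] C_k_SucD(3)[OF U])
    have "dderiv v (dderiv v ?d) x = dderiv v (dderiv v w) x - dderiv v (dderiv v u) x" for v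
      unfolding 1 by (rule dderiv_eq)
        (intro has_derivative_diff C_k_SucD(3)[OF C_k_SucD(2)[OF W]] C_k_SucD(3)[OF C_k_SucD(2)[OF U]])
    then show ?thesis by (simp add: laplacian_def partial_eq_dderiv sum_subtractf)
  qed
  have cont: "continuous_on UNIV w" "continuous_on UNIV u" using w assms(2) C_k_continuous by auto
  have "?d x $ i = 0" for x i
  proof (rule harmonic_periodic_eq_0[where u = "\<lambda>x. ?d x $ i"])
    show "C_k 2 (\<lambda>x. ?d x $ i)" by (rule C_k_linear[OF bounded_linear_vec_nth d])
    show "periodic (\<lambda>x. ?d x $ i)" using w assms(1) by (simp add: periodic_def)
    have "zero_mean ?d"
      unfolding zero_mean_def
      by (subst integral_diff) (use w assms(3) cont in \<open>auto simp: zero_mean_def intro: integrable_continuous continuous_on_subset\<close>)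
    then show "zero_mean (\<lambda>x. ?d x $ i)" using zero_mean_nth[OF C_k_continuous[OF d]] by blast
    show "laplace (\<lambda>x. ?d x $ i) x = 0" for x
      using laplacian_nth[OF d, of x i] lin[of x] w assms(4) by simp
  qed
  then show "w = u" by (auto simp: vec_eq_iff)
qed

lemma grad_plus_transpose_nth:
  fixes g :: "'d::finite \<Rightarrow> real ^ 'd \<Rightarrow> real"
  assumes "\<And>i. C_k (Suc 0) (g i)"
  shows "grad_plus_transpose (\<lambda>x. \<chi> i. g i x) x $ i $ j = dderiv (axis j 1) (g i) x + dderiv (axis i 1) (g j) x"
proof -
  have diff: "(\<lambda>x. \<chi> i. g i x) differentiable (at x)"
    by (rule C_k_SucD(1)[OF C_k_vec[OF assms]])
  have "dderiv v (g i) x = frechet_derivative (\<lambda>x. \<chi> i. g i x) (at x) v $ i" for v i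
    using dderiv_nth[OF diff, of v i] by (simp add: dderiv_def)
  then show ?thesis
    by (simp add: grad_plus_transpose_def jacobian_def matrix_def transpose_def)
qed

lemma matrix_smooth_periodic:
  fixes u :: "'a::euclidean_space \<Rightarrow> real ^ 'n ^ 'm"
  assumes "C_infinity u" "periodic u"
  shows "smooth_periodic (\<lambda>z. u z $ i $ j)"
  using C_infinity_linear[OF bounded_linear_vec_nth C_infinity_linear[OF bounded_linear_vec_nth assms(1)]] assms(2)
  by (simp add: smooth_periodic_def periodic_def)

lemma dderiv_nth2: "u differentiable (at x) \<Longrightarrow> dderiv v (\<lambda>x. u x $ i $ j) x = dderiv v u x $ i $ j"
  using bounded_linear_compose[OF bounded_linear_vec_nth[of j] bounded_linear_vec_nth[of i]]
  by (intro dderiv_linear[of "\<lambda>A. A $ i $ j"]) (auto simp: o_def)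

lemma integral_nth2:
  fixes u :: "'a::euclidean_space \<Rightarrow> real ^ 'n ^ 'm"
  assumes "u integrable_on S"
  shows "integral S (\<lambda>x. u x $ i $ j) = integral S u $ i $ j"
  using integral_linear[OF assms bounded_linear_compose[OF bounded_linear_vec_nth[of j] bounded_linear_vec_nth[of i]]]
  by (simp add: o_def)

lemma vector_derivative_time:
  fixes u :: "real \<times> 'a::euclidean_space \<Rightarrow> 'b::real_normed_vector"
  assumes "C_infinity u"
  shows "vector_derivative (\<lambda>s. u (s, x)) (at t) = dderiv (1, 0) u (t, x)"
proof (rule vector_derivative_at)
  have "((\<lambda>s. (s, x)) has_derivative (\<lambda>d. (d, 0))) (at t)" by (auto intro!: derivative_eq_intros)
  from has_derivative_compose[OF this C_infinityD(2)[OF assms]]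
  have D: "((\<lambda>s. u (s, x)) has_derivative (\<lambda>d. dderiv (d, 0) u (t, x))) (at t)" .
  have "(\<lambda>d. dderiv (d, 0) u (t, x)) = (\<lambda>d. d *\<^sub>R dderiv (1, 0) u (t, x))"
  proof
    show "dderiv (d, 0) u (t, x) = d *\<^sub>R dderiv (1, 0) u (t, x)" for d
      using dderiv_scaleR[OF C_infinityD(1)[OF assms], of d "(1, 0)"] by simp
  qed
  from D[unfolded this] show "((\<lambda>s. u (s, x)) has_vector_derivative dderiv (1, 0) u (t, x)) (at t)"
    unfolding has_vector_derivative_def .
qed

lemma laplacian_matrix_slice:
  fixes u :: "real \<times> (real ^ 'd) \<Rightarrow> real ^ 'n ^ 'm"
  assumes "C_infinity u"
  shows "laplacian (\<lambda>y. u (t, y)) x $ i $ j = laplace_snd (\<lambda>z. u z $ i $ j) (t, x)"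
proof -
  have 1: "dderiv v (\<lambda>z. f z $ i $ j) = (\<lambda>z. dderiv v f z $ i $ j)"
    if "C_infinity f" for v and f :: "real \<times> (real ^ 'd) \<Rightarrow> real ^ 'n ^ 'm"
    by (rule ext, rule dderiv_nth2, rule C_infinityD(1)[OF that])
  show ?thesis
    by (simp add: laplacian_def partial_eq_dderiv laplace_snd_axis dderiv_slice C_infinityD(3) assms 1)
qed

lemma mdiv_slice:
  fixes u :: "real \<times> (real ^ 'd) \<Rightarrow> real ^ 'd ^ 'd"
  assumes "C_infinity u"
  shows "mdiv (\<lambda>y. u (t, y)) = (\<lambda>x. \<chi> i. \<Sum>j\<in>UNIV. dderiv (0, axis j 1) (\<lambda>z. u z $ i $ j) (t, x))"
proof -
  have "C_infinity (\<lambda>z. u z $ i $ j)" for i j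
    by (intro C_infinity_linear[OF bounded_linear_vec_nth] assms)
  then show ?thesis
    unfolding mdiv_def[abs_def] partial_eq_dderiv
    by (subst dderiv_slice) auto
qed

text \<open>
What is left to check is that the operator, written with spatial slices and the Leray projector, has
the components required by \<open>strain_stress_orthogonality\<close>. The gradient of a solution \<open>\<phi>\<close> of
\<open>\<Delta>\<phi> = div (div \<sigma>)\<close> solves the vector equation whose solution defines the gradient part in the Leray
projector.
\<close>

lemma A_tilde_null_orthogonal:
  fixes \<epsilon> \<sigma> :: "real \<times> (real ^ 'd) \<Rightarrow> real ^ 'd ^ 'd"
  assumes "\<And>z. \<epsilon> z \<in> sym0" "\<And>z. \<sigma> z \<in> sym0" "periodic \<epsilon>" "periodic \<sigma>"
    and \<epsilon>: "C_infinity \<epsilon>" and \<sigma>: "C_infinity \<sigma>" and "zero_mean \<epsilon>"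
    and A: "\<And>z. A_tilde \<epsilon> \<sigma> z = 0"
  shows "integral (cbox 0 One) (\<lambda>z. \<epsilon> z \<bullet> \<sigma> z) = 0"
proof -
  define e s where "e i j z = \<epsilon> z $ i $ j" and "s i j z = \<sigma> z $ i $ j" for i j z
  let ?D = "\<lambda>i. dderiv (0, axis i 1) :: (real \<times> (real ^ 'd) \<Rightarrow> real) \<Rightarrow> real \<times> (real ^ 'd) \<Rightarrow> real"
  define a v where "a i z = (\<Sum>j\<in>UNIV. ?D j (e i j) z)" and "v i z = (\<Sum>j\<in>UNIV. ?D j (s i j) z)" for i z
  have e: "smooth_periodic (e i j)" and s: "smooth_periodic (s i j)" for i j
    unfolding e_def s_def using matrix_smooth_periodic assms by blast+
  have a: "smooth_periodic (a i)" and v: "smooth_periodic (v i)" for i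
    unfolding a_def v_def by (intro smooth_periodic_intros e s)+
  have "mean_free (\<lambda>z. \<Sum>i\<in>UNIV. ?D i (v i) z)"
    by (intro mean_free_sum mean_free_dderiv_snd v finite)
  from poisson_exists[OF this]
  obtain \<phi> where \<phi>_adm: "mean_free \<phi>" and \<phi>_eq: "\<And>z. laplace_snd \<phi> z = (\<Sum>i\<in>UNIV. ?D i (v i) z)"
    by blast
  note \<phi> = mean_free_smooth_periodic[OF \<phi>_adm]
  have D\<phi>: "mean_free (?D i \<phi>)" for i by (rule mean_free_dderiv_snd[OF \<phi>])
  define p where "p i z = v i z - ?D i \<phi> z" for i z
  have p: "smooth_periodic (p i)" for i unfolding p_def by (intro smooth_periodic_intros v \<phi>)
  have C1: "C_k n (\<lambda>y. F (t, y))" if "smooth_periodic F" for n t and F :: "real \<times> (real ^ 'd) \<Rightarrow> real"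
    by (rule C_k_slice[OF C_infinity_C_k[OF smooth_periodicD(1)[OF that]]])
  have slice: "dderiv b (\<lambda>y. F (t, y)) = (\<lambda>y. dderiv (0, b) F (t, y))"
    if "smooth_periodic F" for b t and F :: "real \<times> (real ^ 'd) \<Rightarrow> real"
    by (rule dderiv_slice[OF smooth_periodicD(1)[OF that]])

  have mdiv_\<sigma>: "mdiv (\<lambda>y. \<sigma> (t, y)) = (\<lambda>x. \<chi> i. v i (t, x))" for t
    unfolding mdiv_slice[OF \<sigma>] v_def s_def ..
  have mdiv_\<epsilon>: "mdiv (\<lambda>y. \<epsilon> (t, y)) = (\<lambda>x. \<chi> i. a i (t, x))" for t
    unfolding mdiv_slice[OF \<epsilon>] a_def e_def ..
  have leray: "leray (mdiv (\<lambda>y. \<sigma> (t, y))) = (\<lambda>x. \<chi> i. p i (t, x))" for t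
  proof -
    have vdiv: "vdiv (mdiv (\<lambda>y. \<sigma> (t, y))) = (\<lambda>x. laplace_snd \<phi> (t, x))"
      unfolding mdiv_\<sigma> vdiv_def[abs_def] partial_eq_dderiv by (simp add: slice v \<phi>_eq)
    have lap_sp: "smooth_periodic (laplace_snd \<phi>)"
      unfolding laplace_snd_def[abs_def] by (intro smooth_periodic_intros \<phi>)
    have grad: "grad (vdiv (mdiv (\<lambda>y. \<sigma> (t, y)))) = (\<lambda>x. \<chi> i. ?D i (laplace_snd \<phi>) (t, x))"
      unfolding vdiv grad_def[abs_def] partial_eq_dderiv by (simp add: slice lap_sp)
    let ?q = "\<lambda>x. \<chi> i. ?D i \<phi> (t, x)"
    have q: "C_k n ?q" for n
      by (intro C_k_vec C1 smooth_periodic_intros \<phi>)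
    have "inverse_laplacian (grad (vdiv (mdiv (\<lambda>y. \<sigma> (t, y))))) = ?q"
    proof (rule inverse_laplacian_eq)
      show "periodic ?q"
        using periodic_slice[OF mean_freeD(2)[OF D\<phi>]] by (simp add: periodic_def)
      show "C_k 2 ?q" by (rule q)
      show "zero_mean ?q"
        unfolding zero_mean_nth[OF C_k_continuous[OF q]] using zero_mean_slice[OF D\<phi>] by simp
      show "laplacian ?q = grad (vdiv (mdiv (\<lambda>y. \<sigma> (t, y))))"
      proof (rule ext, unfold vec_eq_iff, intro allI)
        fix x i
        have "laplacian ?q x $ i = laplace_snd (?D i \<phi>) (t, x)"
          using laplacian_nth[OF q, of x i] laplace_slice[OF mean_freeD(1)[OF D\<phi>]] by simp
        then show "laplacian ?q x $ i = grad (vdiv (mdiv (\<lambda>y. \<sigma> (t, y)))) x $ i"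
          unfolding grad by (simp add: laplace_snd_dderiv smooth_periodicD(1)[OF \<phi>])
      qed
    qed
    then show ?thesis
      unfolding leray_def[abs_def] mdiv_\<sigma> by (auto simp: vec_eq_iff p_def)
  qed
  have evol: "dderiv (1, 0) (e i j) z = 1/2 * (?D j (p i) z + ?D i (p j) z)" for i j z
  proof -
    obtain t x where z: "z = (t, x)" by force
    have "fst (A_tilde \<epsilon> \<sigma> (t, x)) $ i $ j = 0" using A[of "(t, x)"] by simp
    then have "dderiv (1, 0) \<epsilon> (t, x) $ i $ j - 1/2 * (?D j (p i) (t, x) + ?D i (p j) (t, x)) = 0"
      by (simp add: A_tilde_def vector_derivative_time[OF \<epsilon>] leray grad_plus_transpose_nth C1 p slice)
    then show ?thesis
      unfolding e_def z using dderiv_nth2[OF C_infinityD(1)[OF \<epsilon>]] by simp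
  qed
  have compat: "laplace_snd (e i j) z = ?D j (a i) z + ?D i (a j) z" for i j z
  proof -
    obtain t x where z: "z = (t, x)" by force
    have "snd (A_tilde \<epsilon> \<sigma> (t, x)) $ i $ j = 0" using A[of "(t, x)"] by simp
    then have "laplace_snd (e i j) (t, x) - (?D j (a i) (t, x) + ?D i (a j) (t, x)) = 0"
      by (simp add: A_tilde_def laplacian_matrix_slice[OF \<epsilon>] mdiv_\<epsilon> grad_plus_transpose_nth C1 a slice
          flip: e_def)
    then show ?thesis unfolding z by simp
  qed
  have sym: "A $ i $ j = A $ j $ i" if "A \<in> sym0" for A :: "real ^ 'd ^ 'd" and i j
    using that unfolding sym0_def transpose_def by (auto simp: vec_eq_iff)
  have mean: "torus_integral (e i j) = 0" for i j
  proof -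
    have "\<epsilon> integrable_on cbox 0 One" by (intro integrable_continuous C_infinityD(4) \<epsilon>)
    from integral_nth2[OF this, of i j] show ?thesis
      using assms(7) by (simp add: e_def[abs_def] zero_mean_def)
  qed
  have "torus_integral (\<lambda>z. \<Sum>i\<in>UNIV. \<Sum>j\<in>UNIV. e i j z * s i j z) = 0"
  proof (rule strain_stress_orthogonality[where \<phi> = \<phi>])
    show "s i j = s j i" for i j using sym[OF assms(2)] by (auto simp: s_def)
    show "(\<Sum>i\<in>UNIV. e i i z) = 0" for z
      using assms(1)[of z] by (simp add: e_def sym0_def trace_def)
    show "laplace_snd \<phi> z = (\<Sum>i\<in>UNIV. ?D i (\<lambda>z. \<Sum>j\<in>UNIV. ?D j (s i j) z) z)" for z
      using \<phi>_eq[of z] by (simp add: v_def[abs_def])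
    show "dderiv (1, 0) (e i j) z = 1/2 * (?D j (\<lambda>z. (\<Sum>j\<in>UNIV. ?D j (s i j) z) - ?D i \<phi> z) z
       + ?D i (\<lambda>z. (\<Sum>i\<in>UNIV. ?D i (s j i) z) - ?D j \<phi> z) z)" for i j z
      using evol[of i j z] by (simp add: v_def[abs_def] p_def[abs_def])
    show "laplace_snd (e i j) z = ?D j (\<lambda>z. \<Sum>j\<in>UNIV. ?D j (e i j) z) z + ?D i (\<lambda>z. \<Sum>i\<in>UNIV. ?D i (e j i) z) z" for i j z
      using compat[of i j z] by (simp add: a_def[abs_def])
  qed (use e s \<phi> mean in auto)
  then show ?thesis by (simp add: inner_vec_def e_def s_def)
qed

section \<open>Convex duality on symmetric trace-free matrices\<close>

lemma subspace_sym0: "subspace (sym0 :: (real ^ 'd ^ 'd) set)"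
  unfolding subspace_def sym0_def
  by (auto simp: transpose_def vec_eq_iff trace_def sum.distrib simp flip: sum_distrib_left)

lemma closed_sym0: "closed (sym0 :: (real ^ 'd ^ 'd) set)"
  by (rule closed_subspace[OF subspace_sym0])

lemma C1_sym0_continuous: "C1_sym0 W \<Longrightarrow> continuous_on sym0 W"
  by (simp add: C1_sym0_def differentiable_imp_continuous_on)

lemma superlinear_growthE:
  fixes W :: "real ^ 'd ^ 'd \<Rightarrow> real"
  assumes "superlinear_growth W"
  obtains R where "\<And>e. e \<in> sym0 \<Longrightarrow> R \<le> norm e \<Longrightarrow> M * norm e \<le> W e"
proof -
  have "\<forall>\<^sub>F e in inf at_infinity (principal sym0). M \<le> W e / norm e"
    using assms unfolding superlinear_growth_def filterlim_at_top by blast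
  then obtain b where b: "\<And>e. b \<le> norm e \<Longrightarrow> e \<in> sym0 \<Longrightarrow> M \<le> W e / norm e"
    unfolding eventually_inf_principal eventually_at_infinity by blast
  show thesis
  proof
    fix e :: "real ^ 'd ^ 'd" assume e: "e \<in> sym0" "max b 1 \<le> norm e"
    then have "M \<le> W e / norm e" "0 < norm e" using b by auto
    then show "M * norm e \<le> W e" by (simp add: field_simps)
  qed
qed

text \<open>
Outside a large ball superlinear growth makes \<open>W\<close> dominate the linear term, and inside it everything is
bounded by compactness. That \<open>s\<close> may be any matrix, also outside \<open>sym0\<close>, is what makes the conjugate
a finite convex function on an open set.
\<close>

lemma conjugate_bdd_above:
  fixes W :: "real ^ 'd ^ 'd \<Rightarrow> real"
  assumes "continuous_on sym0 W" "superlinear_growth W"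
  shows "bdd_above ((\<lambda>e. e \<bullet> s - W e) ` sym0)"
proof -
  obtain R where R: "\<And>e. e \<in> sym0 \<Longrightarrow> R \<le> norm e \<Longrightarrow> norm s * norm e \<le> W e"
    using superlinear_growthE[OF assms(2)] by blast
  have "compact (sym0 \<inter> cball 0 R :: (real ^ 'd ^ 'd) set)"
    by (intro closed_Int_compact closed_sym0 compact_cball)
  moreover have "continuous_on (sym0 \<inter> cball 0 R) (\<lambda>e. e \<bullet> s - W e)"
    by (intro continuous_intros continuous_on_subset[OF assms(1)]) auto
  ultimately have "bounded ((\<lambda>e. e \<bullet> s - W e) ` (sym0 \<inter> cball 0 R))"
    by (intro compact_imp_bounded compact_continuous_image)
  then obtain B where B: "\<forall>x \<in> (\<lambda>e. e \<bullet> s - W e) ` (sym0 \<inter> cball 0 R). norm x \<le> B"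
    unfolding bounded_iff by blast
  have B: "e \<bullet> s - W e \<le> B" if "e \<in> sym0" "norm e \<le> R" for e
    using B that by (auto dest!: bspec[of _ _ e])
  show ?thesis
  proof (rule bdd_aboveI2)
    fix e :: "real ^ 'd ^ 'd" assume e: "e \<in> sym0"
    show "e \<bullet> s - W e \<le> max 0 B"
    proof (cases "norm e \<le> R")
      case True
      then show ?thesis using B[OF e] by simp
    next
      case False
      then have "norm s * norm e \<le> W e" using R[OF e] by simp
      then show ?thesis using norm_cauchy_schwarz[of e s] by (simp add: mult.commute)
    qed
  qed
qed

lemma convex_conjugate_le:
  fixes W :: "real ^ 'd ^ 'd \<Rightarrow> real"
  assumes "\<And>e. e \<in> sym0 \<Longrightarrow> e \<bullet> s - W e \<le> B"
  shows "convex_conjugate W s \<le> B"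
  unfolding convex_conjugate_def using assms subspace_0[OF subspace_sym0] by (intro cSUP_least) auto

context
  fixes W :: "real ^ 'd ^ 'd \<Rightarrow> real"
  assumes W: "C1_sym0 W" "superlinear_growth W"
begin

lemma Fenchel_inequality:
  assumes "e \<in> sym0"
  shows "e \<bullet> s \<le> W e + convex_conjugate W s"
proof -
  have "e \<bullet> s - W e \<le> convex_conjugate W s"
    unfolding convex_conjugate_def
    using conjugate_bdd_above[OF C1_sym0_continuous[OF W(1)] W(2)] assms by (rule cSUP_upper[rotated])
  then show ?thesis by simp
qed

text \<open>
As the conjugate is finite on the whole matrix space, which is open, convexity gives continuity.
On \<open>sym0\<close> alone, which has empty interior, this argument would not apply directly.
\<close>

lemma convex_conjugate_continuous: "continuous_on UNIV (convex_conjugate W)"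
proof (rule convex_on_continuous[OF open_UNIV], rule convex_onI)
  fix t :: real and x y :: "real ^ 'd ^ 'd"
  assume t: "0 < t" "t < 1"
  show "convex_conjugate W ((1 - t) *\<^sub>R x + t *\<^sub>R y) \<le> (1 - t) * convex_conjugate W x + t * convex_conjugate W y"
  proof (rule convex_conjugate_le)
    fix e :: "real ^ 'd ^ 'd" assume e: "e \<in> sym0"
    have "(1 - t) * (e \<bullet> x) \<le> (1 - t) * (W e + convex_conjugate W x)" "t * (e \<bullet> y) \<le> t * (W e + convex_conjugate W y)"
      using t Fenchel_inequality[OF e] by (auto intro: mult_left_mono)
    then show "e \<bullet> ((1 - t) *\<^sub>R x + t *\<^sub>R y) - W e \<le> (1 - t) * convex_conjugate W x + t * convex_conjugate W y"
      by (simp add: inner_add_right algebra_simps)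
  qed
qed simp

lemma fenchel_defect_continuous: "continuous_on (sym0 \<times> sym0) (\<lambda>(e, s). fenchel_defect W e s)"
  unfolding fenchel_defect_def split_beta
  by (intro continuous_intros continuous_on_compose2[OF C1_sym0_continuous[OF W(1)]]
      continuous_on_compose2[OF convex_conjugate_continuous]) auto

lemma fenchel_defect_nonneg: "e \<in> sym0 \<Longrightarrow> 0 \<le> fenchel_defect W e s"
  using Fenchel_inequality[of e s] by (simp add: fenchel_defect_def)

end

section \<open>Gradients relative to a subspace\<close>

lemma derivative_on_line:
  fixes W :: "real ^ 'd ^ 'd \<Rightarrow> real"
  assumes "(W has_derivative (\<lambda>h. G \<bullet> h)) (at e within sym0)" "e \<in> sym0" "h \<in> sym0"
  shows "((\<lambda>t. W (e + t *\<^sub>R h)) has_real_derivative G \<bullet> h) (at 0)"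
proof -
  have "((\<lambda>t. e + t *\<^sub>R h) has_derivative (\<lambda>t. t *\<^sub>R h)) (at 0)" by (auto intro!: derivative_eq_intros)
  moreover have "range (\<lambda>t. e + t *\<^sub>R h) \<subseteq> sym0"
    using assms(2,3) subspace_add[OF subspace_sym0] subspace_scale[OF subspace_sym0] by blast
  then have "(W has_derivative (\<lambda>h. G \<bullet> h)) (at (e + 0 *\<^sub>R h) within range (\<lambda>t. e + t *\<^sub>R h))"
    using has_derivative_subset[OF assms(1)] by simp
  ultimately have "((\<lambda>t. W (e + t *\<^sub>R h)) has_derivative (\<lambda>t. G \<bullet> (t *\<^sub>R h))) (at 0)"
    by (rule has_derivative_in_compose)
  then show ?thesis by (simp add: has_field_derivative_def mult_commute_abs)
qed

text \<open>
A derivative relative to \<open>S\<close> is only tested in directions of \<open>S\<close>, so the matrix representing it may be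
replaced by its orthogonal projection to \<open>S\<close>.
\<close>

lemma gradient_on_subspace_exists:
  fixes W :: "'a::euclidean_space \<Rightarrow> real"
  assumes "subspace S" and D: "(W has_derivative D) (at e within S)" and "e \<in> S"
  obtains G where "G \<in> S" "(W has_derivative (\<lambda>h. G \<bullet> h)) (at e within S)"
proof -
  define A where "A = (\<Sum>b\<in>Basis. D b *\<^sub>R b)"
  have lin: "linear D" using D by (rule has_derivative_linear)
  have A: "D h = A \<bullet> h" for h
  proof -
    have "D h = (\<Sum>b\<in>Basis. (h \<bullet> b) * D b)"
      using linear_sum[OF lin, of "\<lambda>b. (h \<bullet> b) *\<^sub>R b" Basis] linear_cmul[OF lin]
      by (simp add: euclidean_representation)
    then show ?thesis by (simp add: A_def inner_sum_left inner_sum_right inner_commute mult.commute)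
  qed
  obtain G z where G: "G \<in> span S" and z: "\<And>w. w \<in> span S \<Longrightarrow> orthogonal z w" and Az: "A = G + z"
    using orthogonal_subspace_decomp_exists[of S A] by blast
  have S: "span S = S" using assms(1) by simp
  have eq: "D (y - e) = G \<bullet> (y - e)" if "y \<in> S" for y
    using z[unfolded S, OF subspace_diff[OF assms(1) that assms(3)]] by (simp add: A Az inner_add_left orthogonal_def)
  have "((\<lambda>y. (1 / norm (y - e)) *\<^sub>R (W y - (W e + G \<bullet> (y - e)))) \<longlongrightarrow> 0) (at e within S)"
  proof (rule Lim_transform_eventually)
    show "((\<lambda>y. (1 / norm (y - e)) *\<^sub>R (W y - (W e + D (y - e)))) \<longlongrightarrow> 0) (at e within S)"
      using D unfolding has_derivative_within by blast
    show "\<forall>\<^sub>F y in at e within S. (1 / norm (y - e)) *\<^sub>R (W y - (W e + D (y - e)))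
        = (1 / norm (y - e)) *\<^sub>R (W y - (W e + G \<bullet> (y - e)))"
      using eq by (auto simp: eventually_at_filter)
  qed
  then have "(W has_derivative (\<lambda>h. G \<bullet> h)) (at e within S)"
    unfolding has_derivative_within by (simp add: bounded_linear_inner_right)
  with G S show thesis using that by simp
qed

text \<open>
Two representatives in \<open>sym0\<close> of the derivative agree on all directions in \<open>sym0\<close>, in particular on their
difference. So the definite description in the definition is justified.
\<close>

lemma grad0:
  fixes W :: "real ^ 'd ^ 'd \<Rightarrow> real"
  assumes "W differentiable_on sym0" "e \<in> sym0"
  shows "grad0 W e \<in> sym0" "(W has_derivative (\<lambda>h. grad0 W e \<bullet> h)) (at e within sym0)"
proof -
  let ?P = "\<lambda>G. G \<in> sym0 \<and> (W has_derivative (\<lambda>h. G \<bullet> h)) (at e within sym0)"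
  obtain D where "(W has_derivative D) (at e within sym0)"
    using assms unfolding differentiable_on_def differentiable_def by blast
  then obtain G where G: "?P G" using gradient_on_subspace_exists[OF subspace_sym0 _ assms(2)] by metis
  moreover have "G' = G" if "?P G'" for G'
  proof -
    have "G' - G \<in> sym0" using G that subspace_diff[OF subspace_sym0] by blast
    then have "G' \<bullet> (G' - G) = G \<bullet> (G' - G)"
      using G that assms(2) derivative_on_line DERIV_unique by metis
    then have "(G' - G) \<bullet> (G' - G) = 0" by (simp add: inner_diff_left)
    then show ?thesis by simp
  qed
  ultimately have "?P (grad0 W e)" unfolding grad0_def by (rule theI)
  then show "grad0 W e \<in> sym0" "(W has_derivative (\<lambda>h. grad0 W e \<bullet> h)) (at e within sym0)" by auto
qed

text \<open>
Convexity along the segment from \<open>e\<close> to \<open>e'\<close>, where the slope at \<open>e\<close> is given by the gradient.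
\<close>

lemma subgradient:
  fixes W :: "real ^ 'd ^ 'd \<Rightarrow> real"
  assumes "W differentiable_on sym0" "convex_on sym0 W" "e \<in> sym0" "e' \<in> sym0"
  shows "W e + grad0 W e \<bullet> (e' - e) \<le> W e'"
proof -
  define h where "h = e' - e"
  have h: "h \<in> sym0" unfolding h_def using assms(3,4) by (intro subspace_diff[OF subspace_sym0])
  have mem: "e + t *\<^sub>R h \<in> sym0" for t
    using h assms(3) subspace_add[OF subspace_sym0] subspace_scale[OF subspace_sym0] by blast
  have "convex_on UNIV (\<lambda>t. W (e + t *\<^sub>R h))"
  proof (rule convex_onI)
    fix t x y :: real assume t: "0 < t" "t < 1"
    have "e + ((1 - t) *\<^sub>R x + t *\<^sub>R y) *\<^sub>R h = (1 - t) *\<^sub>R (e + x *\<^sub>R h) + t *\<^sub>R (e + y *\<^sub>R h)"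
      by (simp add: algebra_simps)
    then show "W (e + ((1 - t) *\<^sub>R x + t *\<^sub>R y) *\<^sub>R h) \<le> (1 - t) * W (e + x *\<^sub>R h) + t * W (e + y *\<^sub>R h)"
      using convex_onD[OF assms(2), of t "e + x *\<^sub>R h" "e + y *\<^sub>R h"] t mem by simp
  qed simp
  moreover have "((\<lambda>t. W (e + t *\<^sub>R h)) has_real_derivative grad0 W e \<bullet> h) (at 0)"
    by (rule derivative_on_line[OF grad0(2)[OF assms(1,3)] assms(3) h])
  ultimately have "W (e + 1 *\<^sub>R h) - W (e + 0 *\<^sub>R h) \<ge> grad0 W e \<bullet> h * (1 - 0)"
    by (intro convex_on_imp_above_tangent[where A = UNIV]) auto
  then show ?thesis by (simp add: h_def)
qed

text \<open>
The defect vanishes exactly if \<open>e\<close> maximises \<open>e \<bullet> s - W e\<close>. The gradient satisfies this by the subgradient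
inequality; conversely the first-order condition at a maximum is tested with the direction
\<open>grad0 W e - s\<close>.
\<close>

lemma fenchel_defect_eq_0_iff:
  fixes W :: "real ^ 'd ^ 'd \<Rightarrow> real"
  assumes W: "C1_sym0 W" "superlinear_growth W" "convex_on sym0 W" and e: "e \<in> sym0" and s: "s \<in> sym0"
  shows "s = grad0 W e \<longleftrightarrow> fenchel_defect W e s = 0"
proof
  have diff: "W differentiable_on sym0" using W(1) by (simp add: C1_sym0_def)
  assume s: "s = grad0 W e"
  have "convex_conjugate W s \<le> e \<bullet> s - W e"
  proof (rule convex_conjugate_le)
    fix e' :: "real ^ 'd ^ 'd" assume "e' \<in> sym0"
    from subgradient[OF diff W(3) e this]
    show "e' \<bullet> s - W e' \<le> e \<bullet> s - W e" by (simp add: s inner_diff_right inner_commute)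
  qed
  then show "fenchel_defect W e s = 0"
    using fenchel_defect_nonneg[OF W(1,2) e, of s] by (simp add: fenchel_defect_def)
next
  have diff: "W differentiable_on sym0" using W(1) by (simp add: C1_sym0_def)
  assume "fenchel_defect W e s = 0"
  then have min: "e' \<bullet> s - W e' \<le> e \<bullet> s - W e" if "e' \<in> sym0" for e'
    using Fenchel_inequality[OF W(1,2) that, of s] by (simp add: fenchel_defect_def)
  define h where "h = grad0 W e - s"
  have h: "h \<in> sym0" unfolding h_def by (intro subspace_diff[OF subspace_sym0] grad0(1) diff e s)
  have "((\<lambda>t. W (e + t *\<^sub>R h) - t * (h \<bullet> s)) has_real_derivative grad0 W e \<bullet> h - h \<bullet> s) (at 0)"
    by (intro DERIV_diff derivative_on_line[OF grad0(2)[OF diff e] e h]) (auto intro!: derivative_eq_intros)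
  moreover have "W (e + 0 *\<^sub>R h) - 0 * (h \<bullet> s) \<le> W (e + t *\<^sub>R h) - t * (h \<bullet> s)" for t
  proof -
    have "e + t *\<^sub>R h \<in> sym0"
      using h e subspace_add[OF subspace_sym0] subspace_scale[OF subspace_sym0] by blast
    from min[OF this] show ?thesis by (simp add: inner_add_left)
  qed
  ultimately have "grad0 W e \<bullet> h - h \<bullet> s = 0"
    by (intro DERIV_local_min[where d = 1]) auto
  then have "h \<bullet> h = 0" unfolding h_def by (simp add: inner_diff_left inner_diff_right inner_commute)
  then show "s = grad0 W e" by (simp add: h_def)
qed

section \<open>Growth of the conjugate\<close>

lemma conjugate_exponent:
  fixes p :: real
  assumes "1 < p"
  defines "q \<equiv> p / (p - 1)"
  shows "1 < q" "1 / p + 1 / q = 1" "(q - 1) * p = q"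
  using assms by (auto simp: q_def field_simps)

lemma Young_weak:
  fixes p :: real
  assumes "1 < p" "0 \<le> a" "0 \<le> b"
  shows "a * b \<le> a powr p + b powr (p / (p - 1))"
proof -
  note q = conjugate_exponent[OF assms(1)]
  have "a * b \<le> a powr p / p + b powr (p / (p - 1)) / (p / (p - 1))"
    by (rule Youngs_inequality[OF assms(1) q(1,2) assms(2,3)])
  also have "\<dots> \<le> a powr p + b powr (p / (p - 1))"
  proof -
    have div: "x / r \<le> x" if "0 \<le> x" "1 < r" for x r :: real
      using that mult_left_mono[of 1 r x] by (simp add: divide_le_eq)
    show ?thesis by (intro add_mono div assms(1) q(1)) auto
  qed
  finally show ?thesis .
qed

text \<open>
Young's inequality is applied after rescaling by \<open>c2 powr (1 / p)\<close>, so that its first term is exactly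
the lower bound of \<open>W\<close> and cancels.
\<close>

lemma convex_conjugate_growth_upper:
  fixes W :: "real ^ 'd ^ 'd \<Rightarrow> real"
  assumes "1 < p" "0 < c2" and W: "\<And>e. e \<in> sym0 \<Longrightarrow> c2 * norm e powr p - c3 \<le> W e"
  shows "convex_conjugate W s \<le> (inverse (c2 powr (1 / p))) powr (p / (p - 1)) * norm s powr (p / (p - 1)) + c3"
proof (rule convex_conjugate_le)
  fix e :: "real ^ 'd ^ 'd" assume e: "e \<in> sym0"
  let ?l = "c2 powr (1 / p)"
  have "norm e * norm s = (?l * norm e) * (inverse ?l * norm s)"
    using assms(2) by simp
  also have "\<dots> \<le> (?l * norm e) powr p + (inverse ?l * norm s) powr (p / (p - 1))"
    by (rule Young_weak[OF assms(1)]) auto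
  also have "\<dots> = c2 * norm e powr p + inverse ?l powr (p / (p - 1)) * norm s powr (p / (p - 1))"
    using assms(1,2) by (simp add: powr_mult powr_powr)
  finally have "norm e * norm s \<le> c2 * norm e powr p + inverse ?l powr (p / (p - 1)) * norm s powr (p / (p - 1))" .
  then show "e \<bullet> s - W e \<le> inverse ?l powr (p / (p - 1)) * norm s powr (p / (p - 1)) + c3"
    using W[OF e] norm_cauchy_schwarz[of e s] by linarith
qed

text \<open>
The supremum is tested with the multiple of \<open>s\<close> of norm \<open>\<mu> * norm s powr (q - 1)\<close>. Then \<open>e \<bullet> s\<close> and
the upper bound of \<open>W e\<close> both scale like \<open>norm s powr q\<close>, and \<open>\<mu>\<close> is such that the second takes away half of
the first.
\<close>

lemma convex_conjugate_growth_lower: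
  fixes W :: "real ^ 'd ^ 'd \<Rightarrow> real"
  assumes "C1_sym0 W" "superlinear_growth W" and "1 < p" "0 < c1"
    and W: "\<And>e. e \<in> sym0 \<Longrightarrow> W e \<le> c1 * (norm e powr p + 1)" and s: "s \<in> sym0"
  defines "\<mu> \<equiv> (1 / (2 * c1)) powr (1 / (p - 1))"
  shows "\<mu> / 2 * norm s powr (p / (p - 1)) - c1 \<le> convex_conjugate W s"
proof (cases "s = 0")
  case True
  then show ?thesis
    using Fenchel_inequality[OF assms(1,2) subspace_0[OF subspace_sym0], of 0] W[OF subspace_0[OF subspace_sym0]]
    by simp
next
  case False
  define q where "q = p / (p - 1)"
  note q = conjugate_exponent[OF assms(3), folded q_def]
  have n: "0 < norm s" using False by simp
  have \<mu>: "0 < \<mu>" "c1 * \<mu> powr p = \<mu> / 2"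
  proof -
    show "0 < \<mu>" using assms(4) by (simp add: \<mu>_def)
    have "\<mu> powr p = \<mu> powr (p - 1) * \<mu>" using \<open>0 < \<mu>\<close> by (simp add: powr_diff)
    also have "\<mu> powr (p - 1) = 1 / (2 * c1)" using assms(3,4) by (simp add: \<mu>_def powr_powr)
    finally show "c1 * \<mu> powr p = \<mu> / 2" using assms(4) by simp
  qed
  \<comment> \<open>the test matrix; \<open>W\<close> is bounded above on it through its norm\<close>
  let ?e = "(\<mu> * norm s powr (q - 2)) *\<^sub>R s"
  have e: "?e \<in> sym0" using s by (rule subspace_scale[OF subspace_sym0])
  have "norm s powr (q - 2) * norm s = norm s powr (q - 1)"
    using n powr_add[of "norm s" "q - 2" 1] by simp
  then have ne: "norm ?e = \<mu> * norm s powr (q - 1)" using \<mu>(1) by (simp add: mult.assoc)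
  have "?e \<bullet> s = \<mu> * (norm s powr (q - 2) * (norm s)\<^sup>2)"
    by (simp add: power2_norm_eq_inner)
  also have "norm s powr (q - 2) * (norm s)\<^sup>2 = norm s powr q"
    using n powr_add[of "norm s" "q - 2" 2] by simp
  finally have es: "?e \<bullet> s = \<mu> * norm s powr q" .
  have "W ?e \<le> c1 * (\<mu> powr p * norm s powr ((q - 1) * p) + 1)"
    using W[OF e] unfolding ne using \<mu>(1) by (simp add: powr_mult powr_powr)
  also have "\<dots> = c1 * \<mu> powr p * norm s powr q + c1" unfolding q(3) by (simp add: algebra_simps)
  finally have "W ?e \<le> \<mu> / 2 * norm s powr q + c1" unfolding \<mu>(2) .
  then show ?thesis
    using Fenchel_inequality[OF assms(1,2) e, of s] unfolding es unfolding q_def by linarith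
qed

lemma fenchel_defect_growth:
  fixes W :: "real ^ 'd ^ 'd \<Rightarrow> real"
  assumes W: "C1_sym0 W" "superlinear_growth W" and p: "1 < p" and c: "0 < c1" "0 < c2" "0 < c3"
    and bounds: "\<And>e. e \<in> sym0 \<Longrightarrow> W e \<le> c1 * (norm e powr p + 1)"
      "\<And>e. e \<in> sym0 \<Longrightarrow> c2 * norm e powr p - c3 \<le> W e"
  defines "q \<equiv> p / (p - 1)"
  shows "\<exists>C1 C2 C3 C4 :: real. 0 < C1 \<and> 0 < C2 \<and> 0 < C3 \<and> 0 < C4 \<and>
    (\<forall>e\<in>sym0. \<forall>s\<in>sym0. C1 * (norm e powr p + norm s powr q + 1) \<ge> fenchel_defect W e s \<and>
       fenchel_defect W e s \<ge> C2 * (norm e powr p + norm s powr q) - C3 - C4 * (e \<bullet> s))"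
proof -
  define L where "L = inverse (c2 powr (1 / p)) powr q"
  define \<mu> where "\<mu> = (1 / (2 * c1)) powr (1 / (p - 1))"
  have L: "0 \<le> L" and \<mu>: "0 < \<mu>" using c by (auto simp: L_def \<mu>_def)
  have upper: "fenchel_defect W e s \<le> (c1 + 1 + L + c3) * (norm e powr p + norm s powr q + 1)"
    if e: "e \<in> sym0" for e s
  proof -
    have "fenchel_defect W e s \<le> c1 * (norm e powr p + 1) + (L * norm s powr q + c3) + (norm e powr p + norm s powr q)"
      using bounds(1)[OF e] convex_conjugate_growth_upper[OF p c(2) bounds(2), of s, folded q_def, folded L_def]
        Young_weak[OF p norm_ge_zero norm_ge_zero, of e s, folded q_def] Cauchy_Schwarz_ineq2[of e s]
      unfolding fenchel_defect_def by linarith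
    also have "\<dots> \<le> (c1 + 1 + L + c3) * (norm e powr p + norm s powr q + 1)"
    proof -
      have "0 \<le> (L + c3) * norm e powr p" "0 \<le> (c1 + c3) * norm s powr q" "0 \<le> 1 + L"
        using L c by auto
      then show ?thesis by (simp add: algebra_simps)
    qed
    finally show ?thesis .
  qed
  have lower: "min c2 (\<mu> / 2) * (norm e powr p + norm s powr q) - (c1 + c3) - 1 * (e \<bullet> s) \<le> fenchel_defect W e s"
    if e: "e \<in> sym0" and s: "s \<in> sym0" for e s
  proof -
    have "min c2 (\<mu> / 2) * norm e powr p \<le> c2 * norm e powr p" "min c2 (\<mu> / 2) * norm s powr q \<le> \<mu> / 2 * norm s powr q"
      by (intro mult_right_mono; simp)+
    then show ?thesis
      using bounds(2)[OF e] convex_conjugate_growth_lower[OF W p c(1) bounds(1) s, folded q_def, folded \<mu>_def]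
      unfolding fenchel_defect_def distrib_left by linarith
  qed
  show ?thesis
    by (rule exI[of _ "c1 + 1 + L + c3"], rule exI[of _ "min c2 (\<mu> / 2)"], rule exI[of _ "c1 + c3"], rule exI[of _ 1])
      (use upper lower L \<mu> c in auto)
qed

section \<open>Quasiconvexity\<close>

text \<open>
A Jensen inequality. The integrand is bounded below, for each competitor \<open>e'\<close> in the supremum defining
the conjugate, by a function that is affine in \<open>(\<epsilon>, \<sigma>)\<close> minus \<open>\<epsilon> \<bullet> \<sigma>\<close>. Both the linear part and
\<open>\<epsilon> \<bullet> \<sigma>\<close> integrate to zero.
\<close>

lemma fenchel_defect_quasiconvex:
  fixes W :: "real ^ 'd ^ 'd \<Rightarrow> real"
  assumes W: "C1_sym0 W" "superlinear_growth W" "convex_on sym0 W"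
  shows "A_tilde_quasiconvex (fenchel_defect W)"
  unfolding A_tilde_quasiconvex_def
proof (intro conjI ballI allI impI; (elim conjE)?)
  show "continuous_on (sym0 \<times> sym0) (\<lambda>(e, s). fenchel_defect W e s)"
    by (rule fenchel_defect_continuous[OF W(1,2)])
  show "0 \<le> fenchel_defect W e s" if "e \<in> sym0" for e s
    by (rule fenchel_defect_nonneg[OF W(1,2) that])
  fix e s :: "real ^ 'd ^ 'd" and \<epsilon> \<sigma> :: "real \<times> (real ^ 'd) \<Rightarrow> real ^ 'd ^ 'd"
  assume e: "e \<in> sym0" and s: "s \<in> sym0" and mem: "\<forall>z. \<epsilon> z \<in> sym0" "\<forall>z. \<sigma> z \<in> sym0"
    and per: "periodic \<epsilon>" "periodic \<sigma>" and smooth: "C_infinity \<epsilon>" "C_infinity \<sigma>"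
    and mean: "zero_mean \<epsilon>" "zero_mean \<sigma>" and A: "\<forall>z. A_tilde \<epsilon> \<sigma> z = 0"
  let ?Q = "cbox 0 One :: (real \<times> (real ^ 'd)) set"
  have diff: "W differentiable_on sym0" using W(1) by (simp add: C1_sym0_def)
  have mem': "e + \<epsilon> z \<in> sym0" "s + \<sigma> z \<in> sym0" for z
    using e s mem subspace_add[OF subspace_sym0] by blast+
  have cont: "continuous_on ?Q \<epsilon>" "continuous_on ?Q \<sigma>" using smooth C_infinityD(4) by blast+
  have int: "\<epsilon> integrable_on ?Q" "\<sigma> integrable_on ?Q" "(\<lambda>z. \<epsilon> z \<bullet> \<sigma> z) integrable_on ?Q"
    by (intro integrable_continuous continuous_intros cont)+
  have hi: "(\<epsilon> has_integral 0) ?Q" "(\<sigma> has_integral 0) ?Q" "((\<lambda>z. \<epsilon> z \<bullet> \<sigma> z) has_integral 0) ?Q"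
    using int[THEN integrable_integral] mean A_tilde_null_orthogonal[OF _ _ per smooth mean(1)] mem A
    by (simp_all add: zero_mean_def)
  have lin: "((\<lambda>z. k \<bullet> \<epsilon> z) has_integral 0) ?Q" "((\<lambda>z. k \<bullet> \<sigma> z) has_integral 0) ?Q" for k
    using has_integral_linear[OF hi(1) bounded_linear_inner_right[of k]]
      has_integral_linear[OF hi(2) bounded_linear_inner_right[of k]] by (simp_all add: o_def)
  have const: "((\<lambda>z. c) has_integral c) ?Q" for c :: real
    using has_integral_const[of c "0 :: real \<times> (real ^ 'd)" One] by simp
  define I where "I = integral ?Q (\<lambda>z. fenchel_defect W (e + \<epsilon> z) (s + \<sigma> z))"
  have "continuous_on ?Q (\<lambda>z. (e + \<epsilon> z, s + \<sigma> z))" by (intro continuous_intros cont)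
  from continuous_on_compose2[OF fenchel_defect_continuous[OF W(1,2)] this] mem'
  have "continuous_on ?Q (\<lambda>z. fenchel_defect W (e + \<epsilon> z) (s + \<sigma> z))" by (simp add: image_subset_iff)
  then have I: "((\<lambda>z. fenchel_defect W (e + \<epsilon> z) (s + \<sigma> z)) has_integral I) ?Q"
    unfolding I_def by (intro integrable_integral integrable_continuous)
  have "convex_conjugate W s \<le> I - W e + e \<bullet> s"
  proof (rule convex_conjugate_le)
    fix e' :: "real ^ 'd ^ 'd" assume e': "e' \<in> sym0"
    let ?c = "W e + (e' \<bullet> s - W e') - e \<bullet> s"
    have "((\<lambda>z. ?c + (grad0 W e - s) \<bullet> \<epsilon> z + (e' - e) \<bullet> \<sigma> z - \<epsilon> z \<bullet> \<sigma> z) has_integral ?c + 0 + 0 - 0) ?Q"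
      by (intro has_integral_diff has_integral_add const lin hi)
    moreover have "?c + (grad0 W e - s) \<bullet> \<epsilon> z + (e' - e) \<bullet> \<sigma> z - \<epsilon> z \<bullet> \<sigma> z
        \<le> fenchel_defect W (e + \<epsilon> z) (s + \<sigma> z)" for z
      using subgradient[OF diff W(3) e mem'(1)[of z]] Fenchel_inequality[OF W(1,2) e', of "s + \<sigma> z"]
      unfolding fenchel_defect_def by (simp add: inner_simps inner_commute)
    ultimately have "?c + 0 + 0 - 0 \<le> I" by (rule has_integral_le[OF _ I])
    then show "e' \<bullet> s - W e' \<le> I - W e + e \<bullet> s" by simp
  qed
  then show "fenchel_defect W e s \<le> integral ?Q (\<lambda>z. fenchel_defect W (e + \<epsilon> z) (s + \<sigma> z))"
    unfolding I_def fenchel_defect_def by simp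
qed

theorem lemma6p1:
  fixes W :: "real ^ 'd ^ 'd \<Rightarrow> real"
  assumes "CARD('d) \<ge> 2"
    and "C1_sym0 W"
    and "convex_on sym0 W"
    and "superlinear_growth W"
  shows "let f = fenchel_defect W in
    (continuous_on (sym0 \<times> sym0) (\<lambda>(e, s). f e s) \<and> (\<forall>e\<in>sym0. \<forall>s\<in>sym0. 0 \<le> f e s)) \<and>
    (\<forall>p c1 c2 c3 :: real.
       1 < p \<and> 0 < c1 \<and> 0 < c2 \<and> 0 < c3 \<and>
       (\<forall>e\<in>sym0. c1 * (norm e powr p + 1) \<ge> W e \<and> W e \<ge> c2 * norm e powr p - c3) \<longrightarrow>
       (let q = p / (p - 1) in
        \<exists>C1 C2 C3 C4 :: real. 0 < C1 \<and> 0 < C2 \<and> 0 < C3 \<and> 0 < C4 \<and>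
          (\<forall>e\<in>sym0. \<forall>s\<in>sym0.
             C1 * (norm e powr p + norm s powr q + 1) \<ge> f e s \<and>
             f e s \<ge> C2 * (norm e powr p + norm s powr q) - C3 - C4 * (e \<bullet> s)))) \<and>
    (\<forall>e\<in>sym0. \<forall>s\<in>sym0. s = grad0 W e \<longleftrightarrow> f e s = 0) \<and>
    A_tilde_quasiconvex f"
  unfolding Let_def
proof (intro conjI allI impI)
  show "continuous_on (sym0 \<times> sym0) (\<lambda>(e, s). fenchel_defect W e s)"
    by (rule fenchel_defect_continuous[OF assms(2,4)])
  show "\<forall>e\<in>sym0. \<forall>s\<in>sym0. 0 \<le> fenchel_defect W e s"
    using fenchel_defect_nonneg[OF assms(2,4)] by blast
  show "\<forall>e\<in>sym0. \<forall>s\<in>sym0. s = grad0 W e \<longleftrightarrow> fenchel_defect W e s = 0"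
    using fenchel_defect_eq_0_iff[OF assms(2,4,3)] by blast
  show "A_tilde_quasiconvex (fenchel_defect W)"
    by (rule fenchel_defect_quasiconvex[OF assms(2,4,3)])
  fix p c1 c2 c3 :: real
  assume "1 < p \<and> 0 < c1 \<and> 0 < c2 \<and> 0 < c3 \<and>
    (\<forall>e\<in>sym0. c1 * (norm e powr p + 1) \<ge> W e \<and> W e \<ge> c2 * norm e powr p - c3)"
  then show "\<exists>C1 C2 C3 C4 :: real. 0 < C1 \<and> 0 < C2 \<and> 0 < C3 \<and> 0 < C4 \<and>
    (\<forall>e\<in>sym0. \<forall>s\<in>sym0.
       C1 * (norm e powr p + norm s powr (p / (p - 1)) + 1) \<ge> fenchel_defect W e s \<and>
       fenchel_defect W e s \<ge> C2 * (norm e powr p + norm s powr (p / (p - 1))) - C3 - C4 * (e \<bullet> s))"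
    by (intro fenchel_defect_growth[OF assms(2,4), of p c1 c2 c3]) auto
qed

end
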